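(* Let $\Omega\subset\mathbb R^n$ be non-empty, open and convex. If $F\in HAP(T_\Omega,\mathbb C^m)$, then $\mathcal O(F)=\overline{\mathcal B(F)}$, where $\mathcal O(F)=\{F_\chi : \chi\in\mathrm{Ch}\,\mathbb R^n\}$ is the set of all perturbations of $F$ by characters of $\mathbb R^n$ and $\overline{\mathcal B(F)}$ is the closure in $HAP(T_\Omega,\mathbb C^m)$ of the Bochner transform of $F$.
   Context: Almost periodic mappings. $T_\Omega=\mathbb R^n+i\Omega\subset\mathbb C^n$; $\Omega'\Subset\Omega$ means that $\Omega'$ is relatively compact in $\Omega$. A holomorphic mapping $F=(f_1,\ldots,f_m):T_\Omega\to\mathbb C^m$ is almost periodic if for every $\varepsilon>0$ and every $\Omega'\Subset\Omega$ there is an $n$-tuple $t$ of positive reals such that for each $\xi\in\mathbb R^n$ the set $\{x\in\mathbb R^n: |x_\ell-\xi_\ell|<t_\ell,\ 1\le\ell\le n\}$ contains a point $\tau$ with $\sup_{z\in T_{\Omega'}}\max_{\ell}|f_\ell(z+\tau)-f_\ell(z)|<\varepsilon$. $HAP(T_\Omega,\mathbb C^m)$ is the space of such mappings, with the topology $\tau(T_\Omega)$ of uniform convergence on every $T_{\Omega'}$, $\Omega'\Subset\Omega$. $\mathcal B(F)=\{F(\cdot+t): t\in\mathbb R^n\}$. Spectra. $\langle z,w\rangle=\sum_j z_j\overline{w_j}$. For a component $f$ of $F$ and $\lambda\in\mathbb R^n$, $a(\lambda,f)=\lim_{s\to+\infty}(2s)^{-n}\int_{|x_j|<s,\,j=1,\dots,n}e^{-i\langle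 x+iy,\lambda\rangle}f(x+iy)\,dx$ (independent of $y\in\Omega$), and $\mathrm{Sp} f=\{\lambda\in\mathbb R^n: a(\lambda,f)\ne0\}$ (at most countable). $\Xi_F$ is the additive subgroup of $\mathbb R^n$ generated by $\bigcup_\ell \mathrm{Sp} f_\ell$, and $\mathrm{lin}_{\mathbb Q}\Xi_F$ is its $\mathbb Q$-linear span. Bochner-Fejer approximation. Fix a basis $\{\omega_r\}_{r\in\mathbb N}$ of $\mathrm{lin}_{\mathbb Q}\Xi_F$. For $j\in\mathbb N$, $Q_j(F)=(Q_j(f_1),\ldots,Q_j(f_m))$ with $$Q_j(f_\ell)(z)=\sum\prod_{r=1}^j\Big(1-\frac{|\nu_r|}{(j!)^2}\Big)\,a\Big(\sum_{r=1}^j\nu_r\frac{\omega_r}{j!},f_\ell\Big)\exp\Big(i\sum_{r=1}^j\nu_r\langle z,\tfrac{\omega_r}{j!}\rangle\Big),$$ the first sum being over integers $\nu_1,\ldots,\nu_j$ of absolute value at most $(j!)^2$. (If $\mathrm{lin}_{\mathbb Q}\Xi_F$ has finite dimension $d$, the index $r$ runs only up to $\min(j,d)$.) Perturbation. $\mathrm{Ch}\,\mathbb R^n=\mathrm{Hom}_{\mathbb Z}(\mathbb R^n,\mathbb S^1)$ is the group of all (not necessarily continuous) characters. For $\chi\in\mathrm{Ch}\,\mathbb R^n$ and a finite exponential sum $g(z)=\sum_{\lambda\in\mathrm{Sp} g}a(\lambda,g)e^{i\langle z,\lambda\rangle}$ put $g_\chi(z)=\sum_{\lambda\in\mathrm{Sp}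 g}a(\lambda,g)\chi(\lambda)e^{i\langle z,\lambda\rangle}$, and perturb mappings componentwise. For general $F\in HAP(T_\Omega,\mathbb C^m)$, $F_\chi=\lim_{j\to+\infty}Q_j(F)_\chi$ in the topology $\tau(T_\Omega)$, with $Q_j(F)$ the Bochner-Fejer approximation for some choice of basis (this limit exists). *)

theory Defs
  imports
    "HOL-Analysis.Analysis"
    "HOL-Library.Extended_Nat"
    "HOL-Computational_Algebra.Group_Closure"
begin

section \<open>Tubes and holomorphic mappings\<close>

definition cplx :: "real ^ 'n \<Rightarrow> real ^ 'n \<Rightarrow> complex ^ 'n" where
  "cplx x y = (\<chi> j. Complex (x $ j) (y $ j))"

definition rvec :: "real ^ 'n \<Rightarrow> complex ^ 'n" where
  "rvec x = (\<chi> j. complex_of_real (x $ j))"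

definition tube :: "(real ^ 'n) set \<Rightarrow> (complex ^ 'n) set" where
  "tube \<Omega> = {cplx x y | x y. y \<in> \<Omega>}"

definition herm :: "complex ^ 'n \<Rightarrow> complex ^ 'n \<Rightarrow> complex" where
  "herm z w = (\<Sum>j\<in>UNIV. z $ j * cnj (w $ j))"

definition rel_compact_in :: "'a::topological_space set \<Rightarrow> 'a set \<Rightarrow> bool" where
  "rel_compact_in A \<Omega> \<longleftrightarrow> compact (closure A) \<and> closure A \<subseteq> \<Omega>"

text \<open>Holomorphy in several variables (on open sets): the real Frechet derivative exists and is
  complex linear.\<close>

definition holomorphic_map :: "(complex ^ 'n \<Rightarrow> complex ^ 'm) \<Rightarrow> (complex ^ 'n) set \<Rightarrow> bool" where
  "holomorphic_map F S \<longleftrightarrow>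
     (\<forall>z\<in>S. \<exists>L. (F has_derivative L) (at z) \<and> (\<forall>c v. L (c *s v) = c *s L v))"

section \<open>Almost periodic mappings\<close>

text \<open>The uniform distance takes values in the extended reals, so that it is meaningful
  for unbounded differences; it is \<open>0\<close> on the empty set.\<close>

definition unif_dist ::
  "(complex ^ 'n) set \<Rightarrow> (complex ^ 'n \<Rightarrow> complex ^ 'm) \<Rightarrow> (complex ^ 'n \<Rightarrow> complex ^ 'm) \<Rightarrow> ennreal" where
  "unif_dist S F G = (SUP z\<in>S. ennreal (MAX l\<in>UNIV. cmod (F z $ l - G z $ l)))"

definition almost_periodic :: "(real ^ 'n) set \<Rightarrow> (complex ^ 'n \<Rightarrow> complex ^ 'm) \<Rightarrow> bool" where
  "almost_periodic \<Omega> F \<longleftrightarrow>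
     (\<forall>\<epsilon>>0. \<forall>\<Omega>'. rel_compact_in \<Omega>' \<Omega> \<longrightarrow>
        (\<exists>t::real ^ 'n. (\<forall>l. 0 < t $ l) \<and>
           (\<forall>\<xi>. \<exists>\<tau>. (\<forall>l. \<bar>\<tau> $ l - \<xi> $ l\<bar> < t $ l) \<and>
              unif_dist (tube \<Omega>') (\<lambda>z. F (z + rvec \<tau>)) F < ennreal \<epsilon>)))"

text \<open>A mapping defined on the tube is represented by the total function that is
  \<open>undefined\<close> outside the tube, so that equality is equality on the tube.\<close>

definition HAP :: "(real ^ 'n) set \<Rightarrow> (complex ^ 'n \<Rightarrow> complex ^ 'm) set" where
  "HAP \<Omega> = {F \<in> extensional (tube \<Omega>). holomorphic_map F (tube \<Omega>) \<and> almost_periodic \<Omega> F}"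

definition hap_topology :: "(real ^ 'n) set \<Rightarrow> (complex ^ 'n \<Rightarrow> complex ^ 'm) topology" where
  "hap_topology \<Omega> = topology_generated_by
     {{G \<in> HAP \<Omega>. unif_dist (tube \<Omega>') G F < ennreal \<epsilon>} | F \<Omega>' \<epsilon>.
        F \<in> HAP \<Omega> \<and> rel_compact_in \<Omega>' \<Omega> \<and> 0 < \<epsilon>}"

definition bochner_transform ::
  "(real ^ 'n) set \<Rightarrow> (complex ^ 'n \<Rightarrow> complex ^ 'm) \<Rightarrow> (complex ^ 'n \<Rightarrow> complex ^ 'm) set" where
  "bochner_transform \<Omega> F = {restrict (\<lambda>z. F (z + rvec t)) (tube \<Omega>) | t. True}"

section \<open>Spectra\<close>

text \<open>The description below is the common value, for all \<open>y \<in> \<Omega>\<close>, of the limit.\<close>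

definition fourier_coeff ::
  "(real ^ 'n) set \<Rightarrow> real ^ 'n \<Rightarrow> (complex ^ 'n \<Rightarrow> complex) \<Rightarrow> complex" where
  "fourier_coeff \<Omega> \<mu> f = (THE c. \<forall>y\<in>\<Omega>.
     ((\<lambda>s::real. complex_of_real (1 / (2 * s) ^ CARD('n)) *
         (LINT x:{x. \<forall>j. \<bar>x $ j\<bar> < s}|lborel.
            exp (- (\<i> * herm (cplx x y) (rvec \<mu>))) * f (cplx x y)))
       \<longlongrightarrow> c) at_top)"

definition spectrum :: "(real ^ 'n) set \<Rightarrow> (complex ^ 'n \<Rightarrow> complex) \<Rightarrow> (real ^ 'n) set" where
  "spectrum \<Omega> f = {\<mu>. fourier_coeff \<Omega> \<mu> f \<noteq> 0}"

definition spectral_group ::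
  "(real ^ 'n) set \<Rightarrow> (complex ^ 'n \<Rightarrow> complex ^ 'm) \<Rightarrow> (real ^ 'n) set" where
  "spectral_group \<Omega> F = group_closure (\<Union>l. spectrum \<Omega> (\<lambda>z. F z $ l))"

section \<open>Bochner-Fejer approximation\<close>

interpretation ratvec: vector_space "\<lambda>(q::rat) (v::'a::real_vector). (of_rat q :: real) *\<^sub>R v"
  by unfold_locales (simp_all add: algebra_simps of_rat_add of_rat_mult)

text \<open>The vectors \<open>\<omega> 1, \<omega> 2, \<dots>\<close> (only up to \<open>\<omega> d\<close> if \<open>d\<close> is finite) are pairwise distinct
  and form a basis of \<open>V\<close> over the rationals; other values of \<open>\<omega>\<close> are irrelevant.\<close>

definition is_rat_basis :: "(nat \<Rightarrow> 'a::real_vector) \<Rightarrow> enat \<Rightarrow> 'a set \<Rightarrow> bool" where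
  "is_rat_basis \<omega> d V \<longleftrightarrow>
     inj_on \<omega> {r. 1 \<le> r \<and> enat r \<le> d} \<and>
     ratvec.independent (\<omega> ` {r. 1 \<le> r \<and> enat r \<le> d}) \<and>
     ratvec.span (\<omega> ` {r. 1 \<le> r \<and> enat r \<le> d}) = V"

text \<open>In the following, \<open>I\<close> is \<open>{1..min j d}\<close>.\<close>

definition bochner_fejer ::
  "(real ^ 'n) set \<Rightarrow> (nat \<Rightarrow> real ^ 'n) \<Rightarrow> enat \<Rightarrow> nat \<Rightarrow> (complex ^ 'n \<Rightarrow> complex) \<Rightarrow>
   complex ^ 'n \<Rightarrow> complex" where
  "bochner_fejer \<Omega> \<omega> d j f z =
     (let I = {r \<in> {1..j}. enat r \<le> d} in
      \<Sum>\<nu> \<in> I \<rightarrow>\<^sub>E {\<nu>::int. \<bar>\<nu>\<bar> \<le> (fact j)\<^sup>2}.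
        complex_of_real (\<Prod>r\<in>I. 1 - real_of_int \<bar>\<nu> r\<bar> / (fact j)\<^sup>2) *
        fourier_coeff \<Omega> (\<Sum>r\<in>I. of_int (\<nu> r) *\<^sub>R (\<omega> r /\<^sub>R fact j)) f *
        exp (\<i> * (\<Sum>r\<in>I. of_int (\<nu> r) * herm z (rvec (\<omega> r /\<^sub>R fact j)))))"

section \<open>Perturbation by characters\<close>

definition characters :: "(real ^ 'n \<Rightarrow> complex) set" where
  "characters = {\<gamma>. (\<forall>\<mu>. cmod (\<gamma> \<mu>) = 1) \<and> (\<forall>\<mu> \<mu>'. \<gamma> (\<mu> + \<mu>') = \<gamma> \<mu> * \<gamma> \<mu>')}"

text \<open>For finite exponential sums \<open>g\<close>, whose spectrum is finite.\<close>

definition perturb_sum ::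
  "(real ^ 'n) set \<Rightarrow> (real ^ 'n \<Rightarrow> complex) \<Rightarrow> (complex ^ 'n \<Rightarrow> complex) \<Rightarrow> complex ^ 'n \<Rightarrow> complex" where
  "perturb_sum \<Omega> \<gamma> g z =
     (\<Sum>\<mu>\<in>spectrum \<Omega> g. fourier_coeff \<Omega> \<mu> g * \<gamma> \<mu> * exp (\<i> * herm z (rvec \<mu>)))"

definition perturbed_bochner_fejer ::
  "(real ^ 'n) set \<Rightarrow> (nat \<Rightarrow> real ^ 'n) \<Rightarrow> enat \<Rightarrow> (real ^ 'n \<Rightarrow> complex) \<Rightarrow>
   (complex ^ 'n \<Rightarrow> complex ^ 'm) \<Rightarrow> nat \<Rightarrow> complex ^ 'n \<Rightarrow> complex ^ 'm" where
  "perturbed_bochner_fejer \<Omega> \<omega> d \<gamma> F j =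
     restrict (\<lambda>z. \<chi> l. perturb_sum \<Omega> \<gamma> (bochner_fejer \<Omega> \<omega> d j (\<lambda>z. F z $ l)) z) (tube \<Omega>)"

text \<open>The limit exists and is the same for every choice of the basis.\<close>

definition perturb ::
  "(real ^ 'n) set \<Rightarrow> (complex ^ 'n \<Rightarrow> complex ^ 'm) \<Rightarrow> (real ^ 'n \<Rightarrow> complex) \<Rightarrow>
   complex ^ 'n \<Rightarrow> complex ^ 'm" where
  "perturb \<Omega> F \<gamma> = (THE G. \<exists>\<omega> d. is_rat_basis \<omega> d (ratvec.span (spectral_group \<Omega> F)) \<and>
     limitin (hap_topology \<Omega>) (perturbed_bochner_fejer \<Omega> \<omega> d \<gamma> F) G sequentially)"

definition perturbations ::
  "(real ^ 'n) set \<Rightarrow> (complex ^ 'n \<Rightarrow> complex ^ 'm) \<Rightarrow> (complex ^ 'n \<Rightarrow> complex ^ 'm) set" where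
  "perturbations \<Omega> F = {perturb \<Omega> F \<gamma> | \<gamma>. \<gamma> \<in> characters}"

end

theory Submission
  imports Defs "HOL-Complex_Analysis.Cauchy_Integral_Formula"
begin

text \<open>Bogolyubov's theorem, proved by Fourier analysis on finite cyclic groups, turns the relatively
  dense sets of almost periods into Bohr neighbourhoods of the origin: \<open>F(\<cdot> + t)\<close> is uniformly close
  to \<open>F\<close> on a tube as soon as finitely many numbers \<open>cis (t \<bullet> \<mu>)\<close> are close to \<open>1\<close>. Averaging \<open>F\<close>
  against a trigonometric kernel concentrated on such a neighbourhood approximates \<open>F\<close> by exponential
  sums with frequencies in its spectrum, and the contraction property of the Fejer kernels carries
  this over to the Bochner-Fejer sums. Hence \<open>F\<^sub>\<gamma> = G\<close> holds as soon as the Fourier coefficients of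
  \<open>G\<close> are those of \<open>F\<close> multiplied by \<open>\<gamma>\<close>. By Kronecker's theorem every character is, on the countable
  spectrum, a limit of waves \<open>cis (t \<bullet> \<mu>)\<close>, and the corresponding translates of \<open>F\<close> converge; conversely,
  compactness of the group of characters provides \<open>\<gamma>\<close> for every limit of translates.\<close>

section \<open>Almost periodic functions and their means\<close>

text \<open>\<open>perturb\<close> asks for one limit common to all rational bases, but neither
  existence nor independence of the basis is attacked head-on. If the coefficients of
  \<open>G\<close> are \<open>\<gamma>\<close> times those of \<open>F\<close>, then in every basis
  the perturbed Bochner-Fejer sums of \<open>F\<close> are literally the Bochner-Fejer sums of
  \<open>G\<close>, so convergence of the latter settles both; \<open>G\<close> itself is obtained
  beforehand as a limit of translates. The obstacle is that membership in \<open>HAP\<close> yields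
  only relatively dense sets of almost periods, while means and Fourier coefficients need
  approximation by trigonometric polynomials. Bogolyubov's theorem puts every point of a Bohr
  neighbourhood within a short vector of a combination \<open>a - b + c - d\<close> of almost
  periods, and a partition of unity then approximates each slice of \<open>F\<close> without using
  any mean of \<open>F\<close>. Only with means at hand can a second averaging place the frequencies
  in the spectrum and make the coefficients uniform over compact sets of imaginary parts. Convexity
  of \<open>\<Omega>\<close> enters where coefficients taken at two imaginary parts are compared
  along a segment.\<close>

inductive trig :: "(real ^ 'n \<Rightarrow> complex) \<Rightarrow> bool" where
  trig_wave: "trig (\<lambda>x. c * cis (x \<bullet> \<mu>))"
| trig_add: "trig f \<Longrightarrow> trig g \<Longrightarrow> trig (\<lambda>x. f x + g x)"

lemma trig_const: "trig (\<lambda>x. c)"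
  using trig_wave[of c 0] by simp

lemma trig_sum: "(\<And>i. i \<in> I \<Longrightarrow> trig (f i)) \<Longrightarrow> trig (\<lambda>x. \<Sum>i\<in>I. f i x)"
  by (induction I rule: infinite_finite_induct) (auto intro: trig_const trig_add)

lemma trig_representation:
  assumes "trig f"
  obtains A c where "finite A" "f = (\<lambda>x. \<Sum>\<mu>\<in>A. c \<mu> * cis (x \<bullet> \<mu>))"
proof -
  have "\<exists>A c. finite A \<and> f = (\<lambda>x. \<Sum>\<mu>\<in>A. c \<mu> * cis (x \<bullet> \<mu>))"
    using assms
  proof induction
    case (trig_wave c \<mu>)
    show ?case by (rule exI[of _ "{\<mu>}"], rule exI[of _ "\<lambda>_. c"]) auto
  next
    case (trig_add f g)
    then obtain A c B d where A: "finite A" "f = (\<lambda>x. \<Sum>\<mu>\<in>A. c \<mu> * cis (x \<bullet> \<mu>))"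
      and B: "finite B" "g = (\<lambda>x. \<Sum>\<mu>\<in>B. d \<mu> * cis (x \<bullet> \<mu>))" by blast
    let ?h = "\<lambda>\<mu>. (if \<mu> \<in> A then c \<mu> else 0) + (if \<mu> \<in> B then d \<mu> else 0)"
    have "(\<Sum>\<mu>\<in>A \<union> B. ?h \<mu> * cis (x \<bullet> \<mu>)) = f x + g x" for x
    proof -
      have "(\<Sum>\<mu>\<in>A \<union> B. ?h \<mu> * cis (x \<bullet> \<mu>)) =
        (\<Sum>\<mu>\<in>A \<union> B. (if \<mu> \<in> A then c \<mu> else 0) * cis (x \<bullet> \<mu>)) +
        (\<Sum>\<mu>\<in>A \<union> B. (if \<mu> \<in> B then d \<mu> else 0) * cis (x \<bullet> \<mu>))"
        by (simp only: sum.distrib[symmetric] distrib_right)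
      also have "(\<Sum>\<mu>\<in>A \<union> B. (if \<mu> \<in> A then c \<mu> else 0) * cis (x \<bullet> \<mu>)) = f x"
        unfolding A(2) by (rule sum.mono_neutral_cong_right) (use A B in auto)
      also have "(\<Sum>\<mu>\<in>A \<union> B. (if \<mu> \<in> B then d \<mu> else 0) * cis (x \<bullet> \<mu>)) = g x"
        unfolding B(2) by (rule sum.mono_neutral_cong_right) (use A B in auto)
      finally show ?thesis .
    qed
    then show ?case
      using A(1) B(1) by (intro exI[of _ "A \<union> B"] exI[of _ ?h]) auto
  qed
  then show thesis using that by blast
qed

lemma trig_mult:
  assumes "trig f" "trig g"
  shows "trig (\<lambda>x. f x * g x)"
  using assms(1)
proof induction
  case (trig_wave c \<mu>)
  show ?case using assms(2)
  proof induction
    case (trig_wave d \<nu>)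
    have "trig (\<lambda>x. (c * d) * cis (x \<bullet> (\<mu> + \<nu>)))" by (rule trig.trig_wave)
    then show ?case by (simp add: inner_add_right flip: cis_mult) (simp add: mult_ac)
  next
    case (trig_add f g)
    show ?case using trig.trig_add[OF trig_add.IH] by (simp add: algebra_simps)
  qed
next
  case (trig_add f1 f2)
  show ?case using trig.trig_add[OF trig_add.IH] by (simp add: algebra_simps)
qed

lemma trig_translate: "trig f \<Longrightarrow> trig (\<lambda>x. f (x + h))"
proof (induction rule: trig.induct)
  case (trig_wave c \<mu>)
  have "trig (\<lambda>x. (c * cis (h \<bullet> \<mu>)) * cis (x \<bullet> \<mu>))" by (rule trig.trig_wave)
  then show ?case by (simp add: inner_add_left flip: cis_mult) (simp add: mult_ac)
qed (rule trig_add)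

lemma trig_continuous: "trig f \<Longrightarrow> continuous_on UNIV f"
  by (induction rule: trig.induct) (auto simp: cis_conv_exp intro!: continuous_intros)

lemma trig_bounded: "trig f \<Longrightarrow> \<exists>B. \<forall>x. cmod (f x) \<le> B"
proof (induction rule: trig.induct)
  case (trig_wave c \<mu>)
  show ?case by (rule exI[of _ "cmod c"]) (simp add: norm_mult)
next
  case (trig_add f g)
  then obtain B C where "\<forall>x. cmod (f x) \<le> B" "\<forall>x. cmod (g x) \<le> C" by blast
  then have "\<forall>x. cmod (f x + g x) \<le> B + C" by (metis norm_add_rule_thm)
  then show ?case by blast
qed

text \<open>Almost periodicity on the real space is taken as uniform approximability by
  trigonometric polynomials, because closure under products and existence of means then follow by
  uniform limits. The link to almost periods is \<open>bohr_continuous_imp_ap\<close>.\<close>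

definition ap :: "(real ^ 'n \<Rightarrow> complex) \<Rightarrow> bool" where
  "ap f \<longleftrightarrow> (\<forall>\<epsilon>>0. \<exists>p. trig p \<and> (\<forall>x. cmod (f x - p x) < \<epsilon>))"

lemma apE:
  assumes "ap f" "\<epsilon> > 0"
  obtains p where "trig p" "\<And>x. cmod (f x - p x) < \<epsilon>"
  using assms unfolding ap_def by blast

lemma trig_ap: "trig f \<Longrightarrow> ap f"
  unfolding ap_def by (intro allI impI exI[of _ f]) auto

lemma ap_const: "ap (\<lambda>x. c)"
  by (intro trig_ap trig_const)

lemma ap_wave: "ap (\<lambda>x. cis (x \<bullet> \<mu>))"
  using trig_ap[OF trig_wave[of 1]] by simp

lemma ap_uniform_limit:
  assumes "\<And>\<epsilon>. \<epsilon> > 0 \<Longrightarrow> \<exists>g. ap g \<and> (\<forall>x. cmod (f x - g x) \<le> \<epsilon>)"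
  shows "ap f"
  unfolding ap_def
proof (intro allI impI)
  fix \<epsilon> :: real assume e: "\<epsilon> > 0"
  then obtain g where g: "ap g" "\<And>x. cmod (f x - g x) \<le> \<epsilon>/2"
    using assms[of "\<epsilon>/2"] by auto
  obtain p where p: "trig p" "\<And>x. cmod (g x - p x) < \<epsilon>/2"
    by (rule apE[OF g(1), of "\<epsilon>/2"]) (use e in auto)
  have "cmod (f x - p x) < \<epsilon>" for x
    using norm_triangle_ineq[of "f x - g x" "g x - p x"] g(2)[of x] p(2)[of x] by simp
  then show "\<exists>p. trig p \<and> (\<forall>x. cmod (f x - p x) < \<epsilon>)" using p(1) by blast
qed

lemma ap_bounded:
  assumes "ap f"
  obtains B where "B > 0" "\<And>x. cmod (f x) \<le> B"
proof -
  obtain p where p: "trig p" "\<And>x. cmod (f x - p x) < 1" by (rule apE[OF assms, of 1]) auto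
  obtain B where B: "\<And>x. cmod (p x) \<le> B" using trig_bounded[OF p(1)] by blast
  have "cmod (f x) \<le> B + 1" for x
    using norm_triangle_ineq[of "f x - p x" "p x"] p(2)[of x] B[of x] by simp
  moreover have "B \<ge> 0" using B[of 0] norm_ge_zero order_trans by blast
  ultimately show thesis using that[of "B + 1"] by auto
qed

lemma ap_continuous:
  assumes "ap f"
  shows "continuous_on UNIV f"
proof -
  have "\<forall>n. \<exists>p. trig p \<and> (\<forall>x. cmod (f x - p x) < inverse (Suc n))"
    using assms unfolding ap_def by simp
  then obtain p where p: "\<And>n. trig (p n)" "\<And>n x. cmod (f x - p n x) < inverse (Suc n)"
    by metis
  have "uniform_limit UNIV p f sequentially"
  proof (rule uniform_limitI)
    fix e :: real assume "e > 0"
    then obtain N where N: "inverse (real (Suc N)) < e" using reals_Archimedean by blast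
    show "\<forall>\<^sub>F n in sequentially. \<forall>x\<in>UNIV. dist (p n x) (f x) < e"
    proof (rule eventually_sequentiallyI[of N], rule ballI)
      fix n x assume "n \<ge> N"
      then have "inverse (real (Suc n)) \<le> inverse (real (Suc N))" by simp
      then show "dist (p n x) (f x) < e"
        using p(2)[of x n] N unfolding dist_norm norm_minus_commute[of "p n x"] by linarith
    qed
  qed
  then show ?thesis
    by (rule uniform_limit_theorem[rotated]) (auto simp: trig_continuous p)
qed

lemma ap_add:
  assumes "ap f" "ap g"
  shows "ap (\<lambda>x. f x + g x)"
proof (rule ap_uniform_limit)
  fix \<epsilon> :: real assume e: "\<epsilon> > 0"
  obtain p where p: "trig p" "\<And>x. cmod (f x - p x) < \<epsilon>/2"
    by (rule apE[OF assms(1), of "\<epsilon>/2"]) (use e in auto)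
  obtain q where q: "trig q" "\<And>x. cmod (g x - q x) < \<epsilon>/2"
    by (rule apE[OF assms(2), of "\<epsilon>/2"]) (use e in auto)
  have "cmod (f x + g x - (p x + q x)) \<le> \<epsilon>" for x
    using norm_triangle_ineq[of "f x - p x" "g x - q x"] p(2)[of x] q(2)[of x]
    by (simp add: algebra_simps)
  then show "\<exists>h. ap h \<and> (\<forall>x. cmod (f x + g x - h x) \<le> \<epsilon>)"
    using trig_ap[OF trig_add[OF p(1) q(1)]] by blast
qed

lemma ap_mult:
  assumes "ap f" "ap g"
  shows "ap (\<lambda>x. f x * g x)"
proof (rule ap_uniform_limit)
  fix \<epsilon> :: real assume e: "\<epsilon> > 0"
  obtain B where B: "B > 0" "\<And>x. cmod (f x) \<le> B" using ap_bounded[OF assms(1)] by blast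
  \<comment> \<open>The polynomial \<open>q\<close> is chosen first: the tolerance for
    \<open>p\<close> depends on a bound for \<open>q\<close>, not for \<open>g\<close>.\<close>
  obtain q where q: "trig q" "\<And>x. cmod (g x - q x) < \<epsilon>/(2*B)"
    by (rule apE[OF assms(2), of "\<epsilon>/(2*B)"]) (use e B in auto)
  obtain C where C: "C > 0" "\<And>x. cmod (q x) \<le> C" using ap_bounded[OF trig_ap[OF q(1)]] by blast
  obtain p where p: "trig p" "\<And>x. cmod (f x - p x) < \<epsilon>/(2*C)"
    by (rule apE[OF assms(1), of "\<epsilon>/(2*C)"]) (use e C in auto)
  have "cmod (f x * g x - p x * q x) \<le> \<epsilon>" for x
  proof -
    have "cmod (f x * (g x - q x)) \<le> B * (\<epsilon>/(2*B))"
      unfolding norm_mult by (rule mult_mono) (use B q(2)[of x] in \<open>auto intro: less_imp_le\<close>)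
    moreover have "cmod ((f x - p x) * q x) \<le> \<epsilon>/(2*C) * C"
      unfolding norm_mult by (rule mult_mono) (use C e p(2)[of x] in \<open>auto intro: less_imp_le\<close>)
    moreover have "f x * g x - p x * q x = f x * (g x - q x) + (f x - p x) * q x"
      by (simp add: algebra_simps)
    ultimately show ?thesis
      using norm_triangle_ineq[of "f x * (g x - q x)" "(f x - p x) * q x"] B C by simp
  qed
  then show "\<exists>h. ap h \<and> (\<forall>x. cmod (f x * g x - h x) \<le> \<epsilon>)"
    using trig_ap[OF trig_mult[OF p(1) q(1)]] by blast
qed

lemma ap_cmult: "ap f \<Longrightarrow> ap (\<lambda>x. c * f x)"
  by (rule ap_mult[OF ap_const])

lemma ap_diff: "ap f \<Longrightarrow> ap g \<Longrightarrow> ap (\<lambda>x. f x - g x)"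
  using ap_add[OF _ ap_cmult, of f g "-1"] by simp

lemma ap_sum: "(\<And>i. i \<in> I \<Longrightarrow> ap (f i)) \<Longrightarrow> ap (\<lambda>x. \<Sum>i\<in>I. f i x)"
  by (induction I rule: infinite_finite_induct) (auto intro: ap_const ap_add)

lemma ap_translate:
  assumes "ap f"
  shows "ap (\<lambda>x. f (x + h))"
  unfolding ap_def
proof (intro allI impI)
  fix \<epsilon> :: real assume e: "\<epsilon> > 0"
  obtain p where "trig p" "\<And>x. cmod (f x - p x) < \<epsilon>"
    using apE[OF assms e] by blast
  then show "\<exists>p. trig p \<and> (\<forall>x. cmod (f (x + h) - p x) < \<epsilon>)"
    using trig_translate[of p h] by blast
qed

text \<open>Weierstrass replaces \<open>\<phi>\<close> on the range of \<open>f\<close> by a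
  polynomial, and polynomials in \<open>f\<close> remain almost periodic. This serves the truncation
  by \<open>max 0\<close> and the reciprocal that occur in the kernels below.\<close>

lemma ap_continuous_compose:
  fixes f :: "real ^ 'n \<Rightarrow> real" and \<phi> :: "real \<Rightarrow> real"
  assumes f: "ap (\<lambda>x. complex_of_real (f x))" and ab: "\<And>x. f x \<in> {a..b}"
    and \<phi>: "continuous_on {a..b} \<phi>"
  shows "ap (\<lambda>x. complex_of_real (\<phi> (f x)))"
proof (rule ap_uniform_limit)
  fix \<epsilon> :: real assume e: "\<epsilon> > 0"
  obtain g where g: "real_polynomial_function g" "\<And>x. x \<in> {a..b} \<Longrightarrow> \<bar>\<phi> x - g x\<bar> < \<epsilon>"
    using Stone_Weierstrass_real_polynomial_function[OF _ \<phi> e] by auto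
  have "ap (\<lambda>x. complex_of_real (g (f x)))"
    using g(1)
  proof induction
    case (linear g)
    have "g y = g 1 * y" for y
      using linear_scale[OF bounded_linear.linear[OF linear], of y 1] by simp
    then have "(\<lambda>x. complex_of_real (g (f x))) = (\<lambda>x. complex_of_real (g 1) * complex_of_real (f x))"
      by (metis of_real_mult)
    then show ?case using ap_cmult[OF f] by simp
  qed (auto simp: ap_const intro: ap_add ap_mult)
  moreover have "cmod (complex_of_real (\<phi> (f x)) - complex_of_real (g (f x))) \<le> \<epsilon>" for x
    using g(2)[OF ab[of x]] by (simp flip: of_real_diff)
  ultimately show "\<exists>h. ap h \<and> (\<forall>x. cmod (complex_of_real (\<phi> (f x)) - h x) \<le> \<epsilon>)"
    by blast
qed

section \<open>Mean values over growing cubes\<close>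

definition cube_mean :: "real \<Rightarrow> (real ^ 'n \<Rightarrow> complex) \<Rightarrow> complex" where
  "cube_mean s f = complex_of_real (1 / (2 * s) ^ CARD('n)) *
     (LINT x:{x. \<forall>j. \<bar>x $ j\<bar> < s}|lborel. f x)"

lemma cube_eq_box: "{x::real^'n. \<forall>j. \<bar>x $ j\<bar> < s} = box (\<chi> j. - s) (\<chi> j. s)"
proof -
  have "\<bar>r\<bar> < s \<longleftrightarrow> - s < r \<and> r < s" for r by linarith
  then show ?thesis by (simp add: set_eq_iff mem_box_cart)
qed

lemma measure_cube: 
  assumes "s > 0"
  shows "measure lborel {x::real^'n. \<forall>j. \<bar>x $ j\<bar> < s} = (2 * s) ^ CARD('n)"
proof -
  let ?a = "\<chi> j. - s :: real^'n" and ?b = "\<chi> j. s :: real^'n"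
  have "cbox ?a ?b \<noteq> {}" using assms by (simp add: interval_ne_empty_cart)
  then have "measure lborel (cbox ?a ?b) = (2 * s) ^ CARD('n)"
    by (simp add: content_cbox_cart)
  moreover have "measure lborel (cbox ?a ?b) = measure lborel (box ?a ?b)"
    by (simp add: measure_lborel_box_eq measure_lborel_cbox_eq)
  ultimately show ?thesis by (simp add: cube_eq_box)
qed

lemma finite_cube: "emeasure lborel {x::real^'n. \<forall>j. \<bar>x $ j\<bar> < s} < \<infinity>"
  unfolding cube_eq_box by (rule emeasure_lborel_box_finite)

lemma cube_integrable:
  fixes f :: "real ^ 'n \<Rightarrow> 'b::{banach, second_countable_topology}"
  assumes "continuous_on UNIV f"
  shows "set_integrable lborel {x. \<forall>j. \<bar>x $ j\<bar> < s} f"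
proof -
  have "set_integrable lborel (cbox (\<chi> j. - s) (\<chi> j. s)) f"
    unfolding set_integrable_def
    by (rule borel_integrable_compact) (auto intro: continuous_on_subset[OF assms])
  then show ?thesis
    unfolding cube_eq_box by (rule set_integrable_subset) (auto simp: box_subset_cbox)
qed

lemma cube_mean_add:
  assumes "continuous_on UNIV f" "continuous_on UNIV g"
  shows "cube_mean s (\<lambda>x. f x + g x) = cube_mean s f + cube_mean s g"
  unfolding cube_mean_def
  by (simp add: set_integral_add(2)[OF cube_integrable[OF assms(1)] cube_integrable[OF assms(2)]]
      distrib_left)

lemma cube_mean_cmult: "cube_mean s (\<lambda>x. c * f x) = c * cube_mean s f"
  unfolding cube_mean_def by simp

lemma cube_mean_diff:
  assumes "continuous_on UNIV f" "continuous_on UNIV g"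
  shows "cube_mean s (\<lambda>x. f x - g x) = cube_mean s f - cube_mean s g"
  unfolding cube_mean_def
  by (simp add: set_integral_diff(2)[OF cube_integrable[OF assms(1)] cube_integrable[OF assms(2)]]
      right_diff_distrib)

lemma cube_mean_le:
  fixes g :: "real ^ 'n \<Rightarrow> real"
  assumes "continuous_on UNIV f" "continuous_on UNIV g" "\<And>x. cmod (f x) \<le> g x" "s > 0"
  shows "cmod (cube_mean s f) \<le> Re (cube_mean s (\<lambda>x. complex_of_real (g x)))"
proof -
  let ?C = "{x::real^'n. \<forall>j. \<bar>x $ j\<bar> < s}"
  have "cmod (LINT x:?C|lborel. f x) \<le> (LINT x:?C|lborel. cmod (f x))"
    by (rule set_integral_norm_bound[OF cube_integrable[OF assms(1)]])
  also have "\<dots> \<le> (LINT x:?C|lborel. g x)"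
    by (rule set_integral_mono)
      (use assms in \<open>auto intro!: cube_integrable continuous_intros\<close>)
  finally have "cmod (LINT x:?C|lborel. f x) \<le> (LINT x:?C|lborel. g x)" .
  moreover have "(LINT x:?C|lborel. complex_of_real (g x)) = complex_of_real (LINT x:?C|lborel. g x)"
    by (rule set_integral_complex_of_real)
  ultimately show ?thesis
    unfolding cube_mean_def using assms(4)
    by (simp add: norm_mult norm_divide norm_power divide_right_mono mult_left_mono)
qed

lemma cube_mean_const:
  assumes "s > 0"
  shows "cube_mean s (\<lambda>x::real^'n. c) = c"
proof -
  have "cube_mean s (\<lambda>x::real^'n. c) =
      complex_of_real (1 / (2 * s) ^ CARD('n)) * (complex_of_real ((2 * s) ^ CARD('n)) * c)"
    unfolding cube_mean_def set_lebesgue_integral_def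
    using measure_cube[OF assms, where 'n='n] finite_cube[of s, where 'n='n]
    by (simp add: scaleR_conv_of_real)
  then show ?thesis using assms by simp
qed

lemma cube_mean_norm:
  fixes f :: "real ^ 'n \<Rightarrow> complex"
  assumes "continuous_on UNIV f" "\<And>x. cmod (f x) \<le> B" "s > 0"
  shows "cmod (cube_mean s f) \<le> B"
  using cube_mean_le[OF assms(1) _ assms(2,3)] cube_mean_const[OF assms(3), where 'n='n]
  by simp

text \<open>Changing the side of a large cube by a bounded amount leaves its volume asymptotically
  the same, so boundary effects disappear from cube means.\<close>

lemma power_ratio_tendsto:
  "((\<lambda>s::real. ((2 * (s + c)) ^ n) / (2 * s) ^ n) \<longlongrightarrow> 1) at_top"
proof -
  have "((\<lambda>s::real. (1 + c * inverse s) ^ n) \<longlongrightarrow> (1 + c * 0) ^ n) at_top"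
    by (intro tendsto_intros tendsto_inverse_0_at_top filterlim_ident)
  moreover have "\<forall>\<^sub>F s::real in at_top. (1 + c * inverse s) ^ n = ((2 * (s + c)) ^ n) / (2 * s) ^ n"
    using eventually_gt_at_top[of 0]
  proof eventually_elim
    case (elim s)
    then have "1 + c * inverse s = (2 * (s + c)) / (2 * s)" by (simp add: field_simps)
    then show ?case by (simp only: power_divide)
  qed
  ultimately show ?thesis using tendsto_cong[of _ _ at_top] by fastforce
qed

text \<open>A translation by half a period changes the sign of the wave but moves the cube only by a
  bounded amount.\<close>

lemma cube_mean_wave_nonzero:
  fixes \<mu> :: "real ^ 'n"
  assumes "\<mu> \<noteq> 0"
  shows "((\<lambda>s. cube_mean s (\<lambda>x. cis (x \<bullet> \<mu>))) \<longlongrightarrow> 0) at_top"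
proof (rule Lim_null_comparison)
  define C where "C = (\<lambda>s::real. {x::real^'n. \<forall>j. \<bar>x $ j\<bar> < s})"
  define h where "h = (pi / (\<mu> \<bullet> \<mu>)) *\<^sub>R \<mu>"
  define a where "a = norm h"
  have hmu: "h \<bullet> \<mu> = pi" using assms by (simp add: h_def)
  have e: "cis ((h + x) \<bullet> \<mu>) = - cis (x \<bullet> \<mu>)" for x
    by (simp add: inner_add_left hmu flip: cis_mult)
  have hj: "\<bar>h $ j\<bar> \<le> a" for j unfolding a_def by (rule component_le_norm_cart)
  have cont: "continuous_on UNIV (\<lambda>x. cis (x \<bullet> \<mu>))"
    by (auto simp: cis_conv_exp intro!: continuous_intros)
  have [measurable]: "C s \<in> sets borel" for s by (simp add: C_def)
  have Cfin: "emeasure lborel (C s) < \<infinity>" for s unfolding C_def by (rule finite_cube)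
  \<comment> \<open>The indicators of the cube and of its translate agree on the inner cube and both
    vanish outside the outer one, so the integral lives on the shell between them. Writing
    \<open>s + - a\<close> lets \<open>power_ratio_tendsto\<close> cover both radii.\<close>
  have bd: "cmod (cube_mean s (\<lambda>x. cis (x \<bullet> \<mu>))) \<le>
      (((2 * (s + a)) ^ CARD('n)) / (2 * s) ^ CARD('n) - ((2 * (s + - a)) ^ CARD('n)) / (2 * s) ^
          CARD('n)) / 2"
    if s: "s > a" for s
  proof -
    have s0: "s > 0" "a \<ge> 0" using s norm_ge_zero[of h] unfolding a_def by linarith+
    define f where "f = (\<lambda>x. indicator (C s) x *\<^sub>R cis (x \<bullet> \<mu>))"
    have f: "integrable lborel f"
      using cube_integrable[OF cont, of s] unfolding set_integrable_def f_def C_def .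
    have f': "integrable lborel (\<lambda>x. f (h + x))"
    proof -
      have "integrable (distr lborel borel ((+) h)) f" using f by (simp only: lborel_distr_plus)
      then show ?thesis by (subst (asm) integrable_distr_eq) (use f in auto)
    qed
    have "(LINT x|lborel. f x) = (LINT x|lborel. f (h + x))"
    proof -
      have "(LINT x|distr lborel borel ((+) h). f x) = (LINT x|lborel. f (h + x))"
        by (rule integral_distr) (use f in auto)
      then show ?thesis by (simp only: lborel_distr_plus)
    qed
    then have "2 * (LINT x|lborel. f x) = (LINT x|lborel. f x + f (h + x))"
      using f f' by simp
    also have "cmod \<dots> \<le> (LINT x|lborel. cmod (f x + f (h + x)))"
      by (rule integral_norm_bound)
    also have "\<dots> \<le> (LINT x|lborel. indicator (C (s + a)) x - indicator (C (s + - a)) x)"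
    proof (rule integral_mono)
      show "integrable lborel (\<lambda>x. cmod (f x + f (h + x)))" using f f' by simp
      show "integrable lborel (\<lambda>x. indicator (C (s + a)) x - indicator (C (s + - a)) x :: real)"
        using Cfin by simp
      fix x :: "real^'n"
      have 1: "x \<in> C s \<Longrightarrow> x \<in> C (s + a)" unfolding C_def using s0 by (auto intro: less_le_trans
          add_increasing2)
      have c2: "\<bar>x $ j\<bar> < s + a" if "\<bar>h $ j + x $ j\<bar> < s" for j using that hj[of j] by linarith
      have 2: "h + x \<in> C s \<Longrightarrow> x \<in> C (s + a)" unfolding C_def using c2 by simp
      have c3: "\<bar>x $ j\<bar> < s \<and> \<bar>h $ j + x $ j\<bar> < s" if "\<bar>x $ j\<bar> < s + - a" for j
        using that hj[of j] s0 by linarith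
      have 3: "x \<in> C (s + - a) \<Longrightarrow> x \<in> C s \<and> h + x \<in> C s"
        unfolding C_def using c3 by simp
      have "f x + f (h + x) = (indicator (C s) x - indicator (C s) (h + x)) *\<^sub>R cis (x \<bullet> \<mu>)"
        unfolding f_def e by (simp add: scaleR_left_diff_distrib)
      then have "cmod (f x + f (h + x)) = \<bar>indicator (C s) x - indicator (C s) (h + x)\<bar>"
        by simp
      also have "\<dots> \<le> indicator (C (s + a)) x - indicator (C (s + - a)) x"
        using 1 2 3 by (auto simp: indicator_def)
      finally show "cmod (f x + f (h + x)) \<le> indicator (C (s + a)) x - indicator (C (s + - a)) x" .
    qed
    also have "\<dots> = (2 * (s + a)) ^ CARD('n) - (2 * (s + - a)) ^ CARD('n)"
      using Cfin measure_cube[of "s + a", where 'n='n] measure_cube[of "s + - a", where 'n='n] s s0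
      by (simp add: C_def)
    finally have "cmod (LINT x|lborel. f x) \<le> ((2 * (s + a)) ^ CARD('n) - (2 * (s + - a)) ^
        CARD('n)) / 2"
      by (simp add: norm_mult)
    then have "cmod (LINT x|lborel. f x) / (2 * s) ^ CARD('n) \<le>
      ((2 * (s + a)) ^ CARD('n) - (2 * (s + - a)) ^ CARD('n)) / 2 / (2 * s) ^ CARD('n)"
      by (rule divide_right_mono) (use s0 in auto)
    moreover have "cmod (cube_mean s (\<lambda>x. cis (x \<bullet> \<mu>))) = cmod (LINT x|lborel. f x) / (2 * s) ^ CARD('n)"
      unfolding cube_mean_def f_def set_lebesgue_integral_def C_def
      using s0 by (simp add: norm_mult norm_divide norm_power)
    ultimately show ?thesis by (simp add: diff_divide_distrib)
  qed
  show "\<forall>\<^sub>F s in at_top. cmod (cube_mean s (\<lambda>x. cis (x \<bullet> \<mu>))) \<le>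
      (((2 * (s + a)) ^ CARD('n)) / (2 * s) ^ CARD('n) - ((2 * (s + - a)) ^ CARD('n)) / (2 * s) ^
          CARD('n)) / 2"
    using eventually_gt_at_top[of a] by eventually_elim (rule bd)
  have "((\<lambda>s. (((2 * (s + a)) ^ CARD('n)) / (2 * s) ^ CARD('n) - ((2 * (s + - a)) ^ CARD('n)) / (2
      * s) ^ CARD('n)) / 2) \<longlongrightarrow> (1 - 1) / 2) at_top"
    by (intro tendsto_intros power_ratio_tendsto) simp
  then show "((\<lambda>s. (((2 * (s + a)) ^ CARD('n)) / (2 * s) ^ CARD('n) - ((2 * (s + - a)) ^ CARD('n))
      / (2 * s) ^ CARD('n)) / 2) \<longlongrightarrow> 0) at_top"
    by simp
qed

lemma cube_mean_wave:
  "((\<lambda>s. cube_mean s (\<lambda>x. cis (x \<bullet> \<mu>))) \<longlongrightarrow> (if \<mu> = 0 then 1 else 0)) at_top"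
proof (cases "\<mu> = 0")
  case True
  have "\<forall>\<^sub>F s in at_top. cube_mean s (\<lambda>x. cis (x \<bullet> \<mu>)) = 1"
    using eventually_gt_at_top[of 0] by eventually_elim (simp add: True cube_mean_const)
  then show ?thesis using True by (simp add: tendsto_eventually)
qed (simp add: cube_mean_wave_nonzero)

lemma cube_mean_trig:
  assumes "trig f"
  shows "\<exists>c. ((\<lambda>s. cube_mean s f) \<longlongrightarrow> c) at_top"
  using assms
proof induction
  case (trig_wave c \<mu>)
  then show ?case
    using tendsto_mult[OF tendsto_const cube_mean_wave[of \<mu>], of c] by (auto simp: cube_mean_cmult)
next
  case (trig_add f g)
  then obtain c d where "((\<lambda>s. cube_mean s f) \<longlongrightarrow> c) at_top" "((\<lambda>s. cube_mean s g) \<longlongrightarrow> d) at_top"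
    by blast
  then have "((\<lambda>s. cube_mean s f + cube_mean s g) \<longlongrightarrow> c + d) at_top" by (rule tendsto_add)
  then show ?case
    by (auto simp: cube_mean_add trig_continuous trig_add)
qed

definition mean :: "(real ^ 'n \<Rightarrow> complex) \<Rightarrow> complex" where
  "mean f = Lim at_top (\<lambda>s. cube_mean s f)"

lemma cube_mean_limit_close:
  assumes "continuous_on UNIV f" "continuous_on UNIV g" "\<And>x. cmod (f x - g x) \<le> \<epsilon>"
    and "((\<lambda>s. cube_mean s f) \<longlongrightarrow> c) at_top" "((\<lambda>s. cube_mean s g) \<longlongrightarrow> d) at_top"
  shows "cmod (c - d) \<le> \<epsilon>"
proof (rule tendsto_upperbound)
  show "((\<lambda>s. cmod (cube_mean s f - cube_mean s g)) \<longlongrightarrow> cmod (c - d)) at_top"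
    using assms(4,5) by (intro tendsto_intros)
  show "\<forall>\<^sub>F s in at_top. cmod (cube_mean s f - cube_mean s g) \<le> \<epsilon>"
    using eventually_gt_at_top[of 0]
  proof eventually_elim
    case (elim s)
    then show ?case
      using cube_mean_norm[OF continuous_on_diff[OF assms(1,2)] assms(3), of s]
      by (simp add: cube_mean_diff assms)
  qed
qed simp

lemma mean_eqI: "((\<lambda>s. cube_mean s f) \<longlongrightarrow> c) at_top \<Longrightarrow> mean f = c"
  unfolding mean_def by (rule tendsto_Lim) simp

text \<open>The means of the approximating polynomials form a Cauchy sequence, because a mean is
  bounded by the supremum. As the approximation error is the same for all \<open>s > 0\<close>, the
  limits in \<open>s\<close> and in \<open>n\<close> may be interchanged.\<close>

lemma ap_mean:
  assumes "ap f"
  shows "((\<lambda>s. cube_mean s f) \<longlongrightarrow> mean f) at_top"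
proof -
  have fc: "continuous_on UNIV f" by (rule ap_continuous[OF assms])
  have "\<forall>n. \<exists>p. trig p \<and> (\<forall>x. cmod (f x - p x) < inverse (Suc n))"
    using assms unfolding ap_def by simp
  then obtain p where p: "\<And>n. trig (p n)" "\<And>n x. cmod (f x - p n x) < inverse (Suc n)"
    by metis
  have pc: "continuous_on UNIV (p n)" for n by (rule trig_continuous[OF p(1)])
  have "\<forall>n. \<exists>c. ((\<lambda>s. cube_mean s (p n)) \<longlongrightarrow> c) at_top" using p(1) cube_mean_trig by blast
  then obtain c where c: "\<And>n. ((\<lambda>s. cube_mean s (p n)) \<longlongrightarrow> c n) at_top" by metis
  have pp: "cmod (p m x - p n x) \<le> inverse (Suc m) + inverse (Suc n)" for m n x
    using norm_triangle_ineq[of "p m x - f x" "f x - p n x"] p(2)[of x m] p(2)[of x n]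
    by (simp add: norm_minus_commute)
  have cc: "cmod (c m - c n) \<le> inverse (Suc m) + inverse (Suc n)" for m n
    by (rule cube_mean_limit_close[OF pc pc pp c c])
  have inv: "\<exists>N. \<forall>n\<ge>N. inverse (real (Suc n)) < e" if "e > 0" for e
  proof -
    obtain N where N: "inverse (real (Suc N)) < e" using reals_Archimedean \<open>e > 0\<close> by blast
    have "inverse (real (Suc n)) \<le> inverse (real (Suc N))" if "n \<ge> N" for n using that by simp
    then show ?thesis using N by (meson le_less_trans)
  qed
  have "Cauchy c"
  proof (rule metric_CauchyI)
    fix e :: real assume "e > 0"
    then obtain N where N: "\<And>n. n \<ge> N \<Longrightarrow> inverse (real (Suc n)) < e/2" using inv[of "e/2"] by auto
    have "dist (c m) (c n) < e" if "m \<ge> N" "n \<ge> N" for m n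
      using cc[of m n] N[OF that(1)] N[OF that(2)] unfolding dist_norm by linarith
    then show "\<exists>M. \<forall>m\<ge>M. \<forall>n\<ge>M. dist (c m) (c n) < e" by blast
  qed
  then obtain l where l: "c \<longlonglongrightarrow> l" using Cauchy_convergent convergent_def by blast
  have "((\<lambda>s. cube_mean s f) \<longlongrightarrow> l) at_top"
  proof (rule tendstoI)
    fix e :: real assume e: "e > 0"
    obtain N where N: "\<And>n. n \<ge> N \<Longrightarrow> inverse (real (Suc n)) < e/3" using inv[of "e/3"] e by auto
    obtain M where M: "\<And>n. n \<ge> M \<Longrightarrow> dist (c n) l < e/3"
      using LIMSEQ_D[OF l, of "e/3"] e by (auto simp: dist_norm)
    let ?k = "max N M"
    have "\<forall>\<^sub>F s in at_top. dist (cube_mean s (p ?k)) (c ?k) < e/3"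
      by (rule tendstoD[OF c]) (use e in simp)
    then show "\<forall>\<^sub>F s in at_top. dist (cube_mean s f) l < e"
      using eventually_gt_at_top[of 0]
    proof eventually_elim
      case (elim s)
      have "cmod (cube_mean s f - cube_mean s (p ?k)) \<le> inverse (Suc ?k)"
        using cube_mean_norm[OF continuous_on_diff[OF fc pc] less_imp_le[OF p(2)] elim(2)]
        by (simp add: cube_mean_diff fc pc)
      then have "dist (cube_mean s f) (cube_mean s (p ?k)) < e/3"
        using N[of ?k] unfolding dist_norm by linarith
      moreover have "dist (c ?k) l < e/3" using M[of ?k] by simp
      ultimately show ?case
        using elim(1) dist_triangle[of "cube_mean s f" l "cube_mean s (p ?k)"]
          dist_triangle[of "cube_mean s (p ?k)" l "c ?k"] by linarith
    qed
  qed
  then show ?thesis using mean_eqI by metis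
qed

lemma mean_const [simp]: "mean (\<lambda>x. c) = c"
proof (rule mean_eqI)
  have "\<forall>\<^sub>F s in at_top. cube_mean s (\<lambda>x. c) = c"
    using eventually_gt_at_top[of 0] by eventually_elim (simp add: cube_mean_const)
  then show "((\<lambda>s. cube_mean s (\<lambda>x. c)) \<longlongrightarrow> c) at_top"
    by (rule tendsto_eventually)
qed

lemma mean_wave: "mean (\<lambda>x. cis (x \<bullet> \<mu>)) = (if \<mu> = 0 then 1 else 0)"
  by (rule mean_eqI[OF cube_mean_wave])

lemma mean_add:
  assumes "ap f" "ap g"
  shows "mean (\<lambda>x. f x + g x) = mean f + mean g"
  by (rule mean_eqI, subst cube_mean_add)
    (auto intro!: ap_continuous assms tendsto_add ap_mean)

lemma mean_diff:
  assumes "ap f" "ap g"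
  shows "mean (\<lambda>x. f x - g x) = mean f - mean g"
  by (rule mean_eqI, subst cube_mean_diff)
    (auto intro!: ap_continuous assms tendsto_diff ap_mean)

lemma mean_cmult:
  assumes "ap f"
  shows "mean (\<lambda>x. c * f x) = c * mean f"
  by (rule mean_eqI, subst cube_mean_cmult) (auto intro!: assms tendsto_mult ap_mean)

lemma mean_sum:
  assumes "\<And>i. i \<in> I \<Longrightarrow> ap (f i)"
  shows "mean (\<lambda>x. \<Sum>i\<in>I. f i x) = (\<Sum>i\<in>I. mean (f i))"
  using assms
proof (induction I rule: infinite_finite_induct)
  case (insert i I)
  then have "mean (\<lambda>x. f i x + (\<Sum>i\<in>I. f i x)) = mean (f i) + mean (\<lambda>x. \<Sum>i\<in>I. f i x)"
    by (intro mean_add ap_sum) auto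
  then show ?case using insert by simp
qed auto

text \<open>A variable majorant instead of a constant is what is needed when an integrand is
  dominated by a multiple of a nonnegative kernel whose mean is known.\<close>

lemma mean_le:
  fixes g :: "real ^ 'n \<Rightarrow> real"
  assumes "ap f" "ap (\<lambda>x. complex_of_real (g x))" "\<And>x. cmod (f x) \<le> g x"
  shows "cmod (mean f) \<le> Re (mean (\<lambda>x. complex_of_real (g x)))"
proof (rule tendsto_le)
  show "((\<lambda>s. Re (cube_mean s (\<lambda>x. complex_of_real (g x)))) \<longlongrightarrow> Re (mean (\<lambda>x. complex_of_real (g
      x)))) at_top"
    by (intro tendsto_intros ap_mean assms)
  show "((\<lambda>s. cmod (cube_mean s f)) \<longlongrightarrow> cmod (mean f)) at_top"
    by (intro tendsto_intros ap_mean assms)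
  have "continuous_on UNIV (\<lambda>x. Re (complex_of_real (g x)))"
    by (rule continuous_on_Re[OF ap_continuous[OF assms(2)]])
  then have g: "continuous_on UNIV g" by simp
  show "\<forall>\<^sub>F s in at_top. cmod (cube_mean s f) \<le> Re (cube_mean s (\<lambda>x. complex_of_real (g x)))"
    using eventually_gt_at_top[of 0]
    by eventually_elim (rule cube_mean_le[OF ap_continuous[OF assms(1)] g assms(3)])
qed simp

lemma mean_norm:
  assumes "ap f" "\<And>x. cmod (f x) \<le> B"
  shows "cmod (mean f) \<le> B"
  using mean_le[OF assms(1) ap_const assms(2)] by simp

text \<open>A translation multiplies the wave at \<open>\<mu>\<close> by
  \<open>cis (h \<bullet> \<mu>)\<close>. This factor is 1 at \<open>\<mu> = 0\<close>, and at every
  other frequency the mean is 0 before and after. Uniform approximation carries this over to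
  \<open>f\<close>.\<close>

lemma mean_translate:
  fixes f :: "real ^ 'n \<Rightarrow> complex"
  assumes "ap f"
  shows "mean (\<lambda>x. f (x + h)) = mean f"
proof -
  have *: "mean (\<lambda>x. p (x + h)) = mean p" if "trig p" for p :: "real ^ 'n \<Rightarrow> complex"
    using that
  proof induction
    case (trig_wave c \<mu>)
    have "mean (\<lambda>x. c * cis ((x + h) \<bullet> \<mu>)) = mean (\<lambda>x. (c * cis (h \<bullet> \<mu>)) * cis (x \<bullet> \<mu>))"
      by (simp add: inner_add_left flip: cis_mult) (simp add: mult_ac)
    then show ?case by (simp add: mean_cmult ap_wave mean_wave)
  next
    case (trig_add f g)
    then show ?case by (simp add: mean_add trig_ap ap_translate)
  qed
  have "cmod (mean (\<lambda>x. f (x + h)) - mean f) \<le> e" if e: "e > 0" for e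
  proof -
    obtain p where p: "trig p" "\<And>x. cmod (f x - p x) < e/2"
      by (rule apE[OF assms, of "e/2"]) (use e in auto)
    have "cmod (mean (\<lambda>x. f (x + h) - p (x + h))) \<le> e/2"
      by (rule mean_norm[OF ap_diff[OF ap_translate[OF assms] ap_translate[OF trig_ap[OF p(1)]]]])
        (rule less_imp_le[OF p(2)])
    moreover have "cmod (mean (\<lambda>x. f x - p x)) \<le> e/2"
      by (rule mean_norm[OF ap_diff[OF assms trig_ap[OF p(1)]]]) (rule less_imp_le[OF p(2)])
    ultimately show ?thesis
      using norm_triangle_ineq4[of "mean (\<lambda>x. f (x + h)) - mean p" "mean f - mean p"]
      by (simp add: mean_diff ap_translate assms trig_ap p(1) *)
  qed
  then have "cmod (mean (\<lambda>x. f (x + h)) - mean f) \<le> 0" by (rule field_le_epsilon) simp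
  then show ?thesis by simp
qed

section \<open>Bogolyubov's theorem\<close>

lemma cis_eq_1_iff_int: "cis x = 1 \<longleftrightarrow> (\<exists>m::int. x = 2 * pi * m)"
proof
  assume "cis x = 1"
  then have "cos x = 1" by (metis cis.simps(1) one_complex.simps(1))
  then show "\<exists>m::int. x = 2 * pi * m" by (auto simp: cos_one_2pi_int mult_ac)
next
  assume "\<exists>m::int. x = 2 * pi * m"
  then show "cis x = 1" using cis_multiple_2pi[OF Ints_of_int] by auto
qed

lemma sum_roots_of_unity:
  fixes d :: int and N :: nat
  assumes "N > 0"
  shows "(\<Sum>k<N. cis (2 * pi * (real k * of_int d) / N)) = (if int N dvd d then of_nat N else 0)"
proof -
  let ?z = "cis (2 * pi * of_int d / N)"
  have pow: "cis (2 * pi * (real k * of_int d) / N) = ?z ^ k" for k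
    by (simp only: Complex.DeMoivre) (rule arg_cong[of _ _ cis], simp)
  have z1: "?z = 1 \<longleftrightarrow> int N dvd d"
  proof -
    have "?z = 1 \<longleftrightarrow> (\<exists>m::int. 2 * pi * of_int d / N = 2 * pi * m)" by (rule cis_eq_1_iff_int)
    also have "\<dots> \<longleftrightarrow> (\<exists>m::int. real_of_int d = real_of_int (int N * m))"
      using assms by (simp add: field_simps)
    also have "\<dots> \<longleftrightarrow> int N dvd d" unfolding of_int_eq_iff dvd_def by simp
    finally show ?thesis .
  qed
  have zN: "?z ^ N = 1"
  proof -
    have "?z ^ N = cis (2 * pi * of_int d)" using assms by (simp add: Complex.DeMoivre)
    also have "\<dots> = 1" by (subst cis_eq_1_iff_int) auto
    finally show ?thesis .
  qed
  show ?thesis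
  proof (cases "int N dvd d")
    case True
    then show ?thesis unfolding pow using z1 by simp
  next
    case False
    then have "?z \<noteq> 1" using z1 by simp
    then show ?thesis unfolding pow using False zN by (simp add: geometric_sum)
  qed
qed

text \<open>These are the characters of the \<open>n\<close>-th power of the cyclic group of order
  \<open>N\<close>, evaluated on integer tuples so that residue classes need no type of their
  own.\<close>

definition cyc_char :: "nat \<Rightarrow> ('n::finite \<Rightarrow> nat) \<Rightarrow> ('n \<Rightarrow> int) \<Rightarrow> complex" where
  "cyc_char N k u = cis (2 * pi * (\<Sum>j\<in>UNIV. real (k j) * of_int (u j)) / N)"

text \<open>The sum factors into one geometric sum for each coordinate. This is the orthogonality
  relation behind Parseval's identity and behind counting solutions of congruences.\<close>

lemma cyc_char_sum:
  fixes u :: "'n::finite \<Rightarrow> int"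
  assumes "N > 0"
  shows "(\<Sum>k\<in>UNIV \<rightarrow>\<^sub>E {..<N}. cyc_char N k u) = (if \<forall>j. int N dvd u j then of_nat (N ^ CARD('n)) else 0)"
proof -
  have "cyc_char N k u = (\<Prod>j\<in>UNIV. cis (2 * pi * (real (k j) * of_int (u j)) / N))" for k
    unfolding cyc_char_def cis_conv_exp
    by (simp add: exp_sum[symmetric] sum_distrib_left sum_divide_distrib)
  then have "(\<Sum>k\<in>UNIV \<rightarrow>\<^sub>E {..<N}. cyc_char N k u) =
     (\<Prod>j\<in>UNIV. \<Sum>k<N. cis (2 * pi * (real k * of_int (u j)) / N))"
    by (subst prod_sum_PiE) auto
  also have "\<dots> = (\<Prod>j\<in>(UNIV::'n set). if int N dvd u j then of_nat N else 0)"
    by (simp only: sum_roots_of_unity[OF assms])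
  also have "\<dots> = (if \<forall>j. int N dvd u j then of_nat (N ^ CARD('n)) else 0)"
    by (auto simp: prod_zero_iff)
  finally show ?thesis .
qed

lemma cyc_char_diff: "cyc_char N k (\<lambda>j. u j - v j) = cyc_char N k u * cnj (cyc_char N k v)"
  unfolding cyc_char_def
  by (simp add: cis_cnj cis_mult right_diff_distrib sum_subtractf diff_divide_distrib
      flip: minus_divide_left)

text \<open>If \<open>t\<close> is not of the form \<open>a - b + c - d\<close>, then the fourth powers of the Fourier
  coefficients of \<open>A\<close>, weighted by the character values at \<open>t\<close>, sum to zero. As the trivial
  character alone contributes \<open>|A|\<^sup>4\<close>, one of the few large coefficients has to
  compensate.\<close>

lemma bogolyubov_cyclic:
  fixes A :: "('n::finite \<Rightarrow> int) set"
  assumes N: "N > 0" and A: "\<And>a j. a \<in> A \<Longrightarrow> 0 \<le> a j \<and> a j < int N"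
    and fin: "finite A" and \<delta>: "0 < \<delta>" "\<delta> \<le> 1" "\<delta> * real (N ^ CARD('n)) \<le> real (card A)"
  obtains S where "S \<subseteq> UNIV \<rightarrow>\<^sub>E {..<N}" "finite S" "real (card S) \<le> 2 / \<delta>\<^sup>2"
    "\<And>t. (\<And>k. k \<in> S \<Longrightarrow> Re (cyc_char N k t) \<ge> 0) \<Longrightarrow>
      \<exists>a\<in>A. \<exists>b\<in>A. \<exists>c\<in>A. \<exists>d\<in>A. \<forall>j. int N dvd (a j - b j + c j - d j - t j)"
proof -
  define P where "P = (UNIV::'n set) \<rightarrow>\<^sub>E {..<N}"
  define M where "M = real (N ^ CARD('n))"
  define m where "m = real (card A)"
  define \<alpha> where "\<alpha> = (\<lambda>k. \<Sum>a\<in>A. cyc_char N k a)"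
  \<comment> \<open>The threshold balances two estimates. By Parseval at most
    \<open>2 / \<delta>\<^sup>2\<close> coefficients reach it, and those below it contribute at most
    \<open>\<delta> / 2 * m\<^sup>2 * (M * m)\<close> in modulus, hence at most
    \<open>m ^ 4 / 2\<close> because \<open>\<delta> * M \<le> m\<close>. This cannot cancel the
    term \<open>m ^ 4\<close> of the trivial character.\<close>
  define S where "S = {k \<in> P. (cmod (\<alpha> k))\<^sup>2 \<ge> \<delta> / 2 * m\<^sup>2}"
  have finP: "finite P" unfolding P_def by (intro finite_PiE) auto
  have M: "M > 0" using N by (simp add: M_def)
  have "\<delta> * M \<le> m" using \<delta>(3) unfolding m_def M_def .
  moreover have "0 < \<delta> * M" using \<delta>(1) M by simp
  ultimately have m: "m > 0" "\<delta> * M \<le> m" by auto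
  have sq: "complex_of_real ((cmod (\<alpha> k))\<^sup>2) = (\<Sum>a\<in>A. \<Sum>b\<in>A. cyc_char N k (\<lambda>j. a j - b j))" for k
    unfolding complex_norm_square cyc_char_diff \<alpha>_def by (simp add: sum_product)
  have parseval: "(\<Sum>k\<in>P. (cmod (\<alpha> k))\<^sup>2) = M * m"
  proof -
    have "complex_of_real (\<Sum>k\<in>P. (cmod (\<alpha> k))\<^sup>2) =
        (\<Sum>a\<in>A. \<Sum>b\<in>A. \<Sum>k\<in>P. cyc_char N k (\<lambda>j. a j - b j))"
      by (simp only: of_real_sum sq) (subst sum.swap, intro sum.cong refl sum.swap)
    also have "\<dots> = (\<Sum>a\<in>A. \<Sum>b\<in>A. if b = a then of_nat (N ^ CARD('n)) else 0)"
    proof (intro sum.cong refl)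
      fix a b assume ab: "a \<in> A" "b \<in> A"
      \<comment> \<open>All tuples in \<open>A\<close> lie in one period box, so congruent ones are
        equal.\<close>
      have "(\<forall>j. int N dvd (a j - b j)) \<longleftrightarrow> b = a"
      proof
        assume *: "\<forall>j. int N dvd (a j - b j)"
        have "a j = b j" for j
        proof -
          have "\<bar>a j - b j\<bar> < int N" using A[OF ab(1), of j] A[OF ab(2), of j] by auto
          then show ?thesis using * zdvd_imp_le[of "int N" "\<bar>a j - b j\<bar>"] by force
        qed
        then show "b = a" by auto
      qed auto
      then show "(\<Sum>k\<in>P. cyc_char N k (\<lambda>j. a j - b j)) = (if b = a then of_nat (N ^ CARD('n)) else 0)"
        unfolding P_def cyc_char_sum[OF N] by simp
    qed
    also have "\<dots> = complex_of_real (M * m)" using fin by (simp add: M_def m_def)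
    finally show ?thesis by (simp only: of_real_eq_iff)
  qed
  have S: "S \<subseteq> P" "finite S" using finP by (auto simp: S_def)
  have cardS: "real (card S) \<le> 2 / \<delta>\<^sup>2"
  proof -
    have "real (card S) * (\<delta> / 2 * m\<^sup>2) = (\<Sum>k\<in>S. \<delta> / 2 * m\<^sup>2)" by simp
    also have "\<dots> \<le> (\<Sum>k\<in>S. (cmod (\<alpha> k))\<^sup>2)" by (rule sum_mono) (simp add: S_def)
    also have "\<dots> \<le> M * m" unfolding parseval[symmetric] by (rule sum_mono2) (use S finP in auto)
    also have "\<dots> \<le> (m / \<delta>) * m" using m \<delta> by (intro mult_right_mono) (auto simp: field_simps)
    finally have "real (card S) * \<delta>\<^sup>2 * m\<^sup>2 \<le> 2 * m\<^sup>2" using \<delta> by (simp add: field_simps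
        power2_eq_square)
    then have "real (card S) * \<delta>\<^sup>2 \<le> 2" using m by simp
    then show ?thesis using \<delta> by (simp add: field_simps)
  qed
  have "\<exists>a\<in>A. \<exists>b\<in>A. \<exists>c\<in>A. \<exists>d\<in>A. \<forall>j. int N dvd (a j - b j + c j - d j - t j)"
    if t: "\<And>k. k \<in> S \<Longrightarrow> Re (cyc_char N k t) \<ge> 0" for t
  proof (rule ccontr)
    assume no: "\<not> ?thesis"
    have "(\<Sum>k\<in>P. complex_of_real ((cmod (\<alpha> k))\<^sup>2) * complex_of_real ((cmod (\<alpha> k))\<^sup>2) * cnj
        (cyc_char N k t)) =
      (\<Sum>k\<in>P. \<Sum>a\<in>A. \<Sum>b\<in>A. \<Sum>c\<in>A. \<Sum>d\<in>A. cyc_char N k (\<lambda>j. a j - b j + c j - d j - t j))"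
    proof (rule sum.cong[OF refl])
      fix k
      have e: "cyc_char N k (\<lambda>j. a j - b j + c j - d j - t j) =
          cyc_char N k (\<lambda>j. a j - b j) * cyc_char N k (\<lambda>j. c j - d j) * cnj (cyc_char N k t)" for a b c d
      proof -
        have "cyc_char N k (\<lambda>j. a j - b j) = cyc_char N k (\<lambda>j. (a j - b j + c j - d j) - (c j - d j))"
          by (simp add: algebra_simps)
        also have "\<dots> * cyc_char N k (\<lambda>j. c j - d j) = cyc_char N k (\<lambda>j. a j - b j + c j - d j)"
          unfolding cyc_char_diff[of N k "\<lambda>j. a j - b j + c j - d j" "\<lambda>j. c j - d j"]
          by (simp add: cyc_char_def cis_cnj cis_mult)
        finally show ?thesis by (simp only: cyc_char_diff[of N k _ t])
      qed
      show "complex_of_real ((cmod (\<alpha> k))\<^sup>2) * complex_of_real ((cmod (\<alpha> k))\<^sup>2) * cnj (cyc_char N k t) =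
        (\<Sum>a\<in>A. \<Sum>b\<in>A. \<Sum>c\<in>A. \<Sum>d\<in>A. cyc_char N k (\<lambda>j. a j - b j + c j - d j - t j))"
        unfolding e sq
        by (simp only: sum_distrib_right) (simp only: sum_distrib_left sum_distrib_right)
    qed
    also have "\<dots> = (\<Sum>a\<in>A. \<Sum>b\<in>A. \<Sum>c\<in>A. \<Sum>d\<in>A. \<Sum>k\<in>P. cyc_char N k (\<lambda>j. a j - b j + c j - d j - t j))"
      by (simp only: sum.swap[of _ _ P])
    also have "\<dots> = 0"
    proof -
      have "(\<Sum>k\<in>P. cyc_char N k (\<lambda>j. a j - b j + c j - d j - t j)) = 0"
        if "a \<in> A" "b \<in> A" "c \<in> A" "d \<in> A" for a b c d
      proof -
        have "\<not> (\<forall>j. int N dvd (a j - b j + c j - d j - t j))" using no that by blast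
        then show ?thesis unfolding P_def cyc_char_sum[OF N] by (rule if_not_P)
      qed
      then show ?thesis by simp
    qed
    finally have "(\<Sum>k\<in>P. complex_of_real ((cmod (\<alpha> k))\<^sup>2) * complex_of_real ((cmod (\<alpha> k))\<^sup>2) * cnj
        (cyc_char N k t)) = 0" .
    then have "Re (\<Sum>k\<in>P. complex_of_real ((cmod (\<alpha> k))\<^sup>2) * complex_of_real ((cmod (\<alpha> k))\<^sup>2) * cnj
        (cyc_char N k t)) = 0"
      by simp
    then have zero: "(\<Sum>k\<in>P. (cmod (\<alpha> k)) ^ 4 * Re (cyc_char N k t)) = 0"
      by (simp add: Re_sum flip: of_real_mult power_add)
    define k0 where "k0 = (\<lambda>_::'n. 0::nat)"
    have k0: "k0 \<in> P" "\<alpha> k0 = complex_of_real m" "cyc_char N k0 t = 1"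
      using N by (auto simp: P_def k0_def \<alpha>_def cyc_char_def m_def)
    \<comment> \<open>Summed over all characters, these termwise bounds turn \<open>zero\<close>
      into \<open>m ^ 4 - \<delta> / 2 * m\<^sup>2 * (M * m) \<le> 0\<close>.\<close>
    have lower: "(if k = k0 then m ^ 4 else 0) - \<delta> / 2 * m\<^sup>2 * (cmod (\<alpha> k))\<^sup>2 \<le> (cmod (\<alpha> k)) ^ 4 *
        Re (cyc_char N k t)"
      if "k \<in> P" for k
    proof (cases "k = k0")
      case True
      then show ?thesis using k0 \<delta> m by (simp add: norm_power)
    next
      case False
      show ?thesis
      proof (cases "k \<in> S")
        case True
        then have "0 \<le> (cmod (\<alpha> k)) ^ 4 * Re (cyc_char N k t)" using t by simp
        moreover have "0 \<le> \<delta> / 2 * m\<^sup>2 * (cmod (\<alpha> k))\<^sup>2" using \<delta> by simp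
        ultimately show ?thesis using False by simp
      next
        case nS: False
        have "(cmod (\<alpha> k)) ^ 4 = (cmod (\<alpha> k))\<^sup>2 * (cmod (\<alpha> k))\<^sup>2" by (simp flip: power_add)
        also have "\<dots> \<le> \<delta> / 2 * m\<^sup>2 * (cmod (\<alpha> k))\<^sup>2"
          by (rule mult_right_mono) (use nS that in \<open>auto simp: S_def\<close>)
        finally have 1: "(cmod (\<alpha> k)) ^ 4 \<le> \<delta> / 2 * m\<^sup>2 * (cmod (\<alpha> k))\<^sup>2" .
        have "-1 \<le> Re (cyc_char N k t)" by (simp add: cyc_char_def)
        then have "(cmod (\<alpha> k)) ^ 4 * (-1) \<le> (cmod (\<alpha> k)) ^ 4 * Re (cyc_char N k t)"
          by (intro mult_left_mono) auto
        then show ?thesis using 1 False by simp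
      qed
    qed
    have "m ^ 4 - \<delta> / 2 * m\<^sup>2 * (M * m) =
        (\<Sum>k\<in>P. (if k = k0 then m ^ 4 else 0) - \<delta> / 2 * m\<^sup>2 * (cmod (\<alpha> k))\<^sup>2)"
    proof -
      have "(\<Sum>k\<in>P. (if k = k0 then m ^ 4 else 0) - \<delta> / 2 * m\<^sup>2 * (cmod (\<alpha> k))\<^sup>2) =
          (\<Sum>k\<in>P. if k = k0 then m ^ 4 else 0) - \<delta> / 2 * m\<^sup>2 * (\<Sum>k\<in>P. (cmod (\<alpha> k))\<^sup>2)"
        by (simp only: sum_subtractf sum_distrib_left)
      then show ?thesis using finP k0(1) by (simp add: parseval)
    qed
    also have "\<dots> \<le> (\<Sum>k\<in>P. (cmod (\<alpha> k)) ^ 4 * Re (cyc_char N k t))"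
      by (rule sum_mono) (rule lower)
    also note zero
    finally have "m ^ 3 * m \<le> m ^ 3 * (\<delta> * M / 2)" by (simp add: power_numeral_reduce mult_ac)
    then have "m \<le> \<delta> * M / 2" using m(1) by simp
    then show False using m by simp
  qed
  then show thesis using that[of S] S cardS unfolding P_def by blast
qed

section \<open>From cyclic groups to the lattice and to real vectors\<close>

lemma convergent_subsequence_finite:
  fixes \<theta> :: "nat \<Rightarrow> 'i \<Rightarrow> 'a::euclidean_space"
  assumes "finite I" "bounded B" "\<And>m i. i \<in> I \<Longrightarrow> \<theta> m i \<in> B"
  shows "\<exists>r l. strict_mono (r::nat \<Rightarrow> nat) \<and> (\<forall>i\<in>I. (\<lambda>m. \<theta> (r m) i) \<longlonglongrightarrow> l i)"
  using assms(1,3)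
proof (induction I)
  case empty
  show ?case by (rule exI[of _ id]) (auto simp: strict_mono_def)
next
  case (insert i I)
  then obtain r l where r: "strict_mono (r::nat \<Rightarrow> nat)" "\<forall>i\<in>I. (\<lambda>m. \<theta> (r m) i) \<longlonglongrightarrow> l i"
    by (metis insertCI)
  have "bounded (range (\<lambda>m. \<theta> (r m) i))"
    by (rule bounded_subset[OF assms(2)]) (use insert.prems in auto)
  then obtain L q where q: "strict_mono (q::nat \<Rightarrow> nat)" "((\<lambda>m. \<theta> (r m) i) \<circ> q) \<longlonglongrightarrow> L"
    using bounded_imp_convergent_subsequence[of "\<lambda>m. \<theta> (r m) i"] by blast
  have "(\<lambda>m. \<theta> (r (q m)) i') \<longlonglongrightarrow> (if i' = i then L else l i')" if "i' \<in> insert i I" for i'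
  proof (cases "i' = i")
    case True
    then show ?thesis using q(2) by (simp add: o_def)
  next
    case False
    then show ?thesis using r(2) that LIMSEQ_subseq_LIMSEQ[OF _ q(1), of "\<lambda>m. \<theta> (r m) i'"] by
        (auto simp: o_def)
  qed
  moreover have "strict_mono (r \<circ> q)" using r(1) q(1) by (rule strict_mono_o)
  ultimately show ?case
    by (intro exI[of _ "r \<circ> q"] exI[of _ "\<lambda>i'. if i' = i then L else l i'"]) (simp add: o_def)
qed

text \<open>The lattice is exhausted by boxes, each placed in a cyclic group. One point of
  \<open>A\<close> per cell gives a density that does not depend on the box, so at most
  \<open>K\<close> characters are needed at every stage, and their frequencies \<open>k / N\<close>
  in the unit cube converge along a subsequence. The condition on the limit frequencies is strict
  because it has to persist at a finite stage.\<close>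

lemma bogolyubov_lattice:
  fixes A :: "('n::finite \<Rightarrow> int) set"
  assumes q: "q > 0" and A: "\<And>b. \<exists>a\<in>A. \<forall>j. int q * b j \<le> a j \<and> a j < int q * (b j + 1)"
  obtains K :: nat and \<theta> :: "nat \<Rightarrow> real ^ 'n" where
    "\<And>t. (\<And>i. i < K \<Longrightarrow> Re (cis (2 * pi * (\<Sum>j\<in>UNIV. \<theta> i $ j * of_int (t j)))) > 0) \<Longrightarrow>
      \<exists>a\<in>A. \<exists>b\<in>A. \<exists>c\<in>A. \<exists>d\<in>A. \<forall>j. t j = a j - b j + c j - d j"
proof -
  define \<delta> where "\<delta> = (1 / (8 * real q)) ^ CARD('n)"
  define K where "K = nat \<lceil>2 / \<delta>\<^sup>2\<rceil>"
  \<comment> \<open>The period is eight times the side of the box holding \<open>Am m\<close>. For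
    \<open>t\<close> no larger than that side, \<open>a - b + c - d - t\<close> is then too short to
    wrap around, and divisibility by \<open>N m\<close> forces it to be zero. The factor 8 is the
    one in \<open>\<delta>\<close>.\<close>
  define N where "N = (\<lambda>m. 8 * q * Suc m)"
  define Am where "Am = (\<lambda>m. {a\<in>A. \<forall>j. 0 \<le> a j \<and> a j < int (q * Suc m)})"
  have \<delta>: "0 < \<delta>" "\<delta> \<le> 1" using q by (auto simp: \<delta>_def power_le_one)
  have N: "N m > 0" for m using q by (simp add: N_def)
  have finAm: "finite (Am m)" for m
  proof (rule finite_subset)
    show "Am m \<subseteq> UNIV \<rightarrow>\<^sub>E {0..<int (q * Suc m)}" by (auto simp: Am_def)
    show "finite ((UNIV::'n set) \<rightarrow>\<^sub>E {0..<int (q * Suc m)})" by (intro finite_PiE) auto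
  qed
  have cardAm: "\<delta> * real (N m ^ CARD('n)) \<le> real (card (Am m))" for m
  proof -
    obtain g where g: "\<And>b. g b \<in> A" "\<And>b j. int q * b j \<le> g b j" "\<And>b j. g b j < int q * (b j + 1)"
      using A by metis
    let ?B = "(UNIV::'n set) \<rightarrow>\<^sub>E {0..<int (Suc m)}"
    \<comment> \<open>Division by \<open>q\<close> recovers the cell from the chosen point, which
      makes \<open>g\<close> injective.\<close>
    have div: "g b j div int q = b j" for b j
      using g(2,3)[of b j] g(3)[of b j] q
      by (intro int_div_pos_eq[of _ _ _ "g b j - int q * b j"]) (auto simp: algebra_simps)
    have "inj_on g ?B" by (rule inj_onI) (metis div ext)
    moreover have "g b \<in> Am m" if "b \<in> ?B" for b
    proof -
      have "0 \<le> g b j \<and> g b j < int (q * Suc m)" for j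
      proof -
        have "b j \<in> {0..<int (Suc m)}" using that by blast
        then have b: "0 \<le> b j" "b j + 1 \<le> int (Suc m)" by auto
        have "int q * (b j + 1) \<le> int q * int (Suc m)" using b by (intro mult_left_mono) auto
        moreover have "0 \<le> int q * b j" using b by simp
        ultimately show ?thesis
          using g(2)[of b j] g(3)[of b j] by (simp only: of_nat_mult) linarith
      qed
      then show ?thesis using g(1) unfolding Am_def by blast
    qed
    ultimately have "card ?B \<le> card (Am m)" using finAm card_inj_on_le by (metis image_subsetI)
    then have "Suc m ^ CARD('n) \<le> card (Am m)" by (simp add: card_PiE del: of_nat_Suc)
    moreover have "\<delta> * real (N m ^ CARD('n)) = real (Suc m ^ CARD('n))"
    proof -
      have "\<delta> * real (N m ^ CARD('n)) = (1 / (8 * real q) * real (N m)) ^ CARD('n)"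
        by (simp only: \<delta>_def of_nat_power power_mult_distrib)
      also have "1 / (8 * real q) * real (N m) = real (Suc m)" using q by (simp add: N_def field_simps)
      finally show ?thesis by simp
    qed
    ultimately show ?thesis by (simp only: of_nat_le_iff)
  qed
  have AmN: "0 \<le> a j \<and> a j < int (N m)" if "a \<in> Am m" for a j m
  proof -
    have "0 \<le> a j" "a j < int (q * Suc m)" using that by (auto simp: Am_def)
    moreover have "int (N m) = 8 * int (q * Suc m)"
      by (simp only: N_def mult.assoc of_nat_mult of_nat_numeral)
    ultimately show ?thesis by linarith
  qed
  define good where "good = (\<lambda>m S. S \<subseteq> UNIV \<rightarrow>\<^sub>E {..<N m} \<and> finite S \<and> real (card S) \<le> 2 / \<delta>\<^sup>2 \<and>
    (\<forall>t. (\<forall>k\<in>S. Re (cyc_char (N m) k t) \<ge> 0) \<longrightarrow>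
      (\<exists>a\<in>Am m. \<exists>b\<in>Am m. \<exists>c\<in>Am m. \<exists>d\<in>Am m. \<forall>j. int (N m) dvd (a j - b j + c j - d j - t j))))"
  have "\<exists>S. good m S" for m
  proof (rule bogolyubov_cyclic[where N = "N m" and A = "Am m" and \<delta> = \<delta>, OF N _ finAm \<delta> cardAm])
    show "0 \<le> a j \<and> a j < int (N m)" if "a \<in> Am m" for a j using that by (rule AmN)
    fix S :: "('n \<Rightarrow> nat) set"
    assume 1: "S \<subseteq> UNIV \<rightarrow>\<^sub>E {..<N m}" "finite S" "real (card S) \<le> 2 / \<delta>\<^sup>2"
      and 2: "\<And>t. (\<And>k. k \<in> S \<Longrightarrow> Re (cyc_char (N m) k t) \<ge> 0) \<Longrightarrow>
        \<exists>a\<in>Am m. \<exists>b\<in>Am m. \<exists>c\<in>Am m. \<exists>d\<in>Am m. \<forall>j. int (N m) dvd (a j - b j + c j - d j - t j)"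
    show ?thesis unfolding good_def by (intro exI[of _ S] conjI 1 allI impI 2) simp
  qed
  then obtain S where good: "\<And>m. good m (S m)" by metis
  have S: "S m \<subseteq> UNIV \<rightarrow>\<^sub>E {..<N m}" "finite (S m)" "real (card (S m)) \<le> 2 / \<delta>\<^sup>2"
    "\<And>t. (\<forall>k\<in>S m. Re (cyc_char (N m) k t) \<ge> 0) \<Longrightarrow>
      (\<exists>a\<in>Am m. \<exists>b\<in>Am m. \<exists>c\<in>Am m. \<exists>d\<in>Am m. \<forall>j. int (N m) dvd (a j - b j + c j - d j - t j))" for m
    using good[of m] unfolding good_def by blast+
  have cardS: "card (S m) \<le> K" for m using S(3)[of m] unfolding K_def by linarith
  have "\<forall>m. \<exists>e. bij_betw e {0..<card (S m)} (S m)" using ex_bij_betw_nat_finite S(2) by blast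
  then obtain e where e: "\<And>m. bij_betw (e m) {0..<card (S m)} (S m)" by metis
  \<comment> \<open>Missing indices are filled with the trivial character, so that every stage has
    the same \<open>K\<close> slots and the subsequence can be taken slot by slot.\<close>
  define k where "k = (\<lambda>m i. if i < card (S m) then e m i else (\<lambda>_. 0))"
  have kP: "k m i j < N m" for m i j
  proof (cases "i < card (S m)")
    case True
    then have "e m i \<in> S m" using e[of m] by (auto simp: bij_betw_def)
    then show ?thesis using S(1)[of m] True by (auto simp: k_def)
  qed (simp add: k_def N)
  have kS: "\<exists>i<K. \<kappa> = k m i" if "\<kappa> \<in> S m" for m \<kappa>
  proof -
    have "\<kappa> \<in> e m ` {0..<card (S m)}" using e[of m] that by (simp add: bij_betw_def)
    then obtain i where "i < card (S m)" "\<kappa> = e m i" by auto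
    then show ?thesis using cardS[of m] by (intro exI[of _ i]) (auto simp: k_def)
  qed
  define \<theta> where "\<theta> = (\<lambda>m i. (\<chi> j. real (k m i j) / real (N m)) :: real ^ 'n)"
  have char: "cyc_char (N m) (k m i) t = cis (2 * pi * (\<Sum>j\<in>UNIV. \<theta> m i $ j * of_int (t j)))" for m i t
    by (simp only: cyc_char_def \<theta>_def vec_lambda_beta times_divide_eq_left
        sum_divide_distrib[symmetric] times_divide_eq_right)
  have "\<theta> m i \<in> cbox 0 1" for m i
    using kP[of m i] N[of m] by (auto simp: \<theta>_def mem_box_cart less_imp_le)
  then have "\<exists>r l. strict_mono (r::nat \<Rightarrow> nat) \<and> (\<forall>i\<in>{..<K}. (\<lambda>m. \<theta> (r m) i) \<longlonglongrightarrow> l i)"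
    by (intro convergent_subsequence_finite[OF _ bounded_cbox]) auto
  then obtain r \<phi> where r: "strict_mono (r::nat \<Rightarrow> nat)"
    and \<phi>: "\<And>i. i \<in> {..<K} \<Longrightarrow> (\<lambda>m. \<theta> (r m) i) \<longlonglongrightarrow> \<phi> i"
    by metis
  have "\<exists>a\<in>A. \<exists>b\<in>A. \<exists>c\<in>A. \<exists>d\<in>A. \<forall>j. t j = a j - b j + c j - d j"
    if t: "\<And>i. i < K \<Longrightarrow> Re (cis (2 * pi * (\<Sum>j\<in>UNIV. \<phi> i $ j * of_int (t j)))) > 0" for t
  proof -
    have "\<forall>\<^sub>F m in sequentially. Re (cyc_char (N (r m)) (k (r m) i) t) > 0" if "i < K" for i
    proof -
      have "(\<lambda>m. Re (cis (2 * pi * (\<Sum>j\<in>UNIV. \<theta> (r m) i $ j * of_int (t j))))) \<longlonglongrightarrow>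
          Re (cis (2 * pi * (\<Sum>j\<in>UNIV. \<phi> i $ j * of_int (t j))))"
        unfolding cis.simps using \<phi>[of i] that by (intro tendsto_intros) auto
      then show ?thesis unfolding char by (rule order_tendstoD(1)) (rule t[OF that])
    qed
    then have "\<forall>\<^sub>F m in sequentially. \<forall>i\<in>{..<K}. Re (cyc_char (N (r m)) (k (r m) i) t) > 0"
      by (intro eventually_ball_finite) auto
    \<comment> \<open>This makes the box of stage \<open>r m\<close> large enough to hold
      \<open>t\<close>, since \<open>r m \<ge> m\<close>.\<close>
    moreover have "\<forall>\<^sub>F m in sequentially. m \<ge> nat (Max (range (\<lambda>j. \<bar>t j\<bar>)))"
      by (rule eventually_ge_at_top)
    ultimately have "\<forall>\<^sub>F m in sequentially. (\<forall>i\<in>{..<K}. Re (cyc_char (N (r m)) (k (r m) i) t) > 0)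
        \<and> m \<ge> nat (Max (range (\<lambda>j. \<bar>t j\<bar>)))"
      by eventually_elim simp
    then obtain m where m: "\<forall>i\<in>{..<K}. Re (cyc_char (N (r m)) (k (r m) i) t) > 0"
      "m \<ge> nat (Max (range (\<lambda>j. \<bar>t j\<bar>)))"
      by (auto simp: eventually_sequentially)
    have tm: "\<bar>t j\<bar> \<le> int (r m)" for j
    proof -
      have "\<bar>t j\<bar> \<le> Max (range (\<lambda>j. \<bar>t j\<bar>))" by (rule Max_ge) auto
      then show ?thesis using m(2) seq_suble[OF r, of m] by linarith
    qed
    have "\<forall>\<kappa>\<in>S (r m). Re (cyc_char (N (r m)) \<kappa> t) \<ge> 0"
      using m(1) kS by (metis lessThan_iff less_imp_le)
    then obtain a b c d where abcd: "a \<in> Am (r m)" "b \<in> Am (r m)" "c \<in> Am (r m)" "d \<in> Am (r m)"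
      "\<And>j. int (N (r m)) dvd (a j - b j + c j - d j - t j)"
      using S(4) by blast
    have "t j = a j - b j + c j - d j" for j
    proof -
      let ?Q = "int (q * Suc (r m))"
      have "0 \<le> a j" "a j < ?Q" "0 \<le> b j" "b j < ?Q" "0 \<le> c j" "c j < ?Q" "0 \<le> d j" "d j < ?Q"
        using abcd by (auto simp: Am_def)
      moreover have "\<bar>t j\<bar> \<le> ?Q"
      proof -
        have "int (r m) \<le> int (1 * Suc (r m))" by simp
        also have "\<dots> \<le> ?Q" unfolding of_nat_le_iff by (rule mult_le_mono1) (use q in simp)
        finally show ?thesis using tm[of j] by linarith
      qed
      ultimately have "\<bar>a j - b j + c j - d j - t j\<bar> < 8 * ?Q" by linarith
      moreover have "8 * ?Q = int (N (r m))"
        by (simp only: N_def mult.assoc of_nat_mult of_nat_numeral)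
      ultimately have "\<bar>a j - b j + c j - d j - t j\<bar> < int (N (r m))" by simp
      then show ?thesis
        using abcd(5)[of j] zdvd_imp_le[of "int (N (r m))" "\<bar>a j - b j + c j - d j - t j\<bar>"] by force
    qed
    moreover have "a \<in> A" "b \<in> A" "c \<in> A" "d \<in> A" using abcd by (auto simp: Am_def)
    ultimately show ?thesis by blast
  qed
  then show thesis using that by blast
qed

text \<open>Modulo integers only the numbers \<open>y\<close> with
  \<open>\<eta> \<le> \<bar>y\<bar> \<le> 1/2\<close> have to be excluded. On this compact set the
  distance from \<open>cis (2 * pi * y)\<close> to 1 has no zero, hence a positive minimum.\<close>

lemma cis_near_1_imp_near_int:
  assumes "\<eta> > 0"
  obtains \<delta> where "\<delta> > 0"
    "\<And>x. cmod (cis (2 * pi * x) - 1) < \<delta> \<Longrightarrow> \<bar>x - of_int (round x)\<bar> < \<eta>"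
proof -
  define S where "S = {y::real. \<eta> \<le> \<bar>y\<bar> \<and> \<bar>y\<bar> \<le> 1/2}"
  have S: "compact S"
  proof -
    have "S = {-1/2..-\<eta>} \<union> {\<eta>..1/2}" using assms by (auto simp: S_def)
    then show ?thesis by (simp add: compact_Un)
  qed
  have red: "cis (2 * pi * x) = cis (2 * pi * (x - of_int (round x)))" for x
  proof -
    have "cis (2 * pi * x) = cis (2 * pi * (x - of_int (round x))) * cis (2 * pi * of_int (round x))"
      by (simp add: cis_mult algebra_simps)
    then show ?thesis by (simp add: cis_multiple_2pi)
  qed
  have half: "\<bar>x - of_int (round x)\<bar> \<le> 1/2" for x :: real
    using of_int_round_abs_le[of x] by (simp add: abs_minus_commute)
  have "\<exists>\<delta>>0. \<forall>y\<in>S. \<delta> \<le> cmod (cis (2 * pi * y) - 1)"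
  proof (cases "S = {}")
    case True
    then show ?thesis by (intro exI[of _ 1]) auto
  next
    case False
    have "continuous_on S (\<lambda>y. cmod (cis (2 * pi * y) - 1))"
      by (auto simp: cis_conv_exp intro!: continuous_intros)
    then obtain z where z: "z \<in> S" "\<And>y. y \<in> S \<Longrightarrow> cmod (cis (2 * pi * z) - 1) \<le> cmod (cis (2 * pi *
        y) - 1)"
      using continuous_attains_inf[OF S False] by blast
    have "cis (2 * pi * z) \<noteq> 1"
    proof
      assume "cis (2 * pi * z) = 1"
      then obtain m :: int where "2 * pi * z = 2 * pi * m" using cis_eq_1_iff_int by blast
      then have "z = m" by simp
      moreover have "real_of_int \<bar>m\<bar> < real_of_int 1" using z(1) \<open>z = m\<close> by (simp add: S_def)
      then have "m = 0" unfolding of_int_less_iff by simp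
      ultimately show False using z(1) assms by (simp add: S_def)
    qed
    then show ?thesis using z by (intro exI[of _ "cmod (cis (2 * pi * z) - 1)"]) auto
  qed
  then obtain \<delta> where \<delta>: "\<delta> > 0" "\<And>y. y \<in> S \<Longrightarrow> \<delta> \<le> cmod (cis (2 * pi * y) - 1)" by blast
  show thesis
  proof (rule that[OF \<delta>(1)])
    fix x assume x: "cmod (cis (2 * pi * x) - 1) < \<delta>"
    show "\<bar>x - of_int (round x)\<bar> < \<eta>"
    proof (rule ccontr)
      assume "\<not> ?thesis"
      then have "x - of_int (round x) \<in> S" using half[of x] by (simp add: S_def)
      then show False using \<delta>(2) x red[of x] by (metis not_le)
    qed
  qed
qed

lemma norm_cis_diff_1_le: "cmod (cis x - 1) \<le> \<bar>x\<bar>"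
proof -
  have "(cmod (cis x - 1))\<^sup>2 = (cos x - 1)\<^sup>2 + (sin x)\<^sup>2" by (simp add: cmod_power2)
  also have "\<dots> = 2 - 2 * cos x" using sin_cos_squared_add[of x] by (simp add: power2_diff)
  also have "\<dots> = (2 * sin (x / 2))\<^sup>2" using cos_double_sin[of "x / 2"] by (simp add: power_mult_distrib)
  also have "\<dots> \<le> x\<^sup>2" using abs_sin_x_le_abs_x[of "x / 2"] by (intro abs_le_square_iff[THEN
      iffD1]) (simp add: abs_mult)
  finally show ?thesis by (simp add: abs_le_square_iff[symmetric])
qed

text \<open>Space is discretised with mesh \<open>h\<close>: rounding \<open>U\<close> down gives a
  lattice set with a point in every large box. The frequencies
  \<open>(2 * pi / h) *\<^sub>R axis j 1\<close> force \<open>s / h\<close> to be near an integer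
  tuple \<open>t\<close>, and the frequencies built from \<open>\<theta>\<close> then yield the
  lattice condition at \<open>t\<close>.\<close>

lemma bogolyubov:
  fixes U :: "(real ^ 'n) set"
  assumes U: "\<And>\<xi>. \<exists>\<tau>\<in>U. \<forall>j. \<bar>\<tau> $ j - \<xi> $ j\<bar> < L" and r: "r > 0"
  obtains \<Lambda> \<delta> where "finite \<Lambda>" "\<delta> > 0"
    "\<And>s. (\<And>\<mu>. \<mu> \<in> \<Lambda> \<Longrightarrow> cmod (cis (s \<bullet> \<mu>) - 1) < \<delta>) \<Longrightarrow>
      \<exists>a\<in>U. \<exists>b\<in>U. \<exists>c\<in>U. \<exists>d\<in>U. norm (s - (a - b + c - d)) < r"
proof -
  define n where "n = real CARD('n)"
  have n: "n \<ge> 1" by (simp add: n_def Suc_leI)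
  \<comment> \<open>Rounding costs less than \<open>6 * h\<close> in each coordinate, and the norm
    is at most the sum of the \<open>n\<close> coordinates in modulus.\<close>
  define h where "h = r / (6 * n)"
  have h: "h > 0" using r n by (simp add: h_def)
  have L: "L > 0" using U[of 0] abs_ge_zero le_less_trans by blast
  define A where "A = (\<lambda>u::real^'n. (\<lambda>j. \<lfloor>u $ j / h\<rfloor>)) ` U"
  \<comment> \<open>A cube of side \<open>q * h\<close> then contains the cube of half-side
    \<open>L\<close> about its centre, where \<open>U\<close> has a point, and leaves room for the
    floor.\<close>
  define q where "q = nat \<lceil>2 * (L / h + 1)\<rceil>"
  have q: "q > 0" "real q \<ge> 2 * (L / h + 1)"
  proof -
    show *: "real q \<ge> 2 * (L / h + 1)" unfolding q_def by (rule real_nat_ceiling_ge)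
    have "L / h > 0" using L h by simp
    then have "0 < 2 * (L / h + 1)" by simp
    then have "real q > 0" using * by (rule less_le_trans)
    then show "q > 0" by simp
  qed
  have Aq: "\<exists>a\<in>A. \<forall>j. int q * b j \<le> a j \<and> a j < int q * (b j + 1)" for b
  proof -
    obtain \<tau> where \<tau>: "\<tau> \<in> U" "\<And>j. \<bar>\<tau> $ j - h * (q * b j + q / 2)\<bar> < L"
      using U[of "\<chi> j. h * (q * b j + q / 2)"] by auto
    have "int q * b j \<le> \<lfloor>\<tau> $ j / h\<rfloor> \<and> \<lfloor>\<tau> $ j / h\<rfloor> < int q * (b j + 1)" for j
    proof -
      have "\<tau> $ j / h - (q * b j + q / 2) = (\<tau> $ j - h * (q * b j + q / 2)) / h"
        using h by (simp add: field_simps)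
      then have "\<bar>\<tau> $ j / h - (q * b j + q / 2)\<bar> < L / h"
        using \<tau>(2)[of j] h by (simp add: divide_strict_right_mono)
      then have *: "\<bar>\<tau> $ j / h - (real_of_int (int q * b j) + real q / 2)\<bar> < L / h" by simp
      have **: "real_of_int (int q * (b j + 1)) = real_of_int (int q * b j) + real q"
        by (simp add: distrib_left)
      define X Y Z where "X = \<tau> $ j / h" and "Y = L / h" and "Z = real_of_int (int q * b j)"
      have lin: "Z \<le> X \<and> X < Z + Q" if "\<bar>X - (Z + Q / 2)\<bar> < Y" "2 * (Y + 1) \<le> Q" for X Y Z Q :: real
        using that by (simp add: abs_less_iff)
      have "Z \<le> X" "X < Z + real q"
        using lin[of X Z "real q" Y] * q(2) by (simp_all only: X_def Y_def Z_def)
      then have "real_of_int (int q * b j) \<le> \<tau> $ j / h" "\<tau> $ j / h < real_of_int (int q * (b j + 1))"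
        unfolding ** by (simp_all only: X_def Z_def)
      then show ?thesis by (simp only: le_floor_iff floor_less_iff)
    qed
    then show ?thesis using \<tau>(1) by (auto simp: A_def)
  qed
  obtain K and \<theta> :: "nat \<Rightarrow> real ^ 'n" where \<theta>: "\<And>t. (\<And>i. i < K \<Longrightarrow> Re (cis (2 * pi * (\<Sum>j\<in>UNIV. \<theta> i $
      j * of_int (t j)))) > 0) \<Longrightarrow>
      \<exists>a\<in>A. \<exists>b\<in>A. \<exists>c\<in>A. \<exists>d\<in>A. \<forall>j. t j = a j - b j + c j - d j"
    using bogolyubov_lattice[OF q(1) Aq] by blast
  define B where "B = 1 + (\<Sum>i<K. \<Sum>j\<in>UNIV. \<bar>\<theta> i $ j\<bar>)"
  have B: "B \<ge> 1" by (simp add: B_def sum_nonneg)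
  \<comment> \<open>Replacing \<open>s / h\<close> by the integer tuple changes each phase by at
    most \<open>2 * pi * B * \<eta>\<close>, hence by at most 1/2. As the value at \<open>s\<close>
    is within 1/2 of 1 by the choice of the Bohr neighbourhood below, the value at \<open>t\<close>
    is at distance less than 1 from 1 and has positive real part.\<close>
  define \<eta> where "\<eta> = min 1 (1 / (4 * pi * B))"
  have \<eta>: "\<eta> > 0" "\<eta> \<le> 1" "2 * pi * B * \<eta> \<le> 1/2" 
  proof -
    show "\<eta> > 0" "\<eta> \<le> 1" using B by (auto simp: \<eta>_def)
    have "2 * pi * B * \<eta> \<le> 2 * pi * B * (1 / (4 * pi * B))"
      using B by (intro mult_left_mono) (auto simp: \<eta>_def)
    then show "2 * pi * B * \<eta> \<le> 1/2" using B by simp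
  qed
  obtain \<delta>0 where \<delta>0: "\<delta>0 > 0" "\<And>x. cmod (cis (2 * pi * x) - 1) < \<delta>0 \<Longrightarrow> \<bar>x - of_int (round x)\<bar> < \<eta>"
    using cis_near_1_imp_near_int[OF \<eta>(1)] by blast
  define \<Lambda> where "\<Lambda> = (\<lambda>i. (2 * pi / h) *\<^sub>R \<theta> i) ` {..<K} \<union> (\<lambda>j. (2 * pi / h) *\<^sub>R axis j 1) ` UNIV"
  show thesis
  proof (rule that)
    show "finite \<Lambda>" by (simp add: \<Lambda>_def)
    show "min \<delta>0 (1/2) > 0" using \<delta>0 by simp
    fix s assume s: "\<And>\<mu>. \<mu> \<in> \<Lambda> \<Longrightarrow> cmod (cis (s \<bullet> \<mu>) - 1) < min \<delta>0 (1/2)"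
    define t where "t = (\<lambda>j. round (s $ j / h))"
    have near: "\<bar>s $ j / h - t j\<bar> < \<eta>" for j
    proof -
      have "cmod (cis (s \<bullet> ((2 * pi / h) *\<^sub>R axis j 1)) - 1) < \<delta>0"
      proof -
        have "(2 * pi / h) *\<^sub>R axis j 1 \<in> \<Lambda>" unfolding \<Lambda>_def by blast
        from s[OF this] show ?thesis by simp
      qed
      then have "cmod (cis (2 * pi * (s $ j / h)) - 1) < \<delta>0" by (simp add: inner_axis)
      then show ?thesis using \<delta>0(2) by (simp add: t_def)
    qed
    have "Re (cis (2 * pi * (\<Sum>j\<in>UNIV. \<theta> i $ j * of_int (t j)))) > 0" if i: "i < K" for i
    proof -
      let ?x = "2 * pi * (\<Sum>j\<in>UNIV. \<theta> i $ j * (s $ j / h))"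
      let ?y = "2 * pi * (\<Sum>j\<in>UNIV. \<theta> i $ j * of_int (t j))"
      have sx: "s \<bullet> ((2 * pi / h) *\<^sub>R \<theta> i) = ?x"
      proof -
        have "s \<bullet> ((2 * pi / h) *\<^sub>R \<theta> i) = 2 * pi / h * (\<Sum>j\<in>UNIV. s $ j * \<theta> i $ j)"
          by (simp only: inner_scaleR_right) (simp add: inner_vec_def)
        also have "\<dots> = (\<Sum>j\<in>UNIV. 2 * pi * (\<theta> i $ j * (s $ j / h)))"
          unfolding sum_distrib_left by (rule sum.cong) auto
        finally show ?thesis by (simp only: sum_distrib_left)
      qed
      have 1: "cmod (cis ?x - 1) < 1/2"
        using s[of "(2 * pi / h) *\<^sub>R \<theta> i"] i unfolding sx by (auto simp: \<Lambda>_def)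
      have "\<bar>?x - ?y\<bar> = 2 * pi * \<bar>\<Sum>j\<in>UNIV. \<theta> i $ j * (s $ j / h - of_int (t j))\<bar>"
      proof -
        have "?x - ?y = 2 * pi * (\<Sum>j\<in>UNIV. \<theta> i $ j * (s $ j / h - of_int (t j)))"
          by (simp only: right_diff_distrib sum_subtractf)
        then show ?thesis by (simp add: abs_mult)
      qed
      also have "\<dots> \<le> 2 * pi * (\<Sum>j\<in>UNIV. \<bar>\<theta> i $ j\<bar> * \<eta>)"
        using near by (intro mult_left_mono order_trans[OF sum_abs] sum_mono)
          (simp_all add: abs_mult mult_left_mono less_imp_le[OF near])
      also have "\<dots> = 2 * pi * (\<Sum>j\<in>UNIV. \<bar>\<theta> i $ j\<bar>) * \<eta>" by (simp add: sum_distrib_right)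
      also have "\<dots> \<le> 2 * pi * B * \<eta>"
      proof -
        have "(\<Sum>j\<in>UNIV. \<bar>\<theta> i $ j\<bar>) \<le> (\<Sum>i<K. \<Sum>j\<in>UNIV. \<bar>\<theta> i $ j\<bar>)"
          by (rule member_le_sum[of i "{..<K}" "\<lambda>i. \<Sum>j\<in>UNIV. \<bar>\<theta> i $ j\<bar>"]) (use i in \<open>auto intro:
              sum_nonneg\<close>)
        then show ?thesis using \<eta>(1) by (intro mult_right_mono mult_left_mono) (auto simp: B_def)
      qed
      finally have "\<bar>?x - ?y\<bar> \<le> 1/2" using \<eta>(3) by linarith
      then have 2: "cmod (cis (?x - ?y) - 1) \<le> 1/2" using norm_cis_diff_1_le order_trans by blast
      have "cis ?x - cis ?y = cis ?y * (cis (?x - ?y) - 1)" by (simp add: right_diff_distrib cis_mult)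
      then have "cmod (cis ?x - cis ?y) \<le> 1/2" using 2 by (simp add: norm_mult)
      then have "cmod (1 - cis ?y) < 1"
        using 1 norm_triangle_ineq[of "1 - cis ?x" "cis ?x - cis ?y"] by (simp add: norm_minus_commute)
      then have "\<bar>Re (1 - cis ?y)\<bar> < 1" using abs_Re_le_cmod le_less_trans by blast
      then show ?thesis by simp
    qed
    then obtain a b c d where abcd: "a \<in> U" "b \<in> U" "c \<in> U" "d \<in> U"
      "\<And>j. t j = \<lfloor>a $ j / h\<rfloor> - \<lfloor>b $ j / h\<rfloor> + \<lfloor>c $ j / h\<rfloor> - \<lfloor>d $ j / h\<rfloor>"
      using \<theta>[of t] unfolding A_def by blast
    have "\<bar>(s - (a - b + c - d)) $ j\<bar> < 6 * h" for j
    proof -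
      have "real_of_int (t j) = \<lfloor>a $ j / h\<rfloor> - \<lfloor>b $ j / h\<rfloor> + \<lfloor>c $ j / h\<rfloor> - \<lfloor>d $ j / h\<rfloor>"
        by (simp add: abcd(5))
      then have "\<bar>s $ j / h - (a $ j / h - b $ j / h + c $ j / h - d $ j / h)\<bar> < 6"
        using near[of j] \<eta>(2) by linarith
      moreover have "s $ j / h - (a $ j / h - b $ j / h + c $ j / h - d $ j / h) = (s - (a - b + c
          - d)) $ j / h"
        by (simp add: diff_divide_distrib add_divide_distrib)
      ultimately have "\<bar>(s - (a - b + c - d)) $ j / h\<bar> < 6" by simp
      then show ?thesis using h by (simp only: abs_divide pos_divide_less_eq abs_of_pos)
    qed
    then have "(\<Sum>j\<in>UNIV. \<bar>(s - (a - b + c - d)) $ j\<bar>) < (\<Sum>j\<in>(UNIV::'n set). 6 * h)"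
      by (intro sum_strict_mono) auto
    also have "\<dots> = r" using n by (simp add: h_def n_def)
    finally have "norm (s - (a - b + c - d)) < r" using norm_le_l1_cart le_less_trans by blast
    then show "\<exists>a\<in>U. \<exists>b\<in>U. \<exists>c\<in>U. \<exists>d\<in>U. norm (s - (a - b + c - d)) < r" using abcd by blast
  qed
qed

section \<open>Almost periodic mappings\<close>

lemma bohr_sets_totally_bounded:
  fixes \<Lambda> :: "(real ^ 'n) set"
  assumes "finite \<Lambda>" "\<delta> > 0"
  obtains T where "finite T" "T \<noteq> {}"
    "\<And>x. \<exists>i\<in>T. \<forall>\<mu>\<in>\<Lambda>. cmod (cis ((x - i) \<bullet> \<mu>) - 1) < \<delta>"
proof -
  obtain M :: nat where M: "2 / \<delta> < real M" using reals_Archimedean2 by blast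
  have M0: "real M > 0" using M assms(2) by (metis divide_pos_pos less_trans zero_less_numeral)
  \<comment> \<open>Each point is coded by the grid cells of side \<open>1 / M\<close> that contain
    its values \<open>cis (x \<bullet> \<mu>)\<close>. Only finitely many codes occur,
    \<open>T\<close> holds one point for each, and points with the same code have nearby
    values.\<close>
  define q where "q = (\<lambda>x. \<lambda>\<mu>\<in>\<Lambda>. (\<lfloor>real M * cos (x \<bullet> \<mu>)\<rfloor>, \<lfloor>real M * sin (x \<bullet> \<mu>)\<rfloor>))"
  have fl: "\<lfloor>real M * u\<rfloor> \<in> {-int M..int M}" if "\<bar>u\<bar> \<le> 1" for u
  proof -
    have "real M * u \<le> real M * 1" "real M * (-1) \<le> real M * u"
      using that by (auto intro!: mult_left_mono simp only: abs_le_iff)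
    then show ?thesis by (auto simp: le_floor_iff floor_le_iff)
  qed
  have "range q \<subseteq> (\<Pi>\<^sub>E \<mu>\<in>\<Lambda>. {-int M..int M} \<times> {-int M..int M})"
    using fl unfolding q_def by (auto simp del: atLeastAtMost_iff)
  then have fin: "finite (range q)"
    by (rule finite_subset) (intro finite_PiE assms(1), simp)
  define T where "T = inv_into UNIV q ` range q"
  show thesis
  proof (rule that)
    show "finite T" "T \<noteq> {}" using fin by (auto simp: T_def)
    fix x
    define i where "i = inv_into UNIV q (q x)"
    have qi: "q i = q x" unfolding i_def by (rule f_inv_into_f) simp
    have "cmod (cis ((x - i) \<bullet> \<mu>) - 1) < \<delta>" if "\<mu> \<in> \<Lambda>" for \<mu>
    proof -
      have e: "\<lfloor>real M * cos (i \<bullet> \<mu>)\<rfloor> = \<lfloor>real M * cos (x \<bullet> \<mu>)\<rfloor>" "\<lfloor>real M * sin (i \<bullet> \<mu>)\<rfloor> = \<lfloor>real M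
          * sin (x \<bullet> \<mu>)\<rfloor>"
        using fun_cong[OF qi, of \<mu>] that by (auto simp: q_def)
      have near: "\<bar>a - b\<bar> < 1 / real M" if "\<lfloor>real M * b\<rfloor> = \<lfloor>real M * a\<rfloor>" for a b
      proof -
        have "\<bar>real M * a - real M * b\<bar> < 1" using that by linarith
        then have "real M * \<bar>a - b\<bar> < 1" by (simp add: abs_mult flip: right_diff_distrib)
        then show ?thesis using M0 by (simp add: field_simps)
      qed
      have "cis ((x - i) \<bullet> \<mu>) - 1 = cis (- (i \<bullet> \<mu>)) * (cis (x \<bullet> \<mu>) - cis (i \<bullet> \<mu>))"
        by (simp add: right_diff_distrib cis_mult inner_diff_left)
      then have "cmod (cis ((x - i) \<bullet> \<mu>) - 1) = cmod (cis (x \<bullet> \<mu>) - cis (i \<bullet> \<mu>))"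
        by (simp add: norm_mult)
      also have "\<dots> \<le> \<bar>cos (x \<bullet> \<mu>) - cos (i \<bullet> \<mu>)\<bar> + \<bar>sin (x \<bullet> \<mu>) - sin (i \<bullet> \<mu>)\<bar>"
        using cmod_le[of "cis (x \<bullet> \<mu>) - cis (i \<bullet> \<mu>)"] by simp
      also have "\<dots> < 1 / real M + 1 / real M" by (intro add_strict_mono near e)
      also have "\<dots> < \<delta>" using M M0 assms(2) by (simp add: field_simps)
      finally show ?thesis .
    qed
    then show "\<exists>i\<in>T. \<forall>\<mu>\<in>\<Lambda>. cmod (cis ((x - i) \<bullet> \<mu>) - 1) < \<delta>"
      by (intro bexI[of _ i]) (auto simp: T_def i_def)
  qed
qed

text \<open>Here \<open>k\<close> is a trigonometric polynomial measuring the distance from the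
  origin, so truncating \<open>\<delta>\<^sup>2 - k\<close> gives a kernel that vanishes outside the
  Bohr neighbourhood. Finitely many translates of a smaller Bohr neighbourhood cover the space,
  which is the source of the bound \<open>c\<close>. That bound makes the mean positive and allows
  partitions of unity.\<close>

lemma bohr_kernel:
  fixes \<Lambda> :: "(real ^ 'n) set"
  assumes "finite \<Lambda>" "\<delta> > 0"
  obtains W :: "real ^ 'n \<Rightarrow> real" and T c where
    "ap (\<lambda>t. complex_of_real (W t))" "\<And>t. W t \<ge> 0"
    "\<And>t \<mu>. W t > 0 \<Longrightarrow> \<mu> \<in> \<Lambda> \<Longrightarrow> cmod (cis (t \<bullet> \<mu>) - 1) < \<delta>"
    "finite T" "c > 0" "\<And>x. (\<Sum>i\<in>T. W (x - i)) \<ge> c"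
proof -
  define k where "k = (\<lambda>t. \<Sum>\<mu>\<in>\<Lambda>. (cmod (cis (t \<bullet> \<mu>) - 1))\<^sup>2)"
  define W where "W = (\<lambda>t. max 0 (\<delta>\<^sup>2 - k t))"
  have "complex_of_real (k t) = (\<Sum>\<mu>\<in>\<Lambda>. (cis (t \<bullet> \<mu>) - 1) * (cis (t \<bullet> (- \<mu>)) - 1))" for t
    unfolding k_def of_real_sum complex_norm_square by (simp add: cis_cnj)
  then have "ap (\<lambda>t. complex_of_real (k t))"
    by (simp only:) (intro ap_sum ap_mult ap_diff ap_wave ap_const)
  moreover have "k t \<in> {0..4 * real (card \<Lambda>)}" for t
  proof -
    have "(cmod (cis (t \<bullet> \<mu>) - 1))\<^sup>2 \<le> 2\<^sup>2" for \<mu>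
      by (intro power_mono) (use norm_triangle_ineq4[of "cis (t \<bullet> \<mu>)" 1] in auto)
    then have "k t \<le> (\<Sum>\<mu>\<in>\<Lambda>. 4)" unfolding k_def by (intro sum_mono) simp
    moreover have "0 \<le> k t" unfolding k_def by (intro sum_nonneg) simp
    ultimately show ?thesis by simp
  qed
  ultimately have W: "ap (\<lambda>t. complex_of_real (W t))"
    unfolding W_def by (rule ap_continuous_compose) (intro continuous_intros)
  have small: "cmod (cis (t \<bullet> \<mu>) - 1) < \<delta>" if "W t > 0" "\<mu> \<in> \<Lambda>" for t \<mu>
  proof -
    have "(cmod (cis (t \<bullet> \<mu>) - 1))\<^sup>2 \<le> k t"
      unfolding k_def by (rule member_le_sum[OF that(2)]) (use assms in auto)
    also have "\<dots> < \<delta>\<^sup>2" using that(1) by (simp add: W_def)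
    finally show ?thesis using assms(2) by (simp add: power2_less_imp_less)
  qed
  \<comment> \<open>With this choice \<open>(card \<Lambda> + 1) * \<eta>\<^sup>2\<close> equals
    \<open>\<delta>\<^sup>2 / 2\<close>, so at every point one of the translates of \<open>W\<close>
    is at least \<open>\<delta>\<^sup>2 / 2\<close>. The summand 1 covers an empty
    \<open>\<Lambda>\<close>.\<close>
  define \<eta> where "\<eta> = \<delta> / sqrt (2 * (real (card \<Lambda>) + 1))"
  have \<eta>: "\<eta> > 0" using assms(2) by (simp add: \<eta>_def)
  obtain T where T: "finite T" "T \<noteq> {}"
    "\<And>x. \<exists>i\<in>T. \<forall>\<mu>\<in>\<Lambda>. cmod (cis ((x - i) \<bullet> \<mu>) - 1) < \<eta>"
    using bohr_sets_totally_bounded[OF assms(1) \<eta>] by blast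
  have "\<delta>\<^sup>2 / 2 \<le> (\<Sum>i\<in>T. W (x - i))" for x
  proof -
    obtain i where i: "i \<in> T" "\<And>\<mu>. \<mu> \<in> \<Lambda> \<Longrightarrow> cmod (cis ((x - i) \<bullet> \<mu>) - 1) < \<eta>"
      using T(3) by blast
    have "k (x - i) \<le> (\<Sum>\<mu>\<in>\<Lambda>. \<eta>\<^sup>2)"
      unfolding k_def by (intro sum_mono power_mono less_imp_le[OF i(2)]) auto
    also have "\<dots> \<le> (real (card \<Lambda>) + 1) * \<eta>\<^sup>2" by (simp add: distrib_right)
    also have "\<dots> = \<delta>\<^sup>2 / 2" by (simp add: \<eta>_def power_divide field_simps)
    finally have "\<delta>\<^sup>2 / 2 \<le> \<delta>\<^sup>2 - k (x - i)" by simp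
    also have "\<dots> \<le> W (x - i)" by (simp add: W_def)
    also have "\<dots> \<le> (\<Sum>i\<in>T. W (x - i))"
      by (rule member_le_sum[OF i(1)]) (use T in \<open>auto simp: W_def\<close>)
    finally show ?thesis .
  qed
  then show thesis
    using that[of W T "\<delta>\<^sup>2 / 2"] W small T assms(2) by (simp add: W_def)
qed

text \<open>All translates of \<open>W\<close> have the same mean, while their sum is at least
  \<open>c\<close> everywhere.\<close>

lemma kernel_mean_pos:
  fixes W :: "real ^ 'n \<Rightarrow> real"
  assumes "ap (\<lambda>t. complex_of_real (W t))" "finite T" "c > 0" "\<And>x. (\<Sum>i\<in>T. W (x - i)) \<ge> c"
  shows "Re (mean (\<lambda>t. complex_of_real (W t))) > 0"
proof -
  have tr: "ap (\<lambda>x. complex_of_real (W (x - i)))" for i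
    using ap_translate[OF assms(1), of "- i"] by simp
  have "cmod (mean (\<lambda>x::real^'n. complex_of_real c)) \<le> Re (mean (\<lambda>x. complex_of_real (\<Sum>i\<in>T. W (x - i))))"
    by (rule mean_le) (use assms in \<open>auto intro!: ap_const ap_sum tr\<close>)
  also have "mean (\<lambda>x. complex_of_real (\<Sum>i\<in>T. W (x - i))) = (\<Sum>i\<in>T. mean (\<lambda>x. complex_of_real (W (x
      - i))))"
    by (simp add: mean_sum tr)
  also have "\<dots> = of_nat (card T) * mean (\<lambda>t. complex_of_real (W t))"
    using mean_translate[OF assms(1), of "- i" for i] by simp
  finally have "c \<le> real (card T) * Re (mean (\<lambda>t. complex_of_real (W t)))"
    using assms(3) by simp
  then have "0 < real (card T) * Re (mean (\<lambda>t. complex_of_real (W t)))" using assms(3) by linarith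
  then show ?thesis by (simp add: zero_less_mult_iff)
qed

text \<open>The translates \<open>W (x - i)\<close>, divided by their sum \<open>D\<close>, form an
  almost periodic partition of unity. Where the member with index \<open>i\<close> is nonzero,
  \<open>x - i\<close> lies in the Bohr neighbourhood, so \<open>f x\<close> is close to the
  constant \<open>f i\<close>. Only finitely many values of \<open>f\<close> enter the approximant,
  so nothing about means of \<open>f\<close> has to be known.\<close>

lemma bohr_continuous_imp_ap:
  fixes f :: "real ^ 'n \<Rightarrow> complex"
  assumes "\<And>\<epsilon>. \<epsilon> > 0 \<Longrightarrow> \<exists>\<Lambda> \<delta>. finite \<Lambda> \<and> \<delta> > 0 \<and>
    (\<forall>t. (\<forall>\<mu>\<in>\<Lambda>. cmod (cis (t \<bullet> \<mu>) - 1) < \<delta>) \<longrightarrow> (\<forall>x. cmod (f (x + t) - f x) \<le> \<epsilon>))"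
  shows "ap f"
proof (rule ap_uniform_limit)
  fix \<epsilon> :: real assume \<epsilon>: "\<epsilon> > 0"
  from assms[OF \<epsilon>] obtain \<Lambda> \<delta> where *: "finite \<Lambda> \<and> \<delta> > 0 \<and>
    (\<forall>t. (\<forall>\<mu>\<in>\<Lambda>. cmod (cis (t \<bullet> \<mu>) - 1) < \<delta>) \<longrightarrow> (\<forall>x. cmod (f (x + t) - f x) \<le> \<epsilon>))"
    by (elim exE) (rule that)
  then have \<Lambda>: "finite \<Lambda>" "\<delta> > 0"
    "\<And>t x. (\<And>\<mu>. \<mu> \<in> \<Lambda> \<Longrightarrow> cmod (cis (t \<bullet> \<mu>) - 1) < \<delta>) \<Longrightarrow> cmod (f (x + t) - f x) \<le> \<epsilon>"
    by simp_all
  obtain W :: "real ^ 'n \<Rightarrow> real" and T c where W: "ap (\<lambda>t. complex_of_real (W t))" "\<And>t. W t \<ge> 0"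
    "\<And>t \<mu>. W t > 0 \<Longrightarrow> \<mu> \<in> \<Lambda> \<Longrightarrow> cmod (cis (t \<bullet> \<mu>) - 1) < \<delta>"
    "finite T" "c > 0" "\<And>x. (\<Sum>i\<in>T. W (x - i)) \<ge> c"
    by (rule bohr_kernel[OF \<Lambda>(1,2)]) (rule that)
  define D where "D = (\<lambda>x. \<Sum>i\<in>T. W (x - i))"
  have tr: "ap (\<lambda>x. complex_of_real (W (x - i)))" for i
    using ap_translate[OF W(1), of "- i"] by simp
  have D: "ap (\<lambda>x. complex_of_real (D x))" unfolding D_def of_real_sum by (intro ap_sum tr)
  obtain B where B: "\<And>x. cmod (complex_of_real (D x)) \<le> B" using ap_bounded[OF D] by blast
  have Dc: "c \<le> D x" for x using W(6) by (simp add: D_def)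
  have DB: "D x \<in> {c..B}" for x using B[of x] Dc[of x] by simp
  have invD: "ap (\<lambda>x. complex_of_real (inverse (D x)))"
    by (rule ap_continuous_compose[OF D DB]) (use W(5) in \<open>auto intro!: continuous_intros\<close>)
  define g where "g = (\<lambda>x. \<Sum>i\<in>T. f i * (complex_of_real (W (x - i)) * complex_of_real (inverse (D x))))"
  have "ap g" unfolding g_def by (intro ap_sum ap_cmult ap_mult tr invD)
  moreover have "cmod (f x - g x) \<le> \<epsilon>" for x
  proof -
    have D0: "D x > 0" using Dc[of x] W(5) by linarith
    have "(\<Sum>i\<in>T. complex_of_real (W (x - i)) * complex_of_real (inverse (D x))) = complex_of_real
        (D x * inverse (D x))"
      unfolding D_def by (simp add: sum_distrib_right)
    also have "\<dots> = 1" using D0 by simp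
    finally have "f x - g x = f x * (\<Sum>i\<in>T. complex_of_real (W (x - i)) * complex_of_real (inverse
        (D x))) - g x"
      by simp
    also have "\<dots> = (\<Sum>i\<in>T. (f x - f i) * (complex_of_real (W (x - i) * inverse (D x))))"
      unfolding g_def sum_distrib_left sum_subtractf[symmetric] by (rule sum.cong) (auto simp:
          algebra_simps)
    also have "cmod \<dots> \<le> (\<Sum>i\<in>T. \<epsilon> * (W (x - i) * inverse (D x)))"
    proof (rule order_trans[OF norm_sum], rule sum_mono)
      fix i assume "i \<in> T"
      have nn: "0 \<le> W (x - i) * inverse (D x)" using W(2)[of "x - i"] D0 by simp
      have "cmod (f x - f i) * (W (x - i) * inverse (D x)) \<le> \<epsilon> * (W (x - i) * inverse (D x))"
      proof (cases "W (x - i) = 0")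
        case False
        then have "W (x - i) > 0" using W(2)[of "x - i"] by simp
        then have "cmod (f (i + (x - i)) - f i) \<le> \<epsilon>" using W(3) by (intro \<Lambda>(3)) blast
        then show ?thesis using nn by (intro mult_right_mono) auto
      qed simp
      then show "cmod ((f x - f i) * (complex_of_real (W (x - i) * inverse (D x)))) \<le> \<epsilon> * (W (x -
          i) * inverse (D x))"
        using nn by (simp only: norm_mult norm_of_real abs_of_nonneg)
    qed
    also have "\<dots> = \<epsilon> * (D x * inverse (D x))"
      unfolding D_def by (simp add: sum_distrib_left sum_distrib_right)
    also have "\<dots> = \<epsilon>" using D0 by simp
    finally show ?thesis .
  qed
  ultimately show "\<exists>g. ap g \<and> (\<forall>x. cmod (f x - g x) \<le> \<epsilon>)" by blast
qed

section \<open>Almost periods of mappings on a tube\<close>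

lemma cplx_plus_rvec: "cplx x y + rvec t = cplx (x + t) y"
  by (simp add: cplx_def rvec_def vec_eq_iff complex_eq_iff)

lemma cplx_eq_iff: "cplx x y = cplx x' y' \<longleftrightarrow> x = x' \<and> y = y'"
  by (auto simp: cplx_def vec_eq_iff)

lemma cplx_in_tube [simp]: "cplx x y \<in> tube \<Omega> \<longleftrightarrow> y \<in> \<Omega>"
  unfolding tube_def by (auto simp: cplx_eq_iff)

lemma tubeE:
  assumes "z \<in> tube \<Omega>"
  obtains x y where "z = cplx x y" "y \<in> \<Omega>"
  using assms unfolding tube_def by blast

lemma herm_cplx: "herm (cplx x y) (rvec \<mu>) = Complex (x \<bullet> \<mu>) (y \<bullet> \<mu>)"
  by (simp add: herm_def cplx_def rvec_def inner_vec_def complex_eq_iff Re_sum Im_sum)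

lemma exp_herm: "exp (\<i> * herm (cplx x y) (rvec \<mu>)) = complex_of_real (exp (- (y \<bullet> \<mu>))) * cis (x \<bullet> \<mu>)"
  unfolding herm_cplx by (simp add: exp_eq_polar)

lemma exp_neg_herm: "exp (- (\<i> * herm (cplx x y) (rvec \<mu>))) = complex_of_real (exp (y \<bullet> \<mu>)) * cis
    (x \<bullet> (- \<mu>))"
  unfolding herm_cplx by (simp add: exp_eq_polar)

lemma unif_distD:
  fixes F G :: "complex ^ 'n \<Rightarrow> complex ^ 'm"
  assumes "unif_dist S F G < ennreal \<epsilon>" "z \<in> S"
  shows "cmod (F z $ l - G z $ l) < \<epsilon>"
proof -
  let ?M = "MAX l\<in>UNIV. cmod (F z $ l - G z $ l)"
  have le: "cmod (F z $ l - G z $ l) \<le> ?M" by (rule Max_ge) auto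
  then have "0 \<le> ?M" using norm_ge_zero order_trans by blast
  have "ennreal ?M \<le> unif_dist S F G" unfolding unif_dist_def by (rule SUP_upper[OF assms(2)])
  then have "ennreal ?M < ennreal \<epsilon>" using assms(1) by (rule le_less_trans)
  then have "?M < \<epsilon>" using \<open>0 \<le> ?M\<close> by (simp add: ennreal_less_iff)
  then show ?thesis using le by linarith
qed

lemma unif_dist_le:
  fixes F G :: "complex ^ 'n \<Rightarrow> complex ^ 'm"
  assumes "\<And>z l. z \<in> S \<Longrightarrow> cmod (F z $ l - G z $ l) \<le> \<epsilon>"
  shows "unif_dist S F G \<le> ennreal \<epsilon>"
  unfolding unif_dist_def
proof (rule SUP_least, rule ennreal_leI)
  fix z assume "z \<in> S"
  then show "(MAX l\<in>UNIV. cmod (F z $ l - G z $ l)) \<le> \<epsilon>"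
    using assms by (subst Max_le_iff) auto
qed

lemma unif_dist_less:
  fixes F G :: "complex ^ 'n \<Rightarrow> complex ^ 'm"
  assumes "\<And>z l. z \<in> S \<Longrightarrow> cmod (F z $ l - G z $ l) \<le> \<epsilon>" "\<epsilon> < \<epsilon>'" "0 \<le> \<epsilon>"
  shows "unif_dist S F G < ennreal \<epsilon>'"
proof -
  have "unif_dist S F G \<le> ennreal \<epsilon>" by (rule unif_dist_le[OF assms(1)])
  also have "\<dots> < ennreal \<epsilon>'" using assms(2,3) by (simp add: ennreal_less_iff)
  finally show ?thesis .
qed

lemma compact_imp_rel_compact: "compact K \<Longrightarrow> K \<subseteq> \<Omega> \<Longrightarrow> rel_compact_in K (\<Omega> :: (real ^ 'n) set)"
  unfolding rel_compact_in_def by (simp add: closure_closed compact_imp_closed)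

definition period :: "(complex ^ 'n \<Rightarrow> complex ^ 'm) \<Rightarrow> (real ^ 'n) set \<Rightarrow> real \<Rightarrow> real ^ 'n \<Rightarrow> bool" where
  "period F K \<epsilon> t \<longleftrightarrow> (\<forall>x. \<forall>y\<in>K. \<forall>l. cmod (F (cplx (x + t) y) $ l - F (cplx x y) $ l) < \<epsilon>)"

lemma periodD: "period F K \<epsilon> t \<Longrightarrow> y \<in> K \<Longrightarrow> cmod (F (cplx (x + t) y) $ l - F (cplx x y) $ l) < \<epsilon>"
  unfolding period_def by blast

lemma period_add:
  assumes "period F K \<epsilon> t" "period F K \<epsilon>' t'"
  shows "period F K (\<epsilon> + \<epsilon>') (t + t')"
  unfolding period_def
proof (intro allI ballI)
  fix x y l assume y: "y \<in> K"
  show "cmod (F (cplx (x + (t + t')) y) $ l - F (cplx x y) $ l) < \<epsilon> + \<epsilon>'"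
    using periodD[OF assms(1) y, of "x + t'" l] periodD[OF assms(2) y, of x l]
      norm_triangle_ineq[of "F (cplx (x + t' + t) y) $ l - F (cplx (x + t') y) $ l"
        "F (cplx (x + t') y) $ l - F (cplx x y) $ l"]
    by (simp add: add_ac)
qed

lemma period_uminus:
  assumes "period F K \<epsilon> t"
  shows "period F K \<epsilon> (- t)"
  unfolding period_def
proof (intro allI ballI)
  fix x y l assume y: "y \<in> K"
  show "cmod (F (cplx (x + - t) y) $ l - F (cplx x y) $ l) < \<epsilon>"
    using periodD[OF assms y, of "x + - t" l] by (simp add: norm_minus_commute)
qed

lemma HAP_periods:
  assumes "F \<in> HAP \<Omega>" "compact K" "K \<subseteq> \<Omega>" "\<epsilon> > 0"
  obtains L where "L > 0" "\<And>\<xi>. \<exists>\<tau>. period F K \<epsilon> \<tau> \<and> (\<forall>j. \<bar>\<tau> $ j - \<xi> $ j\<bar> < L)"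
proof -
  have "almost_periodic \<Omega> F" using assms(1) by (simp add: HAP_def)
  then obtain t where t: "\<And>l. 0 < t $ l"
    "\<And>\<xi>. \<exists>\<tau>. (\<forall>l. \<bar>\<tau> $ l - \<xi> $ l\<bar> < t $ l) \<and> unif_dist (tube K) (\<lambda>z. F (z + rvec \<tau>)) F < ennreal \<epsilon>"
    unfolding almost_periodic_def using compact_imp_rel_compact[OF assms(2,3)] assms(4) by metis
  let ?L = "Max (range (\<lambda>l. t $ l))"
  have L: "t $ l \<le> ?L" for l by (rule Max_ge) auto
  show thesis
  proof (rule that)
    show "?L > 0" using t(1) L less_le_trans by blast
    fix \<xi>
    obtain \<tau> where \<tau>: "\<forall>l. \<bar>\<tau> $ l - \<xi> $ l\<bar> < t $ l" "unif_dist (tube K) (\<lambda>z. F (z + rvec \<tau>)) F <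
        ennreal \<epsilon>"
      using t(2) by blast
    have "period F K \<epsilon> \<tau>" unfolding period_def
    proof (intro allI ballI)
      fix x y l assume "y \<in> K"
      then have "cplx x y \<in> tube K" by simp
      from unif_distD[OF \<tau>(2) this] show "cmod (F (cplx (x + \<tau>) y) $ l - F (cplx x y) $ l) < \<epsilon>"
        by (simp add: cplx_plus_rvec)
    qed
    then show "\<exists>\<tau>. period F K \<epsilon> \<tau> \<and> (\<forall>j. \<bar>\<tau> $ j - \<xi> $ j\<bar> < ?L)"
      using \<tau>(1) L less_le_trans by blast
  qed
qed

lemma HAP_continuous:
  assumes "F \<in> HAP \<Omega>"
  shows "continuous_on (tube \<Omega>) F"
proof -
  have "\<forall>z\<in>tube \<Omega>. isCont F z"
    using assms unfolding HAP_def holomorphic_map_def by (auto dest: has_derivative_continuous)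
  then show ?thesis by (simp add: continuous_at_imp_continuous_on)
qed

lemma continuous_cplx: "continuous_on S (\<lambda>p. cplx (fst p) (snd p))"
  unfolding cplx_def Complex_eq
  by (intro continuous_on_vec_lambda continuous_intros)

lemma compact_tube_part:
  fixes K :: "(real ^ 'n) set"
  assumes "compact K"
  shows "compact {cplx x y | x y. x \<in> cbox a b \<and> y \<in> K}"
proof -
  have "{cplx x y | x y. x \<in> cbox a b \<and> y \<in> K} = (\<lambda>p. cplx (fst p) (snd p)) ` (cbox a b \<times> K)"
    by force
  moreover have "compact ((\<lambda>p. cplx (fst p) (snd p)) ` (cbox a b \<times> K))"
    by (intro compact_continuous_image continuous_cplx compact_Times compact_cbox assms)
  ultimately show ?thesis by simp
qed

text \<open>An almost period carries every \<open>x\<close> into one fixed cube at the cost of an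
  error 1, and over that cube \<open>F\<close> is bounded by compactness.\<close>

lemma HAP_bounded:
  fixes F :: "complex ^ 'n \<Rightarrow> complex ^ 'm"
  assumes F: "F \<in> HAP \<Omega>" and K: "compact K" "K \<subseteq> \<Omega>"
  obtains B where "B > 0" "\<And>x y l. y \<in> K \<Longrightarrow> cmod (F (cplx x y) $ l) \<le> B"
proof -
  obtain L where L: "L > 0" "\<And>\<xi>. \<exists>\<tau>. period F K 1 \<tau> \<and> (\<forall>j. \<bar>\<tau> $ j - \<xi> $ j\<bar> < L)"
    by (rule HAP_periods[OF F K, of 1]) (simp, rule that)
  define C where "C = {cplx x y | x y. x \<in> cbox (\<chi> j. - L) (\<chi> j. L) \<and> y \<in> K}"
  have "C \<subseteq> tube \<Omega>" using K by (auto simp: C_def)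
  then have "continuous_on C F" by (rule continuous_on_subset[OF HAP_continuous[OF F]])
  then have "compact (F ` C)"
    by (rule compact_continuous_image) (simp add: C_def compact_tube_part K)
  then have "bounded (F ` C)" by (rule compact_imp_bounded)
  then obtain B where B: "B > 0" "\<forall>w\<in>F ` C. norm w \<le> B"
    unfolding bounded_pos by (elim exE conjE) (rule that)
  show thesis
  proof (rule that)
    show "B + 1 > 0" using B by simp
    fix x y l assume y: "y \<in> K"
    obtain \<tau> where \<tau>: "period F K 1 \<tau>" "\<forall>j. \<bar>\<tau> $ j - (- x) $ j\<bar> < L" using L(2) by blast
    have "\<bar>(x + \<tau>) $ j\<bar> < L" for j using \<tau>(2)[rule_format, of j] by (simp add: add.commute)
    then have "- L \<le> (x + \<tau>) $ j \<and> (x + \<tau>) $ j \<le> L" for j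
      using abs_less_iff[of "(x + \<tau>) $ j" L] by (metis less_imp_le minus_le_iff)
    then have "x + \<tau> \<in> cbox (\<chi> j. - L) (\<chi> j. L)" by (simp only: mem_box_cart vec_lambda_beta) blast
    then have "cplx (x + \<tau>) y \<in> C" using y unfolding C_def by blast
    then have "norm (F (cplx (x + \<tau>) y)) \<le> B" using B(2) by blast
    then have "cmod (F (cplx (x + \<tau>) y) $ l) \<le> B"
      using Finite_Cartesian_Product.norm_nth_le[of "F (cplx (x + \<tau>) y)" l] by linarith
    then show "cmod (F (cplx x y) $ l) \<le> B + 1"
      using periodD[OF \<tau>(1) y, of x l]
        norm_triangle_ineq2[of "F (cplx x y) $ l" "F (cplx (x + \<tau>) y) $ l"]
      by (simp add: norm_minus_commute)
  qed
qed

lemma norm_cplx_diff: "norm (cplx (x + v) y - cplx x y) = norm v"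
  by (simp add: cplx_def norm_vec_def L2_set_def cmod_def)

text \<open>An almost period carries \<open>x\<close> and \<open>x + v\<close> over one compact
  cube, where uniform continuity compares them. The cube is enlarged by 1 to make room for
  \<open>v\<close>.\<close>

lemma HAP_small_periods:
  fixes F :: "complex ^ 'n \<Rightarrow> complex ^ 'm"
  assumes F: "F \<in> HAP \<Omega>" and K: "compact K" "K \<subseteq> \<Omega>" and e: "\<epsilon> > 0"
  obtains r where "r > 0" "\<And>v. norm v < r \<Longrightarrow> period F K \<epsilon> v"
proof -
  obtain L where L: "L > 0" "\<And>\<xi>. \<exists>\<tau>. period F K (\<epsilon>/3) \<tau> \<and> (\<forall>j. \<bar>\<tau> $ j - \<xi> $ j\<bar> < L)"
    by (rule HAP_periods[OF F K, of "\<epsilon>/3"]) (use e in simp, rule that)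
  define C where "C = {cplx x y | x y. x \<in> cbox (\<chi> j. - (L + 1)) (\<chi> j. L + 1) \<and> y \<in> K}"
  have "C \<subseteq> tube \<Omega>" using K by (auto simp: C_def)
  then have "continuous_on C F" by (rule continuous_on_subset[OF HAP_continuous[OF F]])
  then have "uniformly_continuous_on C F"
    by (rule compact_uniformly_continuous) (simp add: C_def compact_tube_part K)
  note uc = this[unfolded uniformly_continuous_on_def]
  have "\<exists>d>0. \<forall>z\<in>C. \<forall>z'\<in>C. dist z' z < d \<longrightarrow> dist (F z') (F z) < \<epsilon>/3"
    by (rule mp[OF spec[OF uc, of "\<epsilon>/3"]]) (use e in simp)
  then obtain d where d: "d > 0" "\<And>z z'. z \<in> C \<Longrightarrow> z' \<in> C \<Longrightarrow> dist z' z < d \<Longrightarrow> dist (F z') (F z) < \<epsilon>/3"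
    by blast
  show thesis
  proof (rule that)
    show "min d 1 > 0" using d by simp
    fix v :: "real^'n" assume v: "norm v < min d 1"
    show "period F K \<epsilon> v" unfolding period_def
    proof (intro allI ballI)
      fix x y l assume y: "y \<in> K"
      obtain \<tau> where \<tau>: "period F K (\<epsilon>/3) \<tau>" "\<forall>j. \<bar>\<tau> $ j - (- x) $ j\<bar> < L" using L(2) by blast
      have 1: "\<bar>(x + \<tau>) $ j\<bar> < L" for j using \<tau>(2)[rule_format, of j] by (simp add: add.commute)
      have 2: "\<bar>(x + \<tau> + v) $ j\<bar> < L + 1" for j
      proof -
        have "norm v < 1" using v by simp
        moreover have "(x + \<tau> + v) $ j = (x + \<tau>) $ j + v $ j" by simp
        ultimately show ?thesis using 1[of j] component_le_norm_cart[of v j] by linarith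
      qed
      have "x + \<tau> \<in> cbox (\<chi> j. - (L + 1)) (\<chi> j. L + 1)" "x + \<tau> + v \<in> cbox (\<chi> j. - (L + 1)) (\<chi> j. L + 1)"
      proof -
        have "- (L + 1) \<le> (x + \<tau>) $ j \<and> (x + \<tau>) $ j \<le> L + 1" for j using 1[of j] by linarith
        then show "x + \<tau> \<in> cbox (\<chi> j. - (L + 1)) (\<chi> j. L + 1)" by (simp only: mem_box_cart
            vec_lambda_beta) blast
        have "- (L + 1) \<le> (x + \<tau> + v) $ j \<and> (x + \<tau> + v) $ j \<le> L + 1" for j using 2[of j] by linarith
        then show "x + \<tau> + v \<in> cbox (\<chi> j. - (L + 1)) (\<chi> j. L + 1)" by (simp only: mem_box_cart
            vec_lambda_beta) blast
      qed
      then have "cplx (x + \<tau>) y \<in> C" "cplx (x + \<tau> + v) y \<in> C" using y unfolding C_def by blast+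
      moreover have "dist (cplx (x + \<tau> + v) y) (cplx (x + \<tau>) y) < d"
        using v by (simp add: dist_norm norm_cplx_diff)
      ultimately have "dist (F (cplx (x + \<tau> + v) y)) (F (cplx (x + \<tau>) y)) < \<epsilon>/3" by (rule d(2))
      then have 3: "cmod (F (cplx (x + \<tau> + v) y) $ l - F (cplx (x + \<tau>) y) $ l) < \<epsilon>/3"
        using dist_vec_nth_le[of "F (cplx (x + \<tau> + v) y)" l "F (cplx (x + \<tau>) y)"] by (simp add:
            dist_norm)
      have 4: "cmod (F (cplx (x + v) y) $ l - F (cplx (x + \<tau> + v) y) $ l) < \<epsilon>/3"
        using periodD[OF \<tau>(1) y, of "x + v" l] by (simp add: norm_minus_commute add_ac)
      have 5: "cmod (F (cplx (x + \<tau>) y) $ l - F (cplx x y) $ l) < \<epsilon>/3"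
        using periodD[OF \<tau>(1) y, of x l] .
      show "cmod (F (cplx (x + v) y) $ l - F (cplx x y) $ l) < \<epsilon>"
        using norm_diff_triangle_less[OF norm_diff_triangle_less[OF 4 3] 5] by simp
    qed
  qed
qed

text \<open>For finite \<open>\<Lambda>\<close> and positive \<open>\<delta>\<close> these are the
  basic neighbourhoods of the origin in the Bohr topology.\<close>

definition bohr :: "(real ^ 'n) set \<Rightarrow> real \<Rightarrow> real ^ 'n \<Rightarrow> bool" where
  "bohr \<Lambda> \<delta> t \<longleftrightarrow> (\<forall>\<mu>\<in>\<Lambda>. cmod (cis (t \<bullet> \<mu>) - 1) < \<delta>)"

text \<open>Five tolerances \<open>\<epsilon>/5\<close> add up: four for the almost periods
  \<open>a\<close>, \<open>b\<close>, \<open>c\<close>, \<open>d\<close> supplied by Bogolyubov's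
  theorem, and one for the remaining vector, which is an almost period because it is short.\<close>

lemma HAP_bohr:
  fixes F :: "complex ^ 'n \<Rightarrow> complex ^ 'm"
  assumes F: "F \<in> HAP \<Omega>" and K: "compact K" "K \<subseteq> \<Omega>" and e: "\<epsilon> > 0"
  obtains \<Lambda> \<delta> where "finite \<Lambda>" "\<delta> > 0" "\<And>t. bohr \<Lambda> \<delta> t \<Longrightarrow> period F K \<epsilon> t"
proof -
  define U where "U = {t. period F K (\<epsilon>/5) t}"
  obtain L where L: "L > 0" "\<And>\<xi>. \<exists>\<tau>. period F K (\<epsilon>/5) \<tau> \<and> (\<forall>j. \<bar>\<tau> $ j - \<xi> $ j\<bar> < L)"
    by (rule HAP_periods[OF F K, of "\<epsilon>/5"]) (use e in simp, rule that)
  have U: "\<exists>\<tau>\<in>U. \<forall>j. \<bar>\<tau> $ j - \<xi> $ j\<bar> < L" for \<xi> using L(2)[of \<xi>] by (auto simp: U_def)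
  obtain r where r: "r > 0" "\<And>v. norm v < r \<Longrightarrow> period F K (\<epsilon>/5) v"
    by (rule HAP_small_periods[OF F K, of "\<epsilon>/5"]) (use e in simp, rule that)
  show thesis
  proof (rule bogolyubov[OF U r(1)])
    fix \<Lambda> \<delta>
    assume \<Lambda>: "finite \<Lambda>" "\<delta> > 0" "\<And>s. (\<And>\<mu>. \<mu> \<in> \<Lambda> \<Longrightarrow> cmod (cis (s \<bullet> \<mu>) - 1) < \<delta>) \<Longrightarrow>
      \<exists>a\<in>U. \<exists>b\<in>U. \<exists>c\<in>U. \<exists>d\<in>U. norm (s - (a - b + c - d)) < r"
    show thesis
    proof (rule that[OF \<Lambda>(1,2)])
      fix t assume "bohr \<Lambda> \<delta> t"
      then have "\<exists>a\<in>U. \<exists>b\<in>U. \<exists>c\<in>U. \<exists>d\<in>U. norm (t - (a - b + c - d)) < r"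
        by (intro \<Lambda>(3)) (simp add: bohr_def)
      then obtain a b c d where abcd: "a \<in> U" "b \<in> U" "c \<in> U" "d \<in> U"
        "norm (t - (a - b + c - d)) < r" by blast
      have U': "period F K (\<epsilon>/5) a" "period F K (\<epsilon>/5) b" "period F K (\<epsilon>/5) c" "period F K (\<epsilon>/5) d"
        using abcd(1-4) by (simp_all only: U_def mem_Collect_eq)
      have "period F K (\<epsilon>/5 + (\<epsilon>/5 + (\<epsilon>/5 + (\<epsilon>/5 + \<epsilon>/5)))) ((t - (a - b + c - d)) + (a + (- b + (c
          + - d))))"
        by (intro period_add period_uminus r(2)[OF abcd(5)] U')
      then show "period F K \<epsilon> t" by simp
    qed
  qed
qed

lemma HAP_slice_ap:
  fixes F :: "complex ^ 'n \<Rightarrow> complex ^ 'm"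
  assumes F: "F \<in> HAP \<Omega>" and y: "y \<in> \<Omega>"
  shows "ap (\<lambda>x. F (cplx x y) $ l)"
proof (rule bohr_continuous_imp_ap)
  fix \<epsilon> :: real assume e: "\<epsilon> > 0"
  obtain \<Lambda> \<delta> where \<Lambda>: "finite \<Lambda>" "\<delta> > 0" "\<And>t. bohr \<Lambda> \<delta> t \<Longrightarrow> period F {y} \<epsilon> t"
    by (rule HAP_bohr[OF F, of "{y}", OF _ _ e]) (use y in simp, use y in simp, rule that)
  have "\<forall>t. (\<forall>\<mu>\<in>\<Lambda>. cmod (cis (t \<bullet> \<mu>) - 1) < \<delta>) \<longrightarrow>
      (\<forall>x. cmod (F (cplx (x + t) y) $ l - F (cplx x y) $ l) \<le> \<epsilon>)"
  proof (intro allI impI)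
    fix t x assume "\<forall>\<mu>\<in>\<Lambda>. cmod (cis (t \<bullet> \<mu>) - 1) < \<delta>"
    then have "period F {y} \<epsilon> t" by (intro \<Lambda>(3)) (simp add: bohr_def)
    then show "cmod (F (cplx (x + t) y) $ l - F (cplx x y) $ l) \<le> \<epsilon>"
      using periodD[of F "{y}" \<epsilon> t y x l] by simp
  qed
  then show "\<exists>\<Lambda> \<delta>. finite \<Lambda> \<and> \<delta> > 0 \<and> (\<forall>t. (\<forall>\<mu>\<in>\<Lambda>. cmod (cis (t \<bullet> \<mu>) - 1) < \<delta>) \<longrightarrow>
      (\<forall>x. cmod (F (cplx (x + t) y) $ l - F (cplx x y) $ l) \<le> \<epsilon>))"
    using \<Lambda>(1,2) by (intro exI[of _ \<Lambda>] exI[of _ \<delta>] conjI)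
qed

section \<open>Fourier coefficients\<close>

text \<open>A complex linear derivative restricts to an ordinary complex derivative on each complex
  line. Cauchy's estimates in one variable become available in this way.\<close>

lemma has_field_derivative_along_line:
  fixes F :: "complex ^ 'n \<Rightarrow> complex ^ 'm"
  assumes "(F has_derivative L) (at (a + w *s v))" "\<And>c u. L (c *s u) = c *s L u"
  shows "((\<lambda>w. F (a + w *s v) $ l) has_field_derivative (L v $ l)) (at w)"
proof -
  have "bounded_linear (\<lambda>w. w *s v)"
    by (rule linear_conv_bounded_linear[THEN iffD1])
      (auto intro!: linearI simp: vec_eq_iff algebra_simps)
  then have "((\<lambda>w. w *s v) has_derivative (\<lambda>w. w *s v)) (at w)"
    by (rule bounded_linear_imp_has_derivative)
  then have "((\<lambda>w. a + w *s v) has_derivative (\<lambda>w. w *s v)) (at w)"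
    using has_derivative_add[OF has_derivative_const] by fastforce
  then have "((\<lambda>w. F (a + w *s v)) has_derivative (\<lambda>w. L (w *s v))) (at w)"
    using assms(1) by (rule has_derivative_compose)
  then have "((\<lambda>w. F (a + w *s v) $ l) has_derivative (\<lambda>w. L (w *s v) $ l)) (at w)"
    by (rule bounded_linear.has_derivative[OF bounded_linear_vec_nth])
  moreover have "(\<lambda>w. L (w *s v) $ l) = (*) (L v $ l)" by (auto simp: assms(2) mult.commute)
  ultimately show ?thesis by (simp only: has_field_derivative_def)
qed

lemma herm_add_scale: "herm (a + w *s v) c = herm a c + w * herm v c"
  by (simp add: herm_def sum.distrib sum_distrib_left algebra_simps)

text \<open>This is Taylor's formula with Cauchy's estimate for the second derivative on discs of
  radius \<open>\<rho> / 4\<close>; the constant 32 is 2! times the square of 4. The quarter keeps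
  all these discs inside the ball where \<open>f\<close> is bounded.\<close>

lemma second_order_remainder:
  assumes hol: "f holomorphic_on ball z \<rho>" and B: "\<And>u. u \<in> ball z \<rho> \<Longrightarrow> cmod (f u) \<le> B"
    and \<rho>: "\<rho> > 0" and w: "cmod w \<le> \<rho> / 4"
  shows "cmod (f (z + w) - f z - deriv f z * w) \<le> 32 * B / \<rho>\<^sup>2 * (cmod w)\<^sup>2"
proof -
  let ?S = "cball z (\<rho> / 4)"
  let ?f = "\<lambda>i. (deriv ^^ i) f"
  have "cmod (?f 0 (z + w) - (\<Sum>i\<le>1. ?f i z * (z + w - z) ^ i / fact i)) \<le>
      (32 * B / \<rho>\<^sup>2) * cmod (z + w - z) ^ Suc 1 / fact 1"
  proof (rule complex_Taylor)
    show "convex ?S" by simp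
    show "z \<in> ?S" "z + w \<in> ?S" using \<rho> w by (auto simp: dist_norm)
    fix x assume x: "x \<in> ?S"
    have sub: "cball x (\<rho> / 4) \<subseteq> ball z \<rho>"
    proof
      fix u assume "u \<in> cball x (\<rho> / 4)"
      then show "u \<in> ball z \<rho>" using x dist_triangle[of z u x] \<rho> by (simp add: dist_commute)
    qed
    show "(?f i has_field_derivative ?f (Suc i) x) (at x within ?S)" for i
    proof -
      have "?f i holomorphic_on ball z \<rho>" by (rule holomorphic_higher_deriv[OF hol]) simp
      moreover have "x \<in> cball x (\<rho> / 4)" using \<rho> by simp
      then have "x \<in> ball z \<rho>" using sub by blast
      ultimately show ?thesis
        by (simp add: holomorphic_derivI[of _ "ball z \<rho>"])
    qed
    have "cmod (?f (Suc 1) x) \<le> fact (Suc 1) * B / (\<rho> / 4) ^ Suc 1"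
    proof (rule Cauchy_inequality)
      show "f holomorphic_on ball x (\<rho> / 4)"
        using hol sub ball_subset_cball holomorphic_on_subset by blast
      show "continuous_on (cball x (\<rho> / 4)) f"
        using hol sub holomorphic_on_imp_continuous_on continuous_on_subset by blast
      show "cmod (f u) \<le> B" if "cmod (x - u) = \<rho> / 4" for u
        using that sub by (intro B) (auto simp: dist_norm subset_iff)
    qed (use \<rho> in simp)
    also have "\<dots> = 32 * B / \<rho>\<^sup>2" by (simp add: power2_eq_square field_simps)
    finally show "cmod (?f (Suc 1) x) \<le> 32 * B / \<rho>\<^sup>2" .
  qed
  then show ?thesis by (simp add: algebra_simps power2_eq_square)
qed

text \<open>Cutting the unit interval into \<open>N\<close> steps bounds the total increment by
  \<open>C / N\<close>, which tends to 0.\<close>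

lemma quadratic_increments_imp_constant:
  fixes m :: "real \<Rightarrow> complex"
  assumes "r > 0" "\<And>s \<epsilon>. 0 \<le> s \<Longrightarrow> s + \<epsilon> \<le> 1 \<Longrightarrow> 0 \<le> \<epsilon> \<Longrightarrow> \<epsilon> \<le> r \<Longrightarrow> cmod (m (s + \<epsilon>) - m s) \<le> C * \<epsilon>\<^sup>2"
  shows "m 1 = m 0"
proof -
  have step: "cmod (m 1 - m 0) \<le> C / real N" if N: "N > 0" "1 / real N \<le> r" for N :: nat
  proof -
    have "m 1 - m 0 = (\<Sum>k<N. m (real (Suc k) / real N) - m (real k / real N))"
      using sum_lessThan_telescope[of "\<lambda>k. m (real k / real N)" N] N by simp
    also have "cmod \<dots> \<le> (\<Sum>k<N. C * (1 / real N)\<^sup>2)"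
    proof (rule order_trans[OF norm_sum], rule sum_mono)
      fix k assume "k \<in> {..<N}"
      then have "real (Suc k) \<le> real N" by simp
      then have "real k / real N + 1 / real N \<le> 1"
        using N(1) by (simp add: add_divide_distrib[symmetric])
      then have "cmod (m (real k / real N + 1 / real N) - m (real k / real N)) \<le> C * (1 / real N)\<^sup>2"
        by (intro assms(2)) (use N in auto)
      then show "cmod (m (real (Suc k) / real N) - m (real k / real N)) \<le> C * (1 / real N)\<^sup>2"
        by (simp add: add_divide_distrib add.commute)
    qed
    also have "\<dots> = C / real N" using N(1) by (simp add: power2_eq_square)
    finally show ?thesis .
  qed
  have "(\<lambda>N. C / real N) \<longlonglongrightarrow> 0" by (rule lim_const_over_n)
  moreover have "\<forall>\<^sub>F N in sequentially. cmod (m 1 - m 0) \<le> C / real N"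
  proof -
    obtain N0 :: nat where N0: "1 / r < real N0" using reals_Archimedean2 by blast
    show ?thesis
    proof (rule eventually_sequentiallyI[of "max N0 1"])
      fix N assume N: "max N0 1 \<le> N"
      then have "1 / r < real N" using N0 by (simp add: less_le_trans)
      then have "1 / real N \<le> r" using assms(1) N by (simp add: field_simps)
      then show "cmod (m 1 - m 0) \<le> C / real N" using N by (intro step) auto
    qed
  qed
  ultimately have "cmod (m 1 - m 0) \<le> 0" by (intro tendsto_lowerbound[of _ 0 sequentially]) auto
  then show ?thesis by simp
qed

lemma HAP_coeff_integrand_ap:
  fixes F :: "complex ^ 'n \<Rightarrow> complex ^ 'm"
  assumes "F \<in> HAP \<Omega>" "y \<in> \<Omega>"
  shows "ap (\<lambda>x. exp (- (\<i> * herm (cplx x y) (rvec \<mu>))) * F (cplx x y) $ l)"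
  unfolding exp_neg_herm by (intro ap_mult ap_cmult ap_wave HAP_slice_ap[OF assms])

text \<open>For a holomorphic function, an imaginary increment is, up to second order, \<open>\<i>\<close> times the real
  increment, and the mean of the latter vanishes by translation invariance.\<close>

lemma HAP_coeff_independent:
  fixes F :: "complex ^ 'n \<Rightarrow> complex ^ 'm"
  assumes F: "F \<in> HAP \<Omega>" and \<Omega>: "open \<Omega>" "convex \<Omega>" and y: "y0 \<in> \<Omega>" "y1 \<in> \<Omega>"
  shows "mean (\<lambda>x. exp (- (\<i> * herm (cplx x y1) (rvec \<mu>))) * F (cplx x y1) $ l) =
    mean (\<lambda>x. exp (- (\<i> * herm (cplx x y0) (rvec \<mu>))) * F (cplx x y0) $ l)"
proof -
  define v where "v = y1 - y0"
  define h where "h = (\<lambda>z. exp (- (\<i> * herm z (rvec \<mu>))) * F z $ l)"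
  define m where "m = (\<lambda>s. mean (\<lambda>x. h (cplx x (y0 + s *\<^sub>R v))))"
  define I where "I = (\<lambda>s. y0 + s *\<^sub>R v) -` \<Omega>"
  have contI: "continuous_on UNIV (\<lambda>s. y0 + s *\<^sub>R v)" by (intro continuous_intros)
  have "open I" unfolding I_def by (rule open_vimage[OF \<Omega>(1) contI])
  moreover have "{0..1} \<subseteq> I"
  proof
    fix s :: real assume s: "s \<in> {0..1}"
    have "(1 - s) *\<^sub>R y0 + s *\<^sub>R y1 \<in> \<Omega>" using s y by (intro convexD[OF \<Omega>(2)]) auto
    then show "s \<in> I" by (simp add: I_def v_def algebra_simps)
  qed
  \<comment> \<open>Compactness of the segment leaves a margin \<open>\<rho>\<close> beyond both of
    its ends, so that the discs of radius \<open>\<rho>\<close> used below stay over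
    \<open>\<Omega>\<close>.\<close>
  ultimately obtain \<rho> where \<rho>: "\<rho> > 0" "(\<Union>s\<in>{0..1}. cball s \<rho>) \<subseteq> I"
    using compact_subset_open_imp_cball_epsilon_subset[of "{0..1::real}" I] by auto
  define K where "K = (\<lambda>s. y0 + s *\<^sub>R v) ` {- \<rho>..1 + \<rho>}"
  have K: "compact K"
    unfolding K_def by (intro compact_continuous_image continuous_on_subset[OF contI]) auto
  have inI: "s \<in> I" if s: "s \<in> {- \<rho>..1 + \<rho>}" for s
  proof -
    have "s \<in> cball (max 0 (min s 1)) \<rho>" "max 0 (min s 1) \<in> {0..1}"
      using s \<rho>(1) by (auto simp: dist_real_def max_def min_def)
    then show ?thesis using \<rho>(2) by blast
  qed
  then have K\<Omega>: "K \<subseteq> \<Omega>" by (auto simp: K_def I_def)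
  obtain B0 where B0: "B0 > 0" "\<And>x y l. y \<in> K \<Longrightarrow> cmod (F (cplx x y) $ l) \<le> B0"
    by (rule HAP_bounded[OF F K K\<Omega>]) (rule that)
  have "bounded ((\<lambda>y. exp (y \<bullet> \<mu>)) ` K)"
    by (intro compact_imp_bounded compact_continuous_image K continuous_intros)
  then obtain E where E: "\<forall>e\<in>(\<lambda>y. exp (y \<bullet> \<mu>)) ` K. norm e \<le> E" unfolding bounded_iff by (elim
      exE) (rule that)
  define B where "B = E * B0"
  have hB: "cmod (h (cplx x y)) \<le> B" if "y \<in> K" for x y
  proof -
    have "exp (y \<bullet> \<mu>) \<le> E" using E that by auto
    moreover have "cmod (h (cplx x y)) = exp (y \<bullet> \<mu>) * cmod (F (cplx x y) $ l)"
      by (simp add: h_def exp_neg_herm norm_mult)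
    ultimately show ?thesis unfolding B_def using B0(2)[OF that] 
      by (simp add: mult_mono order_trans[OF exp_ge_zero])
  qed
  \<comment> \<open>On the complex line in the real direction \<open>v\<close>, the real part of
    \<open>w\<close> translates \<open>x\<close> and the imaginary part moves \<open>y0\<close>. A
    single holomorphic function of \<open>w\<close> thus contains both increments that have to be
    compared.\<close>
  have line: "cplx x y0 + w *s rvec v = cplx (x + Re w *\<^sub>R v) (y0 + Im w *\<^sub>R v)" for x w
    by (simp add: cplx_def rvec_def vec_eq_iff complex_eq_iff)
  \<comment> \<open>Two Taylor remainders occur, each with the constant 32.\<close>
  define C where "C = 64 * B / \<rho>\<^sup>2"
  have hap: "ap (\<lambda>x. h (cplx x y))" if "y \<in> \<Omega>" for y
    unfolding h_def by (rule HAP_coeff_integrand_ap[OF F that])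
  have "m 1 = m 0"
  proof (rule quadratic_increments_imp_constant[of "\<rho> / 4"])
    show "\<rho> / 4 > 0" using \<rho> by simp
    fix s \<epsilon> :: real assume s: "0 \<le> s" "s + \<epsilon> \<le> 1" "0 \<le> \<epsilon>" "\<epsilon> \<le> \<rho> / 4"
    define ys where "ys = y0 + s *\<^sub>R v"
    have ys: "ys \<in> \<Omega>" "y0 + (s + \<epsilon>) *\<^sub>R v \<in> \<Omega>"
      using inI[of s] inI[of "s + \<epsilon>"] s \<rho>(1) by (auto simp: ys_def I_def)
    have key: "cmod ((h (cplx x (y0 + (s + \<epsilon>) *\<^sub>R v)) - h (cplx x ys)) -
        \<i> * (h (cplx (x + \<epsilon> *\<^sub>R v) ys) - h (cplx x ys))) \<le> C * \<epsilon>\<^sup>2" for x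
    proof -
      define \<phi> where "\<phi> = (\<lambda>w. h (cplx x y0 + w *s rvec v))"
      let ?z = "\<i> * complex_of_real s"
      have im: "Im u \<in> {- \<rho>..1 + \<rho>}" if "u \<in> ball ?z \<rho>" for u
      proof -
        have "\<bar>Im (?z - u)\<bar> < \<rho>" using that abs_Im_le_cmod[of "?z - u"] by (simp add: dist_norm)
        then show ?thesis using s by auto
      qed
      have hol: "\<phi> holomorphic_on ball ?z \<rho>"
      proof (rule holomorphic_onI, rule field_differentiable_at_within)
        fix u assume "u \<in> ball ?z \<rho>"
        then have "cplx x y0 + u *s rvec v \<in> tube \<Omega>"
          unfolding line using inI[OF im] by (simp add: I_def)
        then obtain L where L: "(F has_derivative L) (at (cplx x y0 + u *s rvec v))" "\<And>c u. L (c
            *s u) = c *s L u"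
          using F unfolding HAP_def holomorphic_map_def by blast
        have 1: "(\<lambda>w. F (cplx x y0 + w *s rvec v) $ l) field_differentiable at u"
          using has_field_derivative_along_line[OF L] field_differentiable_def by blast
        have 2: "(\<lambda>w. exp (- (\<i> * (herm (cplx x y0) (rvec \<mu>) + w * herm (rvec v) (rvec \<mu>)))))
            field_differentiable at u"
          by (rule holomorphic_on_imp_differentiable_at[of _ UNIV]) (auto intro!: holomorphic_intros)
        show "\<phi> field_differentiable at u"
          unfolding \<phi>_def h_def herm_add_scale by (rule field_differentiable_mult[OF 2 1])
      qed
      have Bd: "cmod (\<phi> u) \<le> B" if "u \<in> ball ?z \<rho>" for u
        unfolding \<phi>_def line using im[OF that] by (intro hB) (auto simp: K_def)
      have v1: "\<phi> ?z = h (cplx x ys)" "\<phi> (?z + complex_of_real \<epsilon>) = h (cplx (x + \<epsilon> *\<^sub>R v) ys)"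
        "\<phi> (?z + \<i> * complex_of_real \<epsilon>) = h (cplx x (y0 + (s + \<epsilon>) *\<^sub>R v))"
        unfolding \<phi>_def line ys_def by simp_all
      have e: "cmod (complex_of_real \<epsilon>) \<le> \<rho> / 4" "cmod (\<i> * complex_of_real \<epsilon>) \<le> \<rho> / 4"
        using s by (auto simp: norm_mult)
      let ?a = "\<phi> (?z + \<i> * complex_of_real \<epsilon>) - \<phi> ?z - deriv \<phi> ?z * (\<i> * complex_of_real \<epsilon>)"
      let ?b = "\<phi> (?z + complex_of_real \<epsilon>) - \<phi> ?z - deriv \<phi> ?z * complex_of_real \<epsilon>"
      have a: "cmod ?a \<le> 32 * B / \<rho>\<^sup>2 * \<epsilon>\<^sup>2"
        using second_order_remainder[OF hol Bd \<rho>(1) e(2)] s by (simp add: norm_mult)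
      have b: "cmod (\<i> * ?b) \<le> 32 * B / \<rho>\<^sup>2 * \<epsilon>\<^sup>2"
        using second_order_remainder[OF hol Bd \<rho>(1) e(1)] s by (simp add: norm_mult)
      have ab: "cmod (?a - \<i> * ?b) \<le> 32 * B / \<rho>\<^sup>2 * \<epsilon>\<^sup>2 + 32 * B / \<rho>\<^sup>2 * \<epsilon>\<^sup>2"
        by (rule order_trans[OF norm_triangle_ineq4 add_mono[OF a b]])
      have eq: "(\<phi> (?z + \<i> * complex_of_real \<epsilon>) - \<phi> ?z) - \<i> * (\<phi> (?z + complex_of_real \<epsilon>) - \<phi> ?z)
          = ?a - \<i> * ?b"
        by (simp add: algebra_simps)
      have "C * \<epsilon>\<^sup>2 = 32 * B / \<rho>\<^sup>2 * \<epsilon>\<^sup>2 + 32 * B / \<rho>\<^sup>2 * \<epsilon>\<^sup>2"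
        by (simp add: C_def)
      then show ?thesis using ab unfolding v1[symmetric] eq by (simp only:)
    qed
    have tr: "ap (\<lambda>x. h (cplx (x + \<epsilon> *\<^sub>R v) ys))" by (rule ap_translate[OF hap[OF ys(1)]])
    have "cmod (mean (\<lambda>x. (h (cplx x (y0 + (s + \<epsilon>) *\<^sub>R v)) - h (cplx x ys)) -
        \<i> * (h (cplx (x + \<epsilon> *\<^sub>R v) ys) - h (cplx x ys)))) \<le> C * \<epsilon>\<^sup>2"
      by (rule mean_norm[OF _ key]) (intro ap_diff ap_cmult hap ys tr)
    also have "mean (\<lambda>x. (h (cplx x (y0 + (s + \<epsilon>) *\<^sub>R v)) - h (cplx x ys)) -
        \<i> * (h (cplx (x + \<epsilon> *\<^sub>R v) ys) - h (cplx x ys))) = m (s + \<epsilon>) - m s"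
      using mean_translate[OF hap[OF ys(1)], of "\<epsilon> *\<^sub>R v"]
      by (simp add: mean_diff mean_cmult ap_diff ap_cmult hap ys tr m_def ys_def[symmetric])
    finally show "cmod (m (s + \<epsilon>) - m s) \<le> C * \<epsilon>\<^sup>2" .
  qed
  then show ?thesis by (simp add: m_def h_def v_def)
qed

text \<open>\<open>cube_mean\<close> repeats the expression inside \<open>fourier_coeff\<close>, so
  it can be folded in there. A point of \<open>\<Omega>\<close> is what makes the definite
  description unique: over the empty set every number would qualify.\<close>

lemma fourier_coeff_eqI:
  assumes "\<Omega> \<noteq> {}"
    and "\<And>y. y \<in> \<Omega> \<Longrightarrow> ((\<lambda>s. cube_mean s (\<lambda>x. exp (- (\<i> * herm (cplx x y) (rvec \<mu>))) * f (cplx x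
        y))) \<longlongrightarrow> c) at_top"
  shows "fourier_coeff \<Omega> \<mu> f = c"
  unfolding fourier_coeff_def cube_mean_def[symmetric]
proof (rule the_equality)
  show "\<forall>y\<in>\<Omega>. ((\<lambda>s. cube_mean s (\<lambda>x. exp (- (\<i> * herm (cplx x y) (rvec \<mu>))) * f (cplx x y))) \<longlongrightarrow> c) at_top"
    using assms(2) by blast
  fix d assume d: "\<forall>y\<in>\<Omega>. ((\<lambda>s. cube_mean s (\<lambda>x. exp (- (\<i> * herm (cplx x y) (rvec \<mu>))) * f (cplx x
      y))) \<longlongrightarrow> d) at_top"
  obtain y where "y \<in> \<Omega>" using assms(1) by blast
  then show "d = c" using d assms(2) tendsto_unique[OF trivial_limit_at_top_linorder] by blast
qed

lemma HAP_fourier_coeff: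
  fixes F :: "complex ^ 'n \<Rightarrow> complex ^ 'm"
  assumes F: "F \<in> HAP \<Omega>" and \<Omega>: "open \<Omega>" "convex \<Omega>" and y: "y \<in> \<Omega>"
  shows "fourier_coeff \<Omega> \<mu> (\<lambda>z. F z $ l) =
    mean (\<lambda>x. exp (- (\<i> * herm (cplx x y) (rvec \<mu>))) * F (cplx x y) $ l)"
proof (rule fourier_coeff_eqI)
  show "\<Omega> \<noteq> {}" using y by blast
  fix y' assume y': "y' \<in> \<Omega>"
  show "((\<lambda>s. cube_mean s (\<lambda>x. exp (- (\<i> * herm (cplx x y') (rvec \<mu>))) * F (cplx x y') $ l)) \<longlongrightarrow>
      mean (\<lambda>x. exp (- (\<i> * herm (cplx x y) (rvec \<mu>))) * F (cplx x y) $ l)) at_top"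
    unfolding HAP_coeff_independent[OF F \<Omega> y' y]
    by (rule ap_mean[OF HAP_coeff_integrand_ap[OF F y']])
qed

text \<open>Averaging over real translates against a wave isolates one term of the Fourier series at
  the same point of the tube, by the substitution of \<open>t + x\<close> for \<open>t\<close>.
  Averages against trigonometric polynomials are therefore exponential sums.\<close>

lemma HAP_mean_translated_wave:
  fixes F :: "complex ^ 'n \<Rightarrow> complex ^ 'm"
  assumes F: "F \<in> HAP \<Omega>" and \<Omega>: "open \<Omega>" "convex \<Omega>" and y: "y \<in> \<Omega>"
  shows "mean (\<lambda>t. cis (t \<bullet> (- \<mu>)) * F (cplx (x + t) y) $ l) =
    fourier_coeff \<Omega> \<mu> (\<lambda>z. F z $ l) * exp (\<i> * herm (cplx x y) (rvec \<mu>))"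
proof -
  have "cis (t \<bullet> (- \<mu>)) * F (cplx (x + t) y) $ l = exp (\<i> * herm (cplx x y) (rvec \<mu>)) *
      (exp (- (\<i> * herm (cplx (t + x) y) (rvec \<mu>))) * F (cplx (t + x) y) $ l)" for t
  proof -
    have "exp (\<i> * herm (cplx x y) (rvec \<mu>)) * exp (- (\<i> * herm (cplx (t + x) y) (rvec \<mu>))) =
       complex_of_real (exp (- (y \<bullet> \<mu>)) * exp (y \<bullet> \<mu>)) * (cis (x \<bullet> \<mu>) * cis ((t + x) \<bullet> (- \<mu>)))"
      unfolding exp_herm exp_neg_herm by (simp add: mult_ac)
    also have "\<dots> = cis (t \<bullet> (- \<mu>))"
      by (simp add: cis_mult inner_add_left flip: exp_add)
    finally show ?thesis by (simp only: mult.assoc[symmetric] add.commute[of x])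
  qed
  then have "mean (\<lambda>t. cis (t \<bullet> (- \<mu>)) * F (cplx (x + t) y) $ l) = exp (\<i> * herm (cplx x y) (rvec \<mu>)) *
      mean (\<lambda>t. exp (- (\<i> * herm (cplx (t + x) y) (rvec \<mu>))) * F (cplx (t + x) y) $ l)"
    by (simp only:) (rule mean_cmult[OF ap_translate[OF HAP_coeff_integrand_ap[OF F y]]])
  also have "mean (\<lambda>t. exp (- (\<i> * herm (cplx (t + x) y) (rvec \<mu>))) * F (cplx (t + x) y) $ l) =
      mean (\<lambda>t. exp (- (\<i> * herm (cplx t y) (rvec \<mu>))) * F (cplx t y) $ l)"
    by (rule mean_translate[OF HAP_coeff_integrand_ap[OF F y]])
  finally show ?thesis unfolding HAP_fourier_coeff[OF F \<Omega> y] by (simp add: mult.commute)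
qed

text \<open>The frequencies \<open>\<theta> i\<close> may coincide, hence the sum over a fibre. By
  linearity only the mean of a single wave is needed, and the factors depending on \<open>y\<close>
  cancel on the fibre.\<close>

lemma fourier_coeff_exponential_sum:
  fixes \<Omega> :: "(real ^ 'n) set" and \<theta> :: "'i \<Rightarrow> real ^ 'n"
  assumes "\<Omega> \<noteq> {}" "finite I"
  shows "fourier_coeff \<Omega> \<mu> (\<lambda>z. \<Sum>i\<in>I. c i * exp (\<i> * herm z (rvec (\<theta> i)))) = (\<Sum>i\<in>{i\<in>I. \<theta> i = \<mu>}. c i)"
proof (rule fourier_coeff_eqI[OF assms(1)])
  fix y :: "real ^ 'n"
  define d where "d = (\<lambda>i. c i * complex_of_real (exp (y \<bullet> \<mu>) * exp (- (y \<bullet> \<theta> i))))"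
  have e: "exp (- (\<i> * herm (cplx x y) (rvec \<mu>))) * (\<Sum>i\<in>I. c i * exp (\<i> * herm (cplx x y) (rvec (\<theta>
      i)))) =
      (\<Sum>i\<in>I. d i * cis (x \<bullet> (\<theta> i - \<mu>)))" for x
    unfolding sum_distrib_left
  proof (rule sum.cong[OF refl])
    fix i
    have "cis (x \<bullet> (\<theta> i - \<mu>)) = cis (x \<bullet> (- \<mu>)) * cis (x \<bullet> \<theta> i)"
      by (simp add: cis_mult inner_diff_right)
    then show "exp (- (\<i> * herm (cplx x y) (rvec \<mu>))) * (c i * exp (\<i> * herm (cplx x y) (rvec (\<theta> i)))) =
        d i * cis (x \<bullet> (\<theta> i - \<mu>))"
      unfolding exp_herm exp_neg_herm d_def by (simp only: of_real_mult mult_ac)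
  qed
  have "trig (\<lambda>x. \<Sum>i\<in>I. d i * cis (x \<bullet> (\<theta> i - \<mu>)))" by (intro trig_sum trig_wave)
  then have "((\<lambda>s. cube_mean s (\<lambda>x. \<Sum>i\<in>I. d i * cis (x \<bullet> (\<theta> i - \<mu>)))) \<longlongrightarrow>
      mean (\<lambda>x. \<Sum>i\<in>I. d i * cis (x \<bullet> (\<theta> i - \<mu>)))) at_top"
    by (intro ap_mean trig_ap)
  also have "mean (\<lambda>x. \<Sum>i\<in>I. d i * cis (x \<bullet> (\<theta> i - \<mu>))) = (\<Sum>i\<in>I. d i * (if \<theta> i - \<mu> = 0 then 1 else 0))"
    by (simp add: mean_sum mean_cmult ap_cmult ap_wave mean_wave del: right_minus_eq)
  also have "\<dots> = (\<Sum>i\<in>{i\<in>I. \<theta> i = \<mu>}. c i)"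
    unfolding sum.inter_filter[OF assms(2)] by (rule sum.cong) (auto simp: d_def simp flip: exp_add)
  finally show "((\<lambda>s. cube_mean s (\<lambda>x. exp (- (\<i> * herm (cplx x y) (rvec \<mu>))) *
      (\<Sum>i\<in>I. c i * exp (\<i> * herm (cplx x y) (rvec (\<theta> i)))))) \<longlongrightarrow> (\<Sum>i\<in>{i\<in>I. \<theta> i = \<mu>}. c i)) at_top"
    unfolding e .
qed

text \<open>\<open>perturb_sum\<close> runs over the spectrum and thus omits frequencies whose
  coefficients cancel. Adding these back as zero terms and regrouping by the fibres of
  \<open>\<theta>\<close> gives a sum over the original index set.\<close>

lemma perturb_exponential_sum:
  fixes \<Omega> :: "(real ^ 'n) set" and \<theta> :: "'i \<Rightarrow> real ^ 'n"
  assumes "\<Omega> \<noteq> {}" "finite I"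
  shows "perturb_sum \<Omega> \<gamma> (\<lambda>z. \<Sum>i\<in>I. c i * exp (\<i> * herm z (rvec (\<theta> i)))) z =
    (\<Sum>i\<in>I. c i * \<gamma> (\<theta> i) * exp (\<i> * herm z (rvec (\<theta> i))))"
proof -
  let ?P = "\<lambda>z. \<Sum>i\<in>I. c i * exp (\<i> * herm z (rvec (\<theta> i)))"
  have co: "fourier_coeff \<Omega> \<mu> ?P = (\<Sum>i\<in>{i\<in>I. \<theta> i = \<mu>}. c i)" for \<mu>
    by (rule fourier_coeff_exponential_sum[OF assms])
  have "spectrum \<Omega> ?P \<subseteq> \<theta> ` I"
    unfolding spectrum_def co using sum.neutral by (auto, metis (mono_tags, lifting)
        empty_Collect_eq image_eqI sum.empty)
  then have "perturb_sum \<Omega> \<gamma> ?P z = (\<Sum>\<mu>\<in>\<theta> ` I. fourier_coeff \<Omega> \<mu> ?P * \<gamma> \<mu> * exp (\<i> * herm z (rvec \<mu>)))"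
    unfolding perturb_sum_def
    by (rule sum.mono_neutral_left[rotated]) (use assms(2) in \<open>auto simp: spectrum_def\<close>)
  also have "\<dots> = (\<Sum>\<mu>\<in>\<theta> ` I. \<Sum>i\<in>{i\<in>I. \<theta> i = \<mu>}. c i * \<gamma> (\<theta> i) * exp (\<i> * herm z (rvec (\<theta> i))))"
    unfolding co sum_distrib_right by (intro sum.cong refl) auto
  also have "\<dots> = (\<Sum>i\<in>I. c i * \<gamma> (\<theta> i) * exp (\<i> * herm z (rvec (\<theta> i))))"
    by (rule sum.image_gen[OF assms(2), symmetric])
  finally show ?thesis .
qed

text \<open>The average of \<open>t \<mapsto> F (cplx (x + t) y)\<close> with weight
  \<open>W\<close>, divided by the mean \<open>w\<close> of \<open>W\<close>, is close to
  \<open>F\<close> because \<open>W\<close> charges only almost periods. Replacing \<open>W\<close>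
  by a trigonometric polynomial \<open>p\<close> turns the average into an exponential sum whose
  coefficients \<open>b\<close> depend neither on \<open>x\<close> nor on \<open>y\<close>, and
  frequencies off the spectrum drop out by themselves.\<close>

lemma HAP_approximation:
  fixes F :: "complex ^ 'n \<Rightarrow> complex ^ 'm"
  assumes F: "F \<in> HAP \<Omega>" and \<Omega>: "open \<Omega>" "convex \<Omega>" and K: "compact K" "K \<subseteq> \<Omega>" and e: "\<epsilon> > 0"
  obtains A b where "finite A" "A \<subseteq> spectrum \<Omega> (\<lambda>z. F z $ l)"
    "\<And>x y. y \<in> K \<Longrightarrow> cmod (F (cplx x y) $ l - (\<Sum>\<mu>\<in>A. b \<mu> * exp (\<i> * herm (cplx x y) (rvec \<mu>)))) \<le> \<epsilon>"
proof -
  obtain \<Lambda> \<delta> where \<Lambda>: "finite \<Lambda>" "\<delta> > 0" "\<And>t. bohr \<Lambda> \<delta> t \<Longrightarrow> period F K (\<epsilon>/2) t"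
    by (rule HAP_bohr[OF F K, of "\<epsilon>/2"]) (use e in simp, rule that)
  obtain W :: "real ^ 'n \<Rightarrow> real" and T c where W: "ap (\<lambda>t. complex_of_real (W t))" "\<And>t. W t \<ge> 0"
    "\<And>t \<mu>. W t > 0 \<Longrightarrow> \<mu> \<in> \<Lambda> \<Longrightarrow> cmod (cis (t \<bullet> \<mu>) - 1) < \<delta>"
    "finite T" "c > 0" "\<And>x. (\<Sum>i\<in>T. W (x - i)) \<ge> c"
    by (rule bohr_kernel[OF \<Lambda>(1,2)]) (rule that)
  define w where "w = mean (\<lambda>t. complex_of_real (W t))"
  have w: "Re w > 0" unfolding w_def by (rule kernel_mean_pos[OF W(1,4,5,6)])
  have w0: "w \<noteq> 0" "cmod w > 0" using w by auto
  have bohrW: "period F K (\<epsilon>/2) t" if "W t > 0" for t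
    by (rule \<Lambda>(3)) (use W(3)[OF that] in \<open>simp add: bohr_def\<close>)
  obtain B where B: "B > 0" "\<And>x y l. y \<in> K \<Longrightarrow> cmod (F (cplx x y) $ l) \<le> B"
    by (rule HAP_bounded[OF F K]) (rule that)
  \<comment> \<open>The error of replacing \<open>W\<close> by \<open>p\<close> is at most
    \<open>B * \<eta>\<close>, that is \<open>\<epsilon> / 2\<close> after division by
    \<open>cmod w\<close>.\<close>
  define \<eta> where "\<eta> = \<epsilon> * cmod w / (2 * B)"
  have \<eta>: "\<eta> > 0" using e w0 B by (simp add: \<eta>_def)
  obtain p where p: "trig p" "\<And>t. cmod (complex_of_real (W t) - p t) < \<eta>"
    by (rule apE[OF W(1) \<eta>]) (rule that)
  obtain S k where S: "finite S" "p = (\<lambda>t. \<Sum>\<mu>\<in>S. k \<mu> * cis (t \<bullet> \<mu>))"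
    by (rule trig_representation[OF p(1)])
  define a where "a = (\<lambda>\<mu>. fourier_coeff \<Omega> \<mu> (\<lambda>z. F z $ l))"
  \<comment> \<open>A wave of \<open>p\<close> at \<open>\<mu>\<close> extracts the coefficient of
    \<open>F\<close> at \<open>- \<mu>\<close>, hence the change of sign. Vanishing coefficients are
    removed to place \<open>A\<close> inside the spectrum.\<close>
  define A where "A = {\<mu> \<in> uminus ` S. a \<mu> \<noteq> 0}"
  define b where "b = (\<lambda>\<mu>. k (- \<mu>) * a \<mu> / w)"
  show thesis
  proof (rule that)
    show "finite A" using S(1) by (simp add: A_def)
    show "A \<subseteq> spectrum \<Omega> (\<lambda>z. F z $ l)" by (auto simp: A_def a_def spectrum_def)
    fix x y assume y: "y \<in> K"
    then have y\<Omega>: "y \<in> \<Omega>" using K by blast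
    let ?f = "\<lambda>t. F (cplx (x + t) y) $ l"
    have f: "ap ?f" using ap_translate[OF HAP_slice_ap[OF F y\<Omega>], of x] by (simp add: add.commute)
    have "mean (\<lambda>t. ?f t * p t) = mean (\<lambda>t. \<Sum>\<mu>\<in>S. k \<mu> * (cis (t \<bullet> (- (- \<mu>))) * ?f t))"
      unfolding S(2) by (simp add: sum_distrib_left mult_ac)
    also have "\<dots> = (\<Sum>\<mu>\<in>S. k \<mu> * mean (\<lambda>t. cis (t \<bullet> (- (- \<mu>))) * ?f t))"
    proof -
      have *: "ap (\<lambda>t. cis (t \<bullet> (- (- \<mu>))) * ?f t)" for \<mu> by (intro ap_mult ap_wave f)
      show ?thesis by (subst mean_sum) (intro ap_cmult *, simp only: mean_cmult[OF *])
    qed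
    also have "\<dots> = (\<Sum>\<mu>\<in>S. k \<mu> * (a (- \<mu>) * exp (\<i> * herm (cplx x y) (rvec (- \<mu>)))))"
      unfolding a_def HAP_mean_translated_wave[OF F \<Omega> y\<Omega>, symmetric] ..
    also have "\<dots> = (\<Sum>\<mu>\<in>uminus ` S. k (- \<mu>) * (a \<mu> * exp (\<i> * herm (cplx x y) (rvec \<mu>))))"
      by (subst sum.reindex) (auto intro: inj_onI)
    also have "\<dots> = (\<Sum>\<mu>\<in>A. k (- \<mu>) * (a \<mu> * exp (\<i> * herm (cplx x y) (rvec \<mu>))))"
      by (rule sum.mono_neutral_right) (use S(1) in \<open>auto simp: A_def\<close>)
    also have "\<dots> = w * (\<Sum>\<mu>\<in>A. b \<mu> * exp (\<i> * herm (cplx x y) (rvec \<mu>)))"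
      unfolding sum_distrib_left by (rule sum.cong) (use w0 in \<open>auto simp: b_def\<close>)
    finally have mp: "mean (\<lambda>t. ?f t * p t) = w * (\<Sum>\<mu>\<in>A. b \<mu> * exp (\<i> * herm (cplx x y) (rvec \<mu>)))" .
    have pa: "ap p" by (rule trig_ap[OF p(1)])
    \<comment> \<open>Wherever \<open>W t\<close> is nonzero, \<open>t\<close> is an almost period,
      so the integrand is dominated by \<open>\<epsilon>/2 * W t\<close>.\<close>
    have 1: "cmod (mean (\<lambda>t. (?f 0 - ?f t) * complex_of_real (W t))) \<le> \<epsilon>/2 * Re w"
    proof -
      have "cmod (mean (\<lambda>t. (?f 0 - ?f t) * complex_of_real (W t))) \<le> Re (mean (\<lambda>t.
          complex_of_real (\<epsilon>/2 * W t)))"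
      proof (rule mean_le)
        show "ap (\<lambda>t. (?f 0 - ?f t) * complex_of_real (W t))" by (intro ap_mult ap_diff ap_const f W(1))
        show "ap (\<lambda>t. complex_of_real (\<epsilon>/2 * W t))" unfolding of_real_mult by (rule ap_cmult[OF W(1)])
        fix t
        have "cmod (?f 0 - ?f t) * W t \<le> \<epsilon>/2 * W t"
        proof (cases "W t = 0")
          case False
          then have "W t > 0" using W(2)[of t] by simp
          then have "cmod (?f t - ?f 0) < \<epsilon>/2" using periodD[OF bohrW y, of t x l] by simp
          then show ?thesis using W(2)[of t] by (intro mult_right_mono) (simp_all add:
              norm_minus_commute)
        qed simp
        then show "cmod ((?f 0 - ?f t) * complex_of_real (W t)) \<le> \<epsilon>/2 * W t"
          using W(2)[of t] by (simp add: norm_mult)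
      qed
      also have "\<dots> = \<epsilon>/2 * Re w" unfolding of_real_mult mean_cmult[OF W(1)] w_def by simp
      finally show ?thesis .
    qed
    have 2: "cmod (mean (\<lambda>t. ?f t * (complex_of_real (W t) - p t))) \<le> B * \<eta>"
    proof (rule mean_norm)
      show "ap (\<lambda>t. ?f t * (complex_of_real (W t) - p t))" by (intro ap_mult ap_diff f W(1) pa)
      show "cmod (?f t * (complex_of_real (W t) - p t)) \<le> B * \<eta>" for t
        unfolding norm_mult by (rule mult_mono) (use B y p(2)[of t] in \<open>auto intro: less_imp_le\<close>)
    qed
    have "mean (\<lambda>t. (?f 0 - ?f t) * complex_of_real (W t)) + mean (\<lambda>t. ?f t * (complex_of_real (W
        t) - p t)) =
        mean (\<lambda>t. (?f 0 - ?f t) * complex_of_real (W t) + ?f t * (complex_of_real (W t) - p t))"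
      by (rule mean_add[symmetric]) (intro ap_mult ap_diff ap_const f W(1) pa)+
    also have "\<dots> = mean (\<lambda>t. ?f 0 * complex_of_real (W t) - ?f t * p t)" by (simp add: algebra_simps)
    also have "\<dots> = ?f 0 * w - mean (\<lambda>t. ?f t * p t)"
      using mean_diff[OF ap_cmult[OF W(1), of "?f 0"] ap_mult[OF f pa]] mean_cmult[OF W(1), of "?f 0"]
      by (simp add: w_def)
    also have "\<dots> = w * (F (cplx x y) $ l - (\<Sum>\<mu>\<in>A. b \<mu> * exp (\<i> * herm (cplx x y) (rvec \<mu>))))"
      unfolding mp by (simp add: right_diff_distrib mult.commute)
    finally have "cmod w * cmod (F (cplx x y) $ l - (\<Sum>\<mu>\<in>A. b \<mu> * exp (\<i> * herm (cplx x y) (rvec \<mu>)))) \<le>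
        \<epsilon>/2 * Re w + B * \<eta>"
      using norm_triangle_mono[OF 1 2] by (simp add: norm_mult)
    also have "\<dots> \<le> \<epsilon>/2 * cmod w + \<epsilon>/2 * cmod w"
      using e complex_Re_le_cmod[of w] B by (intro add_mono mult_left_mono) (auto simp: \<eta>_def)
    also have "\<dots> = cmod w * \<epsilon>" by simp
    finally show "cmod (F (cplx x y) $ l - (\<Sum>\<mu>\<in>A. b \<mu> * exp (\<i> * herm (cplx x y) (rvec \<mu>)))) \<le> \<epsilon>"
      using w0(2) by simp
  qed
qed

text \<open>A frequency outside all the finite sets \<open>A N\<close> is orthogonal to every
  approximating sum. Its coefficient is then at most \<open>exp (y \<bullet> \<mu>)\<close> times
  the \<open>N\<close>-th approximation error for every \<open>N\<close>, hence zero.\<close>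

lemma HAP_spectrum_countable:
  fixes F :: "complex ^ 'n \<Rightarrow> complex ^ 'm"
  assumes F: "F \<in> HAP \<Omega>" and \<Omega>: "open \<Omega>" "convex \<Omega>" "\<Omega> \<noteq> {}"
  shows "countable (spectrum \<Omega> (\<lambda>z. F z $ l))"
proof -
  obtain y where y: "y \<in> \<Omega>" using \<Omega> by blast
  have "\<exists>A b. finite A \<and> (\<forall>x. cmod (F (cplx x y) $ l - (\<Sum>\<mu>\<in>A. b \<mu> * exp (\<i> * herm (cplx x y) (rvec
      \<mu>)))) \<le> inverse (real (Suc N)))" for N
    by (rule HAP_approximation[OF F \<Omega>(1,2), of "{y}" "inverse (real (Suc N))" l]) (use y in auto)
  then obtain A b where A: "\<And>N. finite (A N)"
    "\<And>N x. cmod (F (cplx x y) $ l - (\<Sum>\<mu>\<in>A N. b N \<mu> * exp (\<i> * herm (cplx x y) (rvec \<mu>)))) \<le>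
        inverse (real (Suc N))"
    by metis
  have "spectrum \<Omega> (\<lambda>z. F z $ l) \<subseteq> (\<Union>N. A N)"
  proof (rule ccontr)
    assume "\<not> ?thesis"
    then obtain \<mu> where \<mu>: "fourier_coeff \<Omega> \<mu> (\<lambda>z. F z $ l) \<noteq> 0" "\<And>N. \<mu> \<notin> A N"
      by (auto simp: spectrum_def)
    let ?h = "\<lambda>x. exp (- (\<i> * herm (cplx x y) (rvec \<mu>)))"
    let ?P = "\<lambda>N x. \<Sum>\<mu>\<in>A N. b N \<mu> * exp (\<i> * herm (cplx x y) (rvec \<mu>))"
    have "cmod (fourier_coeff \<Omega> \<mu> (\<lambda>z. F z $ l)) \<le> exp (y \<bullet> \<mu>) * inverse (real (Suc N))" for N
    proof -
      have P0: "mean (\<lambda>x. ?h x * ?P N x) = 0"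
      proof -
        have "?h x * ?P N x = (\<Sum>\<nu>\<in>A N. (complex_of_real (exp (y \<bullet> \<mu>)) * (b N \<nu> * complex_of_real
            (exp (- (y \<bullet> \<nu>))))) * cis (x \<bullet> (\<nu> - \<mu>)))" for x
          unfolding sum_distrib_left exp_herm exp_neg_herm
        proof (rule sum.cong[OF refl])
          fix \<nu>
          have "cis (x \<bullet> (\<nu> - \<mu>)) = cis (x \<bullet> (- \<mu>)) * cis (x \<bullet> \<nu>)" by (simp add: cis_mult
              inner_diff_right)
          then show "complex_of_real (exp (y \<bullet> \<mu>)) * cis (x \<bullet> - \<mu>) * (b N \<nu> * (complex_of_real
              (exp (- (y \<bullet> \<nu>))) * cis (x \<bullet> \<nu>))) =
            complex_of_real (exp (y \<bullet> \<mu>)) * (b N \<nu> * complex_of_real (exp (- (y \<bullet> \<nu>)))) * cis (x \<bullet>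
                (\<nu> - \<mu>))"
            by (simp only: mult_ac)
        qed
        then have "mean (\<lambda>x. ?h x * ?P N x) = (\<Sum>\<nu>\<in>A N. (complex_of_real (exp (y \<bullet> \<mu>)) * (b N \<nu> *
            complex_of_real (exp (- (y \<bullet> \<nu>))))) * mean (\<lambda>x. cis (x \<bullet> (\<nu> - \<mu>))))"
          by (simp only: mean_sum[OF ap_cmult[OF ap_wave]] mean_cmult[OF ap_wave])
        also have "\<dots> = 0"
        proof (rule sum.neutral, rule ballI)
          fix \<nu> assume "\<nu> \<in> A N"
          then have "\<nu> - \<mu> \<noteq> 0" using \<mu>(2) by auto
          then show "(complex_of_real (exp (y \<bullet> \<mu>)) * (b N \<nu> * complex_of_real (exp (- (y \<bullet> \<nu>)))))
              * mean (\<lambda>x. cis (x \<bullet> (\<nu> - \<mu>))) = 0"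
            by (simp only: mean_wave if_False mult_zero_right)
        qed
        finally show ?thesis .
      qed
      have hap: "ap ?h" unfolding exp_neg_herm by (intro ap_cmult ap_wave)
      have Pap: "ap (?P N)" unfolding exp_herm by (intro ap_sum ap_cmult ap_wave)
      have "fourier_coeff \<Omega> \<mu> (\<lambda>z. F z $ l) = mean (\<lambda>x. ?h x * F (cplx x y) $ l) - mean (\<lambda>x. ?h x
          * ?P N x)"
        unfolding P0 HAP_fourier_coeff[OF F \<Omega>(1,2) y] by simp
      also have "\<dots> = mean (\<lambda>x. ?h x * (F (cplx x y) $ l - ?P N x))"
        unfolding right_diff_distrib
        by (rule mean_diff[symmetric]) (intro ap_mult hap Pap HAP_slice_ap[OF F y])+
      also have "cmod \<dots> \<le> exp (y \<bullet> \<mu>) * inverse (real (Suc N))"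
      proof (rule mean_norm)
        show "ap (\<lambda>x. ?h x * (F (cplx x y) $ l - ?P N x))"
          by (intro ap_mult ap_diff hap Pap HAP_slice_ap[OF F y])
        show "cmod (?h x * (F (cplx x y) $ l - ?P N x)) \<le> exp (y \<bullet> \<mu>) * inverse (real (Suc N))" for x
          unfolding norm_mult using A(2)[of x N] by (intro mult_mono) (auto simp: exp_neg_herm norm_mult)
      qed
      finally show ?thesis .
    qed
    moreover have "(\<lambda>N. exp (y \<bullet> \<mu>) * inverse (real (Suc N))) \<longlonglongrightarrow> exp (y \<bullet> \<mu>) * 0"
      by (intro tendsto_intros LIMSEQ_inverse_real_of_nat)
    ultimately have "cmod (fourier_coeff \<Omega> \<mu> (\<lambda>z. F z $ l)) \<le> 0"
      by (intro tendsto_lowerbound[of "\<lambda>N. exp (y \<bullet> \<mu>) * inverse (real (Suc N))" 0 sequentially]) auto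
    then show False using \<mu>(1) by simp
  qed
  moreover have "countable (\<Union>N. A N)" using A(1) by (intro countable_UN) (auto intro: countable_finite)
  ultimately show ?thesis by (rule countable_subset)
qed

section \<open>Bochner-Fejer approximation\<close>

text \<open>The weight \<open>n - \<bar>k\<bar>\<close> counts the pairs \<open>a, b < n\<close>
  with difference \<open>k\<close>. In the induction step the pairs containing the new largest index
  are added, exactly one for each \<open>k\<close> from \<open>- n\<close> to
  \<open>n\<close>.\<close>

lemma fejer_sum:
  fixes g :: "int \<Rightarrow> complex"
  shows "(\<Sum>k\<in>{- int n..int n}. complex_of_real (real n - real_of_int \<bar>k\<bar>) * g k) =
    (\<Sum>a<n. \<Sum>b<n. g (int a - int b))"
proof (induction n)
  case (Suc n)
  have "(\<Sum>k\<in>{- int (Suc n)..int (Suc n)}. complex_of_real (real (Suc n) - real_of_int \<bar>k\<bar>) * g k) =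
      (\<Sum>k\<in>{- int n..int n}. complex_of_real (real (Suc n) - real_of_int \<bar>k\<bar>) * g k)"
  proof (rule sum.mono_neutral_right)
    show "\<forall>k\<in>{- int (Suc n)..int (Suc n)} - {- int n..int n}. complex_of_real (real (Suc n) -
        real_of_int \<bar>k\<bar>) * g k = 0"
    proof
      fix k assume "k \<in> {- int (Suc n)..int (Suc n)} - {- int n..int n}"
      then have "\<bar>k\<bar> = int (Suc n)" by auto
      then show "complex_of_real (real (Suc n) - real_of_int \<bar>k\<bar>) * g k = 0" by simp
    qed
  qed auto
  also have "\<dots> = (\<Sum>k\<in>{- int n..int n}. complex_of_real (real n - real_of_int \<bar>k\<bar>) * g k) + (\<Sum>k\<in>{-
      int n..int n}. g k)"
    unfolding sum.distrib[symmetric] by (rule sum.cong) (auto simp: algebra_simps)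
  also have "(\<Sum>k\<in>{- int n..int n}. g k) = (\<Sum>k\<in>{- int n..0}. g k) + (\<Sum>k\<in>{1..int n}. g k)"
    by (subst sum.union_disjoint[symmetric]) (auto intro: sum.cong)
  also have "(\<Sum>k\<in>{- int n..0}. g k) = (\<Sum>a<Suc n. g (int a - int n))"
    by (rule sum.reindex_bij_witness[of _ "\<lambda>a. int a - int n" "\<lambda>k. nat (k + int n)"]) auto
  also have "(\<Sum>k\<in>{1..int n}. g k) = (\<Sum>b<n. g (int n - int b))"
    by (rule sum.reindex_bij_witness[of _ "\<lambda>b. int n - int b" "\<lambda>k. nat (int n - k)"]) auto
  finally show ?case unfolding Suc.IH by (simp add: sum.distrib)
qed simp

text \<open>Up to the factor \<open>n\<close>, the kernel is the squared modulus of the geometric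
  sum \<open>?s\<close>.\<close>

lemma fejer_kernel_nonneg:
  assumes "n > 0"
  shows "\<exists>\<kappa>\<ge>0. (\<Sum>k\<in>{- int n..int n}. complex_of_real (1 - real_of_int \<bar>k\<bar> / real n) * cis (of_int
      k * \<theta>)) = complex_of_real \<kappa>"
proof -
  let ?s = "\<Sum>a<n. cis (of_nat a * \<theta>)"
  have "complex_of_real (real n) * (\<Sum>k\<in>{- int n..int n}. complex_of_real (1 - real_of_int \<bar>k\<bar> /
      real n) * cis (of_int k * \<theta>)) =
     (\<Sum>k\<in>{- int n..int n}. complex_of_real (real n - real_of_int \<bar>k\<bar>) * cis (of_int k * \<theta>))"
    unfolding sum_distrib_left
  proof (rule sum.cong[OF refl])
    fix k
    have "real n * (1 - real_of_int \<bar>k\<bar> / real n) = real n - real_of_int \<bar>k\<bar>" using assms by (simp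
        add: field_simps)
    then show "complex_of_real (real n) * (complex_of_real (1 - real_of_int \<bar>k\<bar> / real n) * cis
        (of_int k * \<theta>)) =
        complex_of_real (real n - real_of_int \<bar>k\<bar>) * cis (of_int k * \<theta>)"
      by (metis mult.assoc of_real_mult)
  qed
  also have "\<dots> = (\<Sum>a<n. \<Sum>b<n. cis (of_int (int a - int b) * \<theta>))" by (rule fejer_sum)
  also have "\<dots> = ?s * cnj ?s"
    by (simp add: sum_product cis_cnj cis_mult left_diff_distrib)
  also have "\<dots> = complex_of_real ((cmod ?s)\<^sup>2)" by (rule complex_norm_square[symmetric])
  finally have "(\<Sum>k\<in>{- int n..int n}. complex_of_real (1 - real_of_int \<bar>k\<bar> / real n) * cis (of_int
      k * \<theta>)) =
      complex_of_real ((cmod ?s)\<^sup>2 / real n)"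
    using assms by (simp add: field_simps)
  then show ?thesis by (intro exI[of _ "(cmod ?s)\<^sup>2 / real n"]) simp
qed

lemma herm_rvec_sum: "herm z (rvec (\<Sum>r\<in>I. c r *\<^sub>R u r)) = (\<Sum>r\<in>I. complex_of_real (c r) * herm z
    (rvec (u r)))"
  unfolding herm_def rvec_def
  by (simp add: sum_distrib_left sum_distrib_right) (subst sum.swap, simp add: mult_ac)

section \<open>Bochner-Fejer sums and their kernel\<close>

definition bf_index :: "enat \<Rightarrow> nat \<Rightarrow> nat set" where
  "bf_index d j = {r \<in> {1..j}. enat r \<le> d}"

definition bf_exponents :: "enat \<Rightarrow> nat \<Rightarrow> (nat \<Rightarrow> int) set" where
  "bf_exponents d j = bf_index d j \<rightarrow>\<^sub>E {\<nu>::int. \<bar>\<nu>\<bar> \<le> (fact j)\<^sup>2}"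

definition bf_weight :: "enat \<Rightarrow> nat \<Rightarrow> (nat \<Rightarrow> int) \<Rightarrow> real" where
  "bf_weight d j \<nu> = (\<Prod>r\<in>bf_index d j. 1 - real_of_int \<bar>\<nu> r\<bar> / (fact j)\<^sup>2)"

definition bf_freq :: "(nat \<Rightarrow> real ^ 'n) \<Rightarrow> enat \<Rightarrow> nat \<Rightarrow> (nat \<Rightarrow> int) \<Rightarrow> real ^ 'n" where
  "bf_freq \<omega> d j \<nu> = (\<Sum>r\<in>bf_index d j. of_int (\<nu> r) *\<^sub>R (\<omega> r /\<^sub>R fact j))"

lemma finite_bf_index: "finite (bf_index d j)"
  by (simp add: bf_index_def)

lemma bf_range: "{\<nu>::int. \<bar>\<nu>\<bar> \<le> (fact j)\<^sup>2} = {- int ((fact j)\<^sup>2)..int ((fact j)\<^sup>2)}"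
  by (auto simp: abs_le_iff minus_le_iff)

lemma finite_bf_exponents: "finite (bf_exponents d j)"
  unfolding bf_exponents_def bf_range by (intro finite_PiE finite_bf_index) simp

lemma bochner_fejer_eq:
  "bochner_fejer \<Omega> \<omega> d j f z = (\<Sum>\<nu>\<in>bf_exponents d j. complex_of_real (bf_weight d j \<nu>) *
     fourier_coeff \<Omega> (bf_freq \<omega> d j \<nu>) f * exp (\<i> * herm z (rvec (bf_freq \<omega> d j \<nu>))))"
  unfolding bochner_fejer_def Let_def bf_index_def[symmetric] bf_exponents_def[symmetric]
    bf_weight_def bf_freq_def herm_rvec_sum by simp

text \<open>The sum over tuples of exponents factors into one-dimensional Fejer kernels, one for
  each basis vector. The frequencies carry the sign in which waves occur in
  \<open>HAP_mean_translated_wave\<close>.\<close>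

lemma bf_kernel_nonneg:
  "\<exists>\<kappa>\<ge>0. (\<Sum>\<nu>\<in>bf_exponents d j. complex_of_real (bf_weight d j \<nu>) * cis (t \<bullet> (- bf_freq \<omega> d j \<nu>)))
      = complex_of_real \<kappa>"
proof -
  let ?n = "(fact j)\<^sup>2 :: nat"
  let ?\<theta> = "\<lambda>r. - (t \<bullet> (\<omega> r /\<^sub>R fact j))"
  have "t \<bullet> (- bf_freq \<omega> d j \<nu>) = (\<Sum>r\<in>bf_index d j. of_int (\<nu> r) * ?\<theta> r)" for \<nu>
    by (simp add: bf_freq_def inner_sum_right sum_negf mult.assoc)
  then have "complex_of_real (bf_weight d j \<nu>) * cis (t \<bullet> (- bf_freq \<omega> d j \<nu>)) =
      (\<Prod>r\<in>bf_index d j. complex_of_real (1 - real_of_int \<bar>\<nu> r\<bar> / real ?n) * cis (of_int (\<nu> r) * ?\<theta>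
          r))" for \<nu>
    by (simp add: bf_weight_def prod.distrib cis_conv_exp exp_sum[OF finite_bf_index, symmetric]
        sum_distrib_left)
  then have e: "(\<Sum>\<nu>\<in>bf_exponents d j. complex_of_real (bf_weight d j \<nu>) * cis (t \<bullet> (- bf_freq \<omega> d
      j \<nu>))) =
      (\<Prod>r\<in>bf_index d j. \<Sum>k\<in>{- int ?n..int ?n}. complex_of_real (1 - real_of_int \<bar>k\<bar> / real ?n) *
          cis (of_int k * ?\<theta> r))"
    unfolding bf_exponents_def bf_range by (subst prod_sum_PiE) (auto simp: finite_bf_index)
  have n: "?n > 0" by simp
  have "\<forall>r. \<exists>\<kappa>\<ge>0. (\<Sum>k\<in>{- int ?n..int ?n}. complex_of_real (1 - real_of_int \<bar>k\<bar> / real ?n) * cis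
      (of_int k * ?\<theta> r)) = complex_of_real \<kappa>"
    by (rule allI) (rule fejer_kernel_nonneg[OF n])
  from choice[OF this] obtain \<kappa> where \<kappa>': "\<forall>r. \<kappa> r \<ge> 0 \<and> (\<Sum>k\<in>{- int ?n..int ?n}. complex_of_real
      (1 - real_of_int \<bar>k\<bar> / real ?n) * cis (of_int k * ?\<theta> r)) = complex_of_real (\<kappa> r)"
    by (elim exE) (rule that)
  have \<kappa>: "\<kappa> r \<ge> 0" "(\<Sum>k\<in>{- int ?n..int ?n}. complex_of_real (1 - real_of_int \<bar>k\<bar> / real ?n) * cis
      (of_int k * ?\<theta> r)) = complex_of_real (\<kappa> r)" for r
    by (rule conjunct1[OF spec[OF \<kappa>']], rule conjunct2[OF spec[OF \<kappa>']])
  show ?thesis unfolding e \<kappa>(2) by (intro exI[of _ "\<Prod>r\<in>bf_index d j. \<kappa> r"]) (simp add: prod_nonneg \<kappa>(1))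
qed

lemma rat_basis_coefficients_zero:
  assumes "is_rat_basis \<omega> d V" "finite I" "I \<subseteq> {r. 1 \<le> r \<and> enat r \<le> d}"
    and "(\<Sum>r\<in>I. (of_rat (q r) :: real) *\<^sub>R \<omega> r) = 0" "r \<in> I"
  shows "q r = 0"
proof -
  have inj: "inj_on \<omega> I" using assms(1,3) unfolding is_rat_basis_def by (meson inj_on_subset)
  have ind: "ratvec.independent (\<omega> ` {r. 1 \<le> r \<and> enat r \<le> d})" using assms(1) unfolding
      is_rat_basis_def by blast
  define u where "u = (\<lambda>v. q (the_inv_into I \<omega> v))"
  have u: "u (\<omega> r) = q r" if "r \<in> I" for r using the_inv_into_f_f[OF inj that] by (simp add: u_def)
  have "(\<Sum>v\<in>\<omega> ` I. (of_rat (u v) :: real) *\<^sub>R v) = 0"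
    using assms(4) by (subst sum.reindex[OF inj]) (simp add: u)
  then have "u (\<omega> r) = 0"
    by (intro ratvec.independentD[OF ind]) (use assms in auto)
  then show ?thesis using u[OF assms(5)] by simp
qed

lemma of_rat_fact: "(of_rat (fact j) :: real) = fact j"
  using of_rat_of_nat_eq[of "fact j"] by simp

text \<open>Equality of two frequencies is a linear relation between basis vectors whose
  coefficients, the differences of the exponents divided by j!, are rational.\<close>

lemma bf_freq_inj:
  assumes "is_rat_basis \<omega> d V" "\<nu> \<in> bf_exponents d j" "\<nu>' \<in> bf_exponents d j"
    and "bf_freq \<omega> d j \<nu> = bf_freq \<omega> d j \<nu>'"
  shows "\<nu> = \<nu>'"
proof (rule PiE_ext)
  show "\<nu> \<in> bf_index d j \<rightarrow>\<^sub>E {\<nu>::int. \<bar>\<nu>\<bar> \<le> (fact j)\<^sup>2}" "\<nu>' \<in> bf_index d j \<rightarrow>\<^sub>E {\<nu>::int. \<bar>\<nu>\<bar> \<le>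
      (fact j)\<^sup>2}"
    using assms(2,3) by (simp_all add: bf_exponents_def)
  fix r assume r: "r \<in> bf_index d j"
  let ?q = "\<lambda>r. (of_int (\<nu> r - \<nu>' r) / fact j :: rat)"
  have "(\<Sum>r\<in>bf_index d j. (of_rat (?q r) :: real) *\<^sub>R \<omega> r) = bf_freq \<omega> d j \<nu> - bf_freq \<omega> d j \<nu>'"
  proof -
    have "(of_rat (?q r) :: real) = (of_int (\<nu> r) - of_int (\<nu>' r)) / fact j" for r
      by (simp only: of_rat_divide of_rat_fact of_rat_diff of_rat_of_int_eq of_int_diff)
    then have "(of_rat (?q r) :: real) *\<^sub>R \<omega> r = of_int (\<nu> r) *\<^sub>R (\<omega> r /\<^sub>R fact j) - of_int (\<nu>' r)
        *\<^sub>R (\<omega> r /\<^sub>R fact j)" for r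
      by (simp only: divide_inverse left_diff_distrib scaleR_left_diff_distrib scaleR_scaleR)
    then show ?thesis by (simp only: bf_freq_def sum_subtractf)
  qed
  then have "?q r = 0"
    by (intro rat_basis_coefficients_zero[OF assms(1) finite_bf_index[of d j] _ _ r])
      (use assms(4) in \<open>auto simp: bf_index_def\<close>)
  then show "\<nu> r = \<nu>' r" by simp
qed

text \<open>Only the frequency 0 contributes to the mean. By rational independence it belongs to the
  zero exponent alone, and that has weight 1.\<close>

lemma bf_kernel_mean:
  assumes "is_rat_basis \<omega> d V"
  shows "mean (\<lambda>t. \<Sum>\<nu>\<in>bf_exponents d j. complex_of_real (bf_weight d j \<nu>) * cis (t \<bullet> (- bf_freq \<omega>
      d j \<nu>))) = 1"
proof -
  define \<nu>0 where "\<nu>0 = (\<lambda>r\<in>bf_index d j. 0::int)"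
  have \<nu>0: "\<nu>0 \<in> bf_exponents d j" "bf_freq \<omega> d j \<nu>0 = 0" "bf_weight d j \<nu>0 = 1"
    by (auto simp: \<nu>0_def bf_exponents_def bf_freq_def bf_weight_def)
  have "mean (\<lambda>t. \<Sum>\<nu>\<in>bf_exponents d j. complex_of_real (bf_weight d j \<nu>) * cis (t \<bullet> (- bf_freq \<omega> d
      j \<nu>))) =
      (\<Sum>\<nu>\<in>bf_exponents d j. complex_of_real (bf_weight d j \<nu>) * (if - bf_freq \<omega> d j \<nu> = 0 then 1
          else 0))"
    by (simp only: mean_sum[OF ap_cmult[OF ap_wave]] mean_cmult[OF ap_wave] mean_wave)
  also have "\<dots> = (\<Sum>\<nu>\<in>bf_exponents d j. if \<nu> = \<nu>0 then 1 else 0)"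
  proof (rule sum.cong[OF refl])
    fix \<nu> assume \<nu>: "\<nu> \<in> bf_exponents d j"
    have "bf_freq \<omega> d j \<nu> = 0 \<longleftrightarrow> \<nu> = \<nu>0"
      using bf_freq_inj[OF assms \<nu> \<nu>0(1)] \<nu>0(2) by auto
    then show "complex_of_real (bf_weight d j \<nu>) * (if - bf_freq \<omega> d j \<nu> = 0 then 1 else 0) = (if
        \<nu> = \<nu>0 then 1 else 0)"
      using \<nu>0(3) by simp
  qed
  also have "\<dots> = 1" using \<nu>0(1) finite_bf_exponents by simp
  finally show ?thesis .
qed

text \<open>The sum is the mean of \<open>g\<close> against a nonnegative kernel of mean 1, and such
  an average cannot exceed the supremum of \<open>g\<close>. The bound does not depend on
  \<open>j\<close>, which is what the convergence proof exploits.\<close>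

lemma bf_contraction:
  fixes g :: "real ^ 'n \<Rightarrow> complex"
  assumes "is_rat_basis \<omega> d V" "ap g" "\<And>t. cmod (g t) \<le> \<epsilon>"
  shows "cmod (\<Sum>\<nu>\<in>bf_exponents d j. complex_of_real (bf_weight d j \<nu>) * mean (\<lambda>t. cis (t \<bullet> (-
      bf_freq \<omega> d j \<nu>)) * g t)) \<le> \<epsilon>"
proof -
  let ?w = "\<lambda>\<nu> t. complex_of_real (bf_weight d j \<nu>) * cis (t \<bullet> (- bf_freq \<omega> d j \<nu>))"
  have "\<forall>t. \<exists>\<kappa>\<ge>0. (\<Sum>\<nu>\<in>bf_exponents d j. ?w \<nu> t) = complex_of_real \<kappa>"
    by (rule allI) (rule bf_kernel_nonneg)
  from choice[OF this] obtain \<kappa> where \<kappa>': "\<forall>t. \<kappa> t \<ge> 0 \<and> (\<Sum>\<nu>\<in>bf_exponents d j. ?w \<nu> t) =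
      complex_of_real (\<kappa> t)"
    by (elim exE) (rule that)
  have \<kappa>: "\<kappa> t \<ge> 0" "(\<Sum>\<nu>\<in>bf_exponents d j. ?w \<nu> t) = complex_of_real (\<kappa> t)" for t
    by (rule conjunct1[OF spec[OF \<kappa>']], rule conjunct2[OF spec[OF \<kappa>']])
  have ap\<kappa>: "ap (\<lambda>t. complex_of_real (\<kappa> t))"
    unfolding \<kappa>(2)[symmetric] by (intro ap_sum ap_cmult ap_wave)
  have mean\<kappa>: "mean (\<lambda>t. complex_of_real (\<kappa> t)) = 1"
    unfolding \<kappa>(2)[symmetric] by (rule bf_kernel_mean[OF assms(1)])
  have *: "ap (\<lambda>t. cis (t \<bullet> \<mu>) * g t)" for \<mu> by (intro ap_mult ap_wave assms(2))
  have "(\<Sum>\<nu>\<in>bf_exponents d j. complex_of_real (bf_weight d j \<nu>) * mean (\<lambda>t. cis (t \<bullet> (- bf_freq \<omega>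
      d j \<nu>)) * g t)) =
      mean (\<lambda>t. \<Sum>\<nu>\<in>bf_exponents d j. complex_of_real (bf_weight d j \<nu>) * (cis (t \<bullet> (- bf_freq \<omega> d
          j \<nu>)) * g t))"
    by (simp only: mean_sum[OF ap_cmult[OF *]] mean_cmult[OF *])
  also have "\<dots> = mean (\<lambda>t. complex_of_real (\<kappa> t) * g t)"
    unfolding \<kappa>(2)[symmetric] by (simp only: sum_distrib_right mult.assoc)
  also have "cmod \<dots> \<le> Re (mean (\<lambda>t. complex_of_real (\<epsilon> * \<kappa> t)))"
  proof (rule mean_le)
    show "ap (\<lambda>t. complex_of_real (\<kappa> t) * g t)" by (intro ap_mult ap\<kappa> assms(2))
    show "ap (\<lambda>t. complex_of_real (\<epsilon> * \<kappa> t))" unfolding of_real_mult by (rule ap_cmult[OF ap\<kappa>])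
    show "cmod (complex_of_real (\<kappa> t) * g t) \<le> \<epsilon> * \<kappa> t" for t
      using mult_left_mono[OF assms(3)[of t] \<kappa>(1)[of t]] \<kappa>(1)[of t] by (simp add: norm_mult mult.commute)
  qed
  also have "\<dots> = \<epsilon>" unfolding of_real_mult mean_cmult[OF ap\<kappa>] mean\<kappa> by simp
  finally show ?thesis .
qed

lemma rat_basis_representation:
  assumes "is_rat_basis \<omega> d V" "\<mu> \<in> V"
  obtains R q where "finite R" "R \<subseteq> {r. 1 \<le> r \<and> enat r \<le> d}" "\<mu> = (\<Sum>r\<in>R. (of_rat (q r) :: real) *\<^sub>R \<omega> r)"
proof -
  have inj: "inj_on \<omega> {r. 1 \<le> r \<and> enat r \<le> d}" using assms(1) unfolding is_rat_basis_def by blast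
  have "\<mu> \<in> ratvec.span (\<omega> ` {r. 1 \<le> r \<and> enat r \<le> d})" using assms unfolding is_rat_basis_def by blast
  then obtain t u where t: "finite t" "t \<subseteq> \<omega> ` {r. 1 \<le> r \<and> enat r \<le> d}" "\<mu> = (\<Sum>v\<in>t. (of_rat (u v)
      :: real) *\<^sub>R v)"
    unfolding ratvec.span_explicit by blast
  obtain R where R: "R \<subseteq> {r. 1 \<le> r \<and> enat r \<le> d}" "t = \<omega> ` R" using t(2) by (elim subset_imageE)
      (rule that)
  have "inj_on \<omega> R" using inj R(1) by (rule inj_on_subset)
  then have "finite R" using t(1) R(2) finite_image_iff by blast
  moreover have "\<mu> = (\<Sum>r\<in>R. (of_rat (u (\<omega> r)) :: real) *\<^sub>R \<omega> r)"
    unfolding t(3) R(2) by (subst sum.reindex[OF \<open>inj_on \<omega> R\<close>]) simp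
  ultimately show thesis using R(1) that[of R "\<lambda>r. u (\<omega> r)"] by blast
qed

lemma fact_tendsto_infinity: "filterlim (\<lambda>j. fact j :: real) at_top sequentially"
proof (rule filterlim_at_top_mono[OF filterlim_real_sequentially])
  have "real j \<le> fact j" for j using fact_ge_self[of j] by (metis of_nat_fact of_nat_le_iff)
  then show "\<forall>\<^sub>F j in sequentially. real j \<le> fact j" by simp
qed

text \<open>As soon as j! is divisible by all denominators of the coordinates \<open>q r\<close> of
  \<open>\<mu>\<close>, and the numerators are at most j!, \<open>\<mu>\<close> is the frequency of
  exactly one exponent tuple. Its entries are \<open>q r\<close> times j!, so its weight is the
  product of the factors \<open>1 - \<bar>q r\<bar> / j!\<close>. This is the purpose of the mesh
  1/j! and of the range up to the square of j! in the definition.\<close>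

lemma bf_multiplier_tendsto:
  fixes \<omega> :: "nat \<Rightarrow> real ^ 'n"
  assumes "is_rat_basis \<omega> d V" "\<mu> \<in> V"
  shows "(\<lambda>j. \<Sum>\<nu>\<in>{\<nu>\<in>bf_exponents d j. bf_freq \<omega> d j \<nu> = \<mu>}. bf_weight d j \<nu>) \<longlonglongrightarrow> 1"
proof -
  obtain R q where R: "finite R" "R \<subseteq> {r. 1 \<le> r \<and> enat r \<le> d}" "\<mu> = (\<Sum>r\<in>R. (of_rat (q r) :: real)
      *\<^sub>R \<omega> r)"
    by (rule rat_basis_representation[OF assms])
  define num den where "num = (\<lambda>r. fst (quotient_of (q r)))" and "den = (\<lambda>r. snd (quotient_of (q r)))"
  have den: "den r > 0" for r using quotient_of_denom_pos' by (simp add: den_def)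
  have qnd: "q r = of_int (num r) / of_int (den r)" for r
    by (metis num_def den_def quotient_of_div prod.collapse)
  \<comment> \<open>From stage \<open>J\<close> on, all indices, denominators and numerators that
    occur are covered. The inserted 0 keeps the maximum meaningful when \<open>R\<close> is
    empty.\<close>
  define J where "J = Max (insert 0 (R \<union> (\<lambda>r. nat (den r)) ` R \<union> (\<lambda>r. nat \<bar>num r\<bar>) ` R))"
  have J: "r \<le> J" "den r \<le> int J" "\<bar>num r\<bar> \<le> int J" if "r \<in> R" for r
  proof -
    let ?S = "insert 0 (R \<union> (\<lambda>r. nat (den r)) ` R \<union> (\<lambda>r. nat \<bar>num r\<bar>) ` R)"
    have "finite ?S" using R(1) by simp
    then have "r \<le> J" "nat (den r) \<le> J" "nat \<bar>num r\<bar> \<le> J" unfolding J_def using that by (auto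
        intro!: Max_ge)
    then show "r \<le> J" "den r \<le> int J" "\<bar>num r\<bar> \<le> int J" by linarith+
  qed
  have eq: "(\<Sum>\<nu>\<in>{\<nu>\<in>bf_exponents d j. bf_freq \<omega> d j \<nu> = \<mu>}. bf_weight d j \<nu>) =
      (\<Prod>r\<in>R. 1 - \<bar>of_rat (q r)\<bar> / fact j)" if j: "j \<ge> J" for j
  proof -
    have RI: "R \<subseteq> bf_index d j" using R(2) J(1) j by (force simp: bf_index_def)
    \<comment> \<open>These are the coordinates of \<open>\<mu>\<close> times j!, written so that
      they are integers by construction; the division is exact because \<open>den r\<close> divides
      j!.\<close>
    define k where "k = (\<lambda>r. num r * (fact j div den r))"
    have ddvd: "den r dvd fact j" if "r \<in> R" for r
    proof -
      have "nat (den r) dvd (fact j :: nat)" using den[of r] J(2)[OF that] j by (intro dvd_fact) auto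
      then have "int (nat (den r)) dvd int (fact j)" by (simp only: of_nat_dvd_iff)
      then show ?thesis using den[of r] by simp
    qed
    have kq: "real_of_int (k r) = of_rat (q r) * fact j" if "r \<in> R" for r
    proof -
      have "real_of_int (fact j div den r) = fact j / real_of_int (den r)"
        using real_of_int_div[OF ddvd[OF that]] by simp
      then show ?thesis unfolding k_def qnd by (simp add: of_rat_divide)
    qed
    have kb: "\<bar>k r\<bar> \<le> (fact j)\<^sup>2" if "r \<in> R" for r
    proof -
      have "\<bar>k r\<bar> = \<bar>num r\<bar> * (fact j div den r)"
        using den[of r] by (simp add: k_def abs_mult pos_imp_zdiv_nonneg_iff)
      also have "\<dots> \<le> fact j * fact j"
      proof (rule mult_mono)
        have "int j \<le> int (fact j)" using fact_ge_self[of j] by (simp only: of_nat_le_iff)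
        then show "\<bar>num r\<bar> \<le> fact j" using J(3)[OF that] j by simp
        have "(fact j :: int) div den r \<le> fact j div 1"
          by (rule zdiv_mono2) (use den[of r] in auto)
        then show "(fact j :: int) div den r \<le> fact j" by simp
        show "0 \<le> (fact j :: int) div den r" using den[of r] by (simp add: pos_imp_zdiv_nonneg_iff)
      qed simp
      finally show ?thesis by (simp add: power2_eq_square)
    qed
    define \<nu>1 where "\<nu>1 = (\<lambda>r\<in>bf_index d j. if r \<in> R then k r else 0)"
    have \<nu>1: "\<nu>1 \<in> bf_exponents d j"
      using kb by (auto simp: \<nu>1_def bf_exponents_def)
    have "bf_freq \<omega> d j \<nu>1 = (\<Sum>r\<in>R. of_int (k r) *\<^sub>R (\<omega> r /\<^sub>R fact j))"
      unfolding bf_freq_def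
      by (rule sum.mono_neutral_cong_right) (use RI finite_bf_index in \<open>auto simp: \<nu>1_def\<close>)
    also have "\<dots> = \<mu>" unfolding R(3) by (rule sum.cong) (simp_all add: kq)
    finally have fr: "bf_freq \<omega> d j \<nu>1 = \<mu>" .
    have "{\<nu>\<in>bf_exponents d j. bf_freq \<omega> d j \<nu> = \<mu>} = {\<nu>1}"
    proof (intro equalityI subsetI)
      fix \<nu> assume "\<nu> \<in> {\<nu>\<in>bf_exponents d j. bf_freq \<omega> d j \<nu> = \<mu>}"
      then have "\<nu> \<in> bf_exponents d j" "bf_freq \<omega> d j \<nu> = bf_freq \<omega> d j \<nu>1" by (simp_all only: fr
          mem_Collect_eq)
      then have "\<nu> = \<nu>1" using bf_freq_inj[OF assms(1) _ \<nu>1] by blast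
      then show "\<nu> \<in> {\<nu>1}" by simp
    next
      fix \<nu> assume "\<nu> \<in> {\<nu>1}"
      then show "\<nu> \<in> {\<nu>\<in>bf_exponents d j. bf_freq \<omega> d j \<nu> = \<mu>}" using \<nu>1 fr by (simp only:
          singleton_iff mem_Collect_eq)
    qed
    then have "(\<Sum>\<nu>\<in>{\<nu>\<in>bf_exponents d j. bf_freq \<omega> d j \<nu> = \<mu>}. bf_weight d j \<nu>) = bf_weight d j \<nu>1"
        by simp
    also have "\<dots> = (\<Prod>r\<in>R. 1 - real_of_int \<bar>k r\<bar> / (fact j)\<^sup>2)"
      unfolding bf_weight_def
      by (rule prod.mono_neutral_cong_right) (use RI finite_bf_index in \<open>auto simp: \<nu>1_def\<close>)
    also have "\<dots> = (\<Prod>r\<in>R. 1 - \<bar>of_rat (q r)\<bar> / fact j)"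
      by (rule prod.cong) (simp_all add: kq abs_mult power2_eq_square)
    finally show ?thesis .
  qed
  have "(\<lambda>j. \<Prod>r\<in>R. 1 - \<bar>of_rat (q r)\<bar> / fact j :: real) \<longlonglongrightarrow> (\<Prod>r\<in>R. 1 - 0)"
    by (intro tendsto_intros tendsto_divide_0[OF tendsto_const] filterlim_at_top_imp_at_infinity
        fact_tendsto_infinity)
  then have "(\<lambda>j. \<Prod>r\<in>R. 1 - \<bar>of_rat (q r)\<bar> / fact j :: real) \<longlonglongrightarrow> 1" by simp
  moreover have "\<forall>\<^sub>F j in sequentially. (\<Prod>r\<in>R. 1 - \<bar>of_rat (q r)\<bar> / fact j) =
      (\<Sum>\<nu>\<in>{\<nu>\<in>bf_exponents d j. bf_freq \<omega> d j \<nu> = \<mu>}. bf_weight d j \<nu>)"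
    using eventually_ge_at_top[of J] by eventually_elim (simp only: eq)
  ultimately show ?thesis by (rule Lim_transform_eventually)
qed

text \<open>On a finite exponential sum the Bochner-Fejer operator multiplies each coefficient by a
  number tending to 1, and by contraction the error of approximating \<open>F\<close> by such a sum
  is not enlarged. The basis need only span a set containing the spectrum, so it may belong to a
  different mapping; below, a basis for \<open>F\<close> is applied to \<open>G\<close>.\<close>

lemma bochner_fejer_converges:
  fixes F :: "complex ^ 'n \<Rightarrow> complex ^ 'm"
  assumes F: "F \<in> HAP \<Omega>" and \<Omega>: "open \<Omega>" "convex \<Omega>" and K: "compact K" "K \<subseteq> \<Omega>" and e: "\<epsilon> > 0"
    and basis: "is_rat_basis \<omega> d V" and V: "spectrum \<Omega> (\<lambda>z. F z $ l) \<subseteq> V"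
  shows "\<forall>\<^sub>F j in sequentially. \<forall>x. \<forall>y\<in>K.
    cmod (bochner_fejer \<Omega> \<omega> d j (\<lambda>z. F z $ l) (cplx x y) - F (cplx x y) $ l) \<le> \<epsilon>"
proof -
  obtain A b where A: "finite A" "A \<subseteq> spectrum \<Omega> (\<lambda>z. F z $ l)"
    "\<And>x y. y \<in> K \<Longrightarrow> cmod (F (cplx x y) $ l - (\<Sum>\<mu>\<in>A. b \<mu> * exp (\<i> * herm (cplx x y) (rvec \<mu>)))) \<le> \<epsilon>/3"
    by (rule HAP_approximation[OF F \<Omega> K, of "\<epsilon>/3" l]) (use e in simp, rule that)
  define mlt where "mlt = (\<lambda>j \<mu>. \<Sum>\<nu>\<in>{\<nu>\<in>bf_exponents d j. bf_freq \<omega> d j \<nu> = \<mu>}. bf_weight d j \<nu>)"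
  have mlt: "(\<lambda>j. mlt j \<mu>) \<longlonglongrightarrow> 1" if "\<mu> \<in> A" for \<mu>
    unfolding mlt_def using that A(2) V by (intro bf_multiplier_tendsto[OF basis]) blast
  have "\<forall>\<mu>. \<exists>E. \<forall>y\<in>K. exp (- (y \<bullet> \<mu>)) \<le> E"
  proof
    fix \<mu>
    have "bounded ((\<lambda>y. exp (- (y \<bullet> \<mu>))) ` K)"
      by (intro compact_imp_bounded compact_continuous_image K continuous_intros)
    then obtain E where "\<forall>e\<in>(\<lambda>y. exp (- (y \<bullet> \<mu>))) ` K. norm e \<le> E" unfolding bounded_iff by (elim
        exE) (rule that)
    then show "\<exists>E. \<forall>y\<in>K. exp (- (y \<bullet> \<mu>)) \<le> E" by (intro exI[of _ E]) simp
  qed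
  from choice[OF this] obtain E where E: "\<forall>\<mu>. \<forall>y\<in>K. exp (- (y \<bullet> \<mu>)) \<le> E \<mu>" by (elim exE) (rule that)
  have "(\<lambda>j. \<Sum>\<mu>\<in>A. \<bar>mlt j \<mu> - 1\<bar> * (cmod (b \<mu>) * E \<mu>)) \<longlonglongrightarrow> (\<Sum>\<mu>\<in>A. \<bar>1 - 1\<bar> * (cmod (b \<mu>) * E \<mu>))"
    by (intro tendsto_intros mlt)
  then have "(\<lambda>j. \<Sum>\<mu>\<in>A. \<bar>mlt j \<mu> - 1\<bar> * (cmod (b \<mu>) * E \<mu>)) \<longlonglongrightarrow> 0" by simp
  then have "\<forall>\<^sub>F j in sequentially. (\<Sum>\<mu>\<in>A. \<bar>mlt j \<mu> - 1\<bar> * (cmod (b \<mu>) * E \<mu>)) < \<epsilon>/3"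
    by (rule order_tendstoD(2)) (use e in simp)
  then show ?thesis
  proof eventually_elim
    case (elim j)
    show ?case
    proof (intro allI ballI)
      fix x y assume y: "y \<in> K"
      then have y\<Omega>: "y \<in> \<Omega>" using K by blast
      let ?e = "\<lambda>\<mu>. exp (\<i> * herm (cplx x y) (rvec \<mu>))"
      let ?f = "\<lambda>t. F (cplx (x + t) y) $ l"
      let ?P = "\<lambda>t. \<Sum>\<mu>\<in>A. b \<mu> * exp (\<i> * herm (cplx (x + t) y) (rvec \<mu>))"
      have P: "?P = (\<lambda>t. \<Sum>\<mu>\<in>A. (b \<mu> * ?e \<mu>) * cis (t \<bullet> \<mu>))"
        by (simp add: exp_herm inner_add_left flip: cis_mult) (simp add: mult_ac)
      have f: "ap ?f" using ap_translate[OF HAP_slice_ap[OF F y\<Omega>], of x] by (simp add: add.commute)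
      have Pap: "ap ?P" unfolding P by (intro ap_sum ap_cmult ap_wave)
      have contr: "cmod (\<Sum>\<nu>\<in>bf_exponents d j. complex_of_real (bf_weight d j \<nu>) *
          mean (\<lambda>t. cis (t \<bullet> (- bf_freq \<omega> d j \<nu>)) * (?f t - ?P t))) \<le> \<epsilon>/3"
        by (rule bf_contraction[OF basis ap_diff[OF f Pap] A(3)[OF y]])
      have Pmean: "mean (\<lambda>t. cis (t \<bullet> (- \<rho>)) * ?P t) = (\<Sum>\<mu>\<in>A. if \<rho> = \<mu> then b \<mu> * ?e \<mu> else 0)" for \<rho>
      proof -
        have "mean (\<lambda>t. cis (t \<bullet> (- \<rho>)) * ?P t) = mean (\<lambda>t. \<Sum>\<mu>\<in>A. (b \<mu> * ?e \<mu>) * cis (t \<bullet> (\<mu> - \<rho>)))"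
        proof (rule arg_cong[of _ _ mean], rule ext)
          fix t
          have "cis (t \<bullet> (\<mu> - \<rho>)) = cis (t \<bullet> (- \<rho>)) * cis (t \<bullet> \<mu>)" for \<mu>
            by (simp add: cis_mult inner_diff_right)
          then show "cis (t \<bullet> (- \<rho>)) * ?P t = (\<Sum>\<mu>\<in>A. (b \<mu> * ?e \<mu>) * cis (t \<bullet> (\<mu> - \<rho>)))"
            unfolding fun_cong[OF P] sum_distrib_left by (simp only: mult_ac)
        qed
        also have "\<dots> = (\<Sum>\<mu>\<in>A. (b \<mu> * ?e \<mu>) * (if \<mu> - \<rho> = 0 then 1 else 0))"
          by (simp only: mean_sum[OF ap_cmult[OF ap_wave]] mean_cmult[OF ap_wave] mean_wave)
        also have "\<dots> = (\<Sum>\<mu>\<in>A. if \<rho> = \<mu> then b \<mu> * ?e \<mu> else 0)"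
          by (rule sum.cong) auto
        finally show ?thesis .
      qed
      have "(\<Sum>\<nu>\<in>bf_exponents d j. complex_of_real (bf_weight d j \<nu>) *
          mean (\<lambda>t. cis (t \<bullet> (- bf_freq \<omega> d j \<nu>)) * (?f t - ?P t))) =
        (\<Sum>\<nu>\<in>bf_exponents d j. complex_of_real (bf_weight d j \<nu>) *
          (fourier_coeff \<Omega> (bf_freq \<omega> d j \<nu>) (\<lambda>z. F z $ l) * ?e (bf_freq \<omega> d j \<nu>)) -
          complex_of_real (bf_weight d j \<nu>) * (\<Sum>\<mu>\<in>A. if bf_freq \<omega> d j \<nu> = \<mu> then b \<mu> * ?e \<mu> else 0))"
      proof (rule sum.cong[OF refl])
        fix \<nu>
        have "mean (\<lambda>t. cis (t \<bullet> (- bf_freq \<omega> d j \<nu>)) * (?f t - ?P t)) =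
          mean (\<lambda>t. cis (t \<bullet> (- bf_freq \<omega> d j \<nu>)) * ?f t) - mean (\<lambda>t. cis (t \<bullet> (- bf_freq \<omega> d j
              \<nu>)) * ?P t)"
          unfolding right_diff_distrib by (rule mean_diff) (intro ap_mult ap_wave f Pap)+
        then show "complex_of_real (bf_weight d j \<nu>) *
          mean (\<lambda>t. cis (t \<bullet> (- bf_freq \<omega> d j \<nu>)) * (?f t - ?P t)) = complex_of_real (bf_weight d j \<nu>) *
          (fourier_coeff \<Omega> (bf_freq \<omega> d j \<nu>) (\<lambda>z. F z $ l) * ?e (bf_freq \<omega> d j \<nu>)) -
          complex_of_real (bf_weight d j \<nu>) * (\<Sum>\<mu>\<in>A. if bf_freq \<omega> d j \<nu> = \<mu> then b \<mu> * ?e \<mu> else 0)"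
          by (simp only: HAP_mean_translated_wave[OF F \<Omega> y\<Omega>] Pmean right_diff_distrib)
      qed
      also have "\<dots> = bochner_fejer \<Omega> \<omega> d j (\<lambda>z. F z $ l) (cplx x y) -
          (\<Sum>\<nu>\<in>bf_exponents d j. \<Sum>\<mu>\<in>A. complex_of_real (bf_weight d j \<nu>) * (if bf_freq \<omega> d j \<nu> = \<mu>
              then b \<mu> * ?e \<mu> else 0))"
        unfolding bochner_fejer_eq by (simp only: sum_subtractf sum_distrib_left mult.assoc)
      also have "(\<Sum>\<nu>\<in>bf_exponents d j. \<Sum>\<mu>\<in>A. complex_of_real (bf_weight d j \<nu>) * (if bf_freq \<omega> d j
          \<nu> = \<mu> then b \<mu> * ?e \<mu> else 0)) =
          (\<Sum>\<mu>\<in>A. complex_of_real (mlt j \<mu>) * (b \<mu> * ?e \<mu>))"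
      proof (subst sum.swap, rule sum.cong[OF refl])
        fix \<mu>
        show "(\<Sum>\<nu>\<in>bf_exponents d j. complex_of_real (bf_weight d j \<nu>) * (if bf_freq \<omega> d j \<nu> = \<mu>
            then b \<mu> * ?e \<mu> else 0)) =
            complex_of_real (mlt j \<mu>) * (b \<mu> * ?e \<mu>)"
          unfolding mlt_def sum.inter_filter[OF finite_bf_exponents] of_real_sum sum_distrib_right
          by (rule sum.cong) simp_all
      qed
      finally have c1: "cmod (bochner_fejer \<Omega> \<omega> d j (\<lambda>z. F z $ l) (cplx x y) -
          (\<Sum>\<mu>\<in>A. complex_of_real (mlt j \<mu>) * (b \<mu> * ?e \<mu>))) \<le> \<epsilon>/3"
        using contr by simp
      have "(\<Sum>\<mu>\<in>A. complex_of_real (mlt j \<mu>) * (b \<mu> * ?e \<mu>)) - (\<Sum>\<mu>\<in>A. b \<mu> * ?e \<mu>) =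
          (\<Sum>\<mu>\<in>A. complex_of_real (mlt j \<mu> - 1) * (b \<mu> * ?e \<mu>))"
        by (simp add: sum_subtractf[symmetric] left_diff_distrib)
      also have "cmod \<dots> \<le> (\<Sum>\<mu>\<in>A. \<bar>mlt j \<mu> - 1\<bar> * (cmod (b \<mu>) * E \<mu>))"
      proof (rule order_trans[OF norm_sum], rule sum_mono)
        fix \<mu>
        have "cmod (?e \<mu>) \<le> E \<mu>" using E y by (simp add: exp_herm norm_mult)
        then have "\<bar>mlt j \<mu> - 1\<bar> * (cmod (b \<mu>) * cmod (?e \<mu>)) \<le> \<bar>mlt j \<mu> - 1\<bar> * (cmod (b \<mu>) * E \<mu>)"
          by (intro mult_left_mono) auto
        then show "cmod (complex_of_real (mlt j \<mu> - 1) * (b \<mu> * ?e \<mu>)) \<le> \<bar>mlt j \<mu> - 1\<bar> * (cmod (b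
            \<mu>) * E \<mu>)"
          by (simp only: norm_mult norm_of_real)
      qed
      finally have c2: "cmod ((\<Sum>\<mu>\<in>A. complex_of_real (mlt j \<mu>) * (b \<mu> * ?e \<mu>)) - (\<Sum>\<mu>\<in>A. b \<mu> * ?e
          \<mu>)) \<le> \<epsilon>/3"
        using elim by linarith
      have c3: "cmod ((\<Sum>\<mu>\<in>A. b \<mu> * ?e \<mu>) - F (cplx x y) $ l) \<le> \<epsilon>/3"
        using A(3)[OF y, of x] by (simp only: norm_minus_commute)
      show "cmod (bochner_fejer \<Omega> \<omega> d j (\<lambda>z. F z $ l) (cplx x y) - F (cplx x y) $ l) \<le> \<epsilon>"
        using norm_diff_triangle_le[OF norm_diff_triangle_le[OF c1 c2] c3] by simp
    qed
  qed
qed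

section \<open>Rational bases\<close>

lemma rat_basis_exists:
  fixes S :: "'a::real_vector set"
  assumes "countable S"
  obtains \<omega> d where "is_rat_basis \<omega> d (ratvec.span S)"
proof -
  obtain B where B: "B \<subseteq> S" "ratvec.independent B" "S \<subseteq> ratvec.span B"
    by (rule ratvec.maximal_independent_subset[of S]) (rule that)
  have span: "ratvec.span B = ratvec.span S"
  proof
    show "ratvec.span B \<subseteq> ratvec.span S" by (rule ratvec.span_mono[OF B(1)])
    show "ratvec.span S \<subseteq> ratvec.span B" by (rule ratvec.span_minimal[OF B(3) ratvec.subspace_span])
  qed
  show thesis
  proof (cases "finite B")
    case True
    then obtain f where f: "bij_betw f {1..card B} B" using ex_bij_betw_nat_finite_1 by blast
    have "{r. 1 \<le> r \<and> enat r \<le> enat (card B)} = {1..card B}" by auto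
    then have "is_rat_basis f (enat (card B)) (ratvec.span S)"
      unfolding is_rat_basis_def using f B(2) span by (simp add: bij_betw_def)
    then show thesis by (rule that)
  next
    case False
    have f: "bij_betw (from_nat_into B) UNIV B"
      using False assms B(1) countable_subset by (intro bij_betw_from_nat_into) auto
    \<comment> \<open>The shift is needed because a rational basis is numbered from 1.\<close>
    let ?\<omega> = "\<lambda>r. from_nat_into B (r - 1)"
    have I: "{r::nat. 1 \<le> r \<and> enat r \<le> \<infinity>} = {1..}" by auto
    have "bij_betw (\<lambda>r. r - 1) {1::nat..} UNIV"
      by (rule bij_betw_byWitness[of _ Suc]) auto
    from bij_betw_trans[OF this f] have "bij_betw ?\<omega> {1..} B" by (simp add: o_def)
    then have "is_rat_basis ?\<omega> \<infinity> (ratvec.span S)"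
      unfolding is_rat_basis_def I using B(2) span by (simp add: bij_betw_def)
    then show thesis by (rule that)
  qed
qed

lemma span_group_closure: "ratvec.span (group_closure S) = ratvec.span (S :: 'a::real_vector set)"
proof
  have "x \<in> ratvec.span S" if "x \<in> group_closure S" for x
    using that
  proof induction
    case (base s)
    then show ?case using ratvec.span_zero ratvec.span_base by auto
  qed (rule ratvec.span_diff)
  then show "ratvec.span (group_closure S) \<subseteq> ratvec.span S"
    by (intro ratvec.span_minimal ratvec.subspace_span) blast
  show "ratvec.span S \<subseteq> ratvec.span (group_closure S)"
    by (rule ratvec.span_mono) (auto intro: group_closure.base)
qed

section \<open>Kronecker's theorem for arbitrary characters\<close>

lemma character_zero: "\<gamma> \<in> characters \<Longrightarrow> \<gamma> 0 = 1"
proof -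
  assume g: "\<gamma> \<in> characters"
  have n: "cmod (\<gamma> 0) = 1" and add: "\<gamma> (0 + 0) = \<gamma> 0 * \<gamma> 0"
    using g unfolding characters_def by blast+
  have "\<gamma> 0 \<noteq> 0" using n by auto
  then show "\<gamma> 0 = 1" using add by simp
qed

text \<open>The coefficients of the powers of an exponential sum with coefficients \<open>cnj (\<gamma> \<mu>)\<close> are
  nonnegative multiples of the values \<open>cnj (\<gamma> \<mu>)\<close>, while the number of frequencies grows only
  polynomially.\<close>

lemma power_of_character_sum:
  fixes \<Lambda> :: "(real ^ 'n) set"
  assumes \<gamma>: "\<gamma> \<in> characters" and fin: "finite \<Lambda>"
  shows "\<exists>b S. finite S \<and> card S \<le> (p + 1) ^ card \<Lambda> \<and> (\<Sum>\<mu>\<in>S. b \<mu>) = real (card \<Lambda>) ^ p \<and>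
    (\<forall>t. (\<Sum>\<mu>\<in>\<Lambda>. cnj (\<gamma> \<mu>) * cis (t \<bullet> \<mu>)) ^ p = (\<Sum>\<mu>\<in>S. complex_of_real (b \<mu>) * (cnj (\<gamma> \<mu>) * cis (t
        \<bullet> \<mu>))))"
proof -
  \<comment> \<open>In the \<open>p\<close>-th power each frequency of \<open>\<Lambda>\<close>
    occurs with a multiplicity of at most \<open>p\<close>. Indexing by the whole box of
    multiplicities makes the polynomial bound on the number of frequencies evident.\<close>
  define S where "S = (\<lambda>p. (\<lambda>k. \<Sum>\<mu>\<in>\<Lambda>. real (k \<mu>) *\<^sub>R \<mu>) ` (\<Lambda> \<rightarrow>\<^sub>E {0..p}))"
  have finS: "finite (S p)" for p unfolding S_def by (intro finite_imageI finite_PiE fin) simp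
  have cardS: "card (S p) \<le> (p + 1) ^ card \<Lambda>"
  proof -
    have "card (S p) \<le> card (\<Lambda> \<rightarrow>\<^sub>E {0..p})" unfolding S_def by (intro card_image_le finite_PiE fin) simp
    also have "\<dots> = (p + 1) ^ card \<Lambda>" using fin by (simp add: card_PiE)
    finally show ?thesis .
  qed
  have step: "\<mu> + \<kappa> \<in> S (Suc p)" if \<mu>: "\<mu> \<in> \<Lambda>" and \<kappa>: "\<kappa> \<in> S p" for \<mu> \<kappa> p
  proof -
    obtain k where k: "k \<in> \<Lambda> \<rightarrow>\<^sub>E {0..p}" "\<kappa> = (\<Sum>\<mu>\<in>\<Lambda>. real (k \<mu>) *\<^sub>R \<mu>)" using \<kappa> unfolding S_def by blast
    have k': "k(\<mu> := Suc (k \<mu>)) \<in> \<Lambda> \<rightarrow>\<^sub>E {0..Suc p}"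
      using k(1) \<mu> by (auto simp: PiE_iff extensional_def intro: le_SucI)
    have "(\<Sum>\<nu>\<in>\<Lambda>. real ((k(\<mu> := Suc (k \<mu>))) \<nu>) *\<^sub>R \<nu>) = (\<Sum>\<nu>\<in>\<Lambda>. real (k \<nu>) *\<^sub>R \<nu> + (if \<nu> = \<mu> then \<mu>
        else 0))"
      by (rule sum.cong) (auto simp: scaleR_left_distrib)
    also have "\<dots> = \<kappa> + (\<Sum>\<nu>\<in>\<Lambda>. if \<nu> = \<mu> then \<mu> else 0)" by (simp only: sum.distrib k(2))
    also have "(\<Sum>\<nu>\<in>\<Lambda>. if \<nu> = \<mu> then \<mu> else 0) = \<mu>" using fin \<mu> by (simp only: sum.delta if_True)
    finally have "\<mu> + \<kappa> = (\<Sum>\<nu>\<in>\<Lambda>. real ((k(\<mu> := Suc (k \<mu>))) \<nu>) *\<^sub>R \<nu>)" by (simp only: add.commute)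
    then show ?thesis unfolding S_def by (rule image_eqI[OF _ k'])
  qed
  have mult: "\<gamma> (\<mu> + \<nu>) = \<gamma> \<mu> * \<gamma> \<nu>" for \<mu> \<nu> using \<gamma> unfolding characters_def by blast
  have "\<exists>b. (\<Sum>\<mu>\<in>S p. b \<mu>) = real (card \<Lambda>) ^ p \<and>
    (\<forall>t. (\<Sum>\<mu>\<in>\<Lambda>. cnj (\<gamma> \<mu>) * cis (t \<bullet> \<mu>)) ^ p = (\<Sum>\<mu>\<in>S p. complex_of_real (b \<mu>) * (cnj (\<gamma> \<mu>) * cis
        (t \<bullet> \<mu>))))"
  proof (induction p)
    case 0
    have "\<Lambda> \<rightarrow>\<^sub>E {0..0} = {\<lambda>\<mu>\<in>\<Lambda>. 0::nat}" by (auto simp: PiE_iff extensional_def fun_eq_iff)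
    then have "S 0 = {0}" by (simp add: S_def)
    then show ?case by (intro exI[of _ "\<lambda>_. 1"]) (simp add: character_zero[OF \<gamma>])
  next
    case (Suc p)
    then obtain b where b: "(\<Sum>\<mu>\<in>S p. b \<mu>) = real (card \<Lambda>) ^ p"
      "\<And>t. (\<Sum>\<mu>\<in>\<Lambda>. cnj (\<gamma> \<mu>) * cis (t \<bullet> \<mu>)) ^ p = (\<Sum>\<mu>\<in>S p. complex_of_real (b \<mu>) * (cnj (\<gamma> \<mu>) * cis
          (t \<bullet> \<mu>)))"
      by blast
    let ?g = "\<lambda>(\<mu>, \<kappa>). \<mu> + \<kappa>"
    \<comment> \<open>Products with the same total frequency are collected. Since
      \<open>\<gamma>\<close> is multiplicative they all carry the same factor
      \<open>cnj (\<gamma> \<sigma>)\<close>, so only the real coefficients have to be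
      added.\<close>
    define b' where "b' = (\<lambda>\<sigma>. \<Sum>x\<in>{x\<in>\<Lambda> \<times> S p. ?g x = \<sigma>}. b (snd x))"
    have im: "?g ` (\<Lambda> \<times> S p) \<subseteq> S (Suc p)" using step by auto
    have fp: "finite (\<Lambda> \<times> S p)" using fin finS by simp
    have "(\<Sum>\<sigma>\<in>S (Suc p). b' \<sigma>) = (\<Sum>x\<in>\<Lambda> \<times> S p. b (snd x))"
      unfolding b'_def by (rule sum.group[OF fp finS im])
    also have "\<dots> = (\<Sum>\<mu>\<in>\<Lambda>. \<Sum>\<kappa>\<in>S p. b \<kappa>)"
      by (simp only: sum.cartesian_product case_prod_unfold)
    also have "\<dots> = real (card \<Lambda>) ^ Suc p" using b(1) by simp
    finally have 1: "(\<Sum>\<sigma>\<in>S (Suc p). b' \<sigma>) = real (card \<Lambda>) ^ Suc p" .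
    have 2: "(\<Sum>\<mu>\<in>\<Lambda>. cnj (\<gamma> \<mu>) * cis (t \<bullet> \<mu>)) ^ Suc p = (\<Sum>\<sigma>\<in>S (Suc p). complex_of_real (b' \<sigma>) *
        (cnj (\<gamma> \<sigma>) * cis (t \<bullet> \<sigma>)))" for t
    proof -
      let ?h = "\<lambda>x. complex_of_real (b (snd x)) * (cnj (\<gamma> (?g x)) * cis (t \<bullet> ?g x))"
      have "(\<Sum>\<sigma>\<in>S (Suc p). complex_of_real (b' \<sigma>) * (cnj (\<gamma> \<sigma>) * cis (t \<bullet> \<sigma>))) =
          (\<Sum>\<sigma>\<in>S (Suc p). \<Sum>x\<in>{x\<in>\<Lambda> \<times> S p. ?g x = \<sigma>}. ?h x)"
        unfolding b'_def of_real_sum sum_distrib_right by (intro sum.cong refl) auto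
      also have "\<dots> = (\<Sum>x\<in>\<Lambda> \<times> S p. ?h x)" by (rule sum.group[OF fp finS im])
      also have "\<dots> = (\<Sum>\<mu>\<in>\<Lambda>. \<Sum>\<kappa>\<in>S p. (cnj (\<gamma> \<mu>) * cis (t \<bullet> \<mu>)) * (complex_of_real (b \<kappa>) * (cnj (\<gamma>
          \<kappa>) * cis (t \<bullet> \<kappa>))))"
        unfolding sum.cartesian_product
      proof (rule sum.cong[OF refl], clarify)
        fix \<mu> \<kappa>
        have "cis (t \<bullet> (\<mu> + \<kappa>)) = cis (t \<bullet> \<mu>) * cis (t \<bullet> \<kappa>)" by (simp add: cis_mult inner_add_right)
        then show "complex_of_real (b (snd (\<mu>, \<kappa>))) * (cnj (\<gamma> (\<mu> + \<kappa>)) * cis (t \<bullet> (\<mu> + \<kappa>))) =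
            (cnj (\<gamma> \<mu>) * cis (t \<bullet> \<mu>)) * (complex_of_real (b \<kappa>) * (cnj (\<gamma> \<kappa>) * cis (t \<bullet> \<kappa>)))"
          by (simp add: mult mult_ac)
      qed
      also have "\<dots> = (\<Sum>\<mu>\<in>\<Lambda>. cnj (\<gamma> \<mu>) * cis (t \<bullet> \<mu>)) * (\<Sum>\<mu>\<in>\<Lambda>. cnj (\<gamma> \<mu>) * cis (t \<bullet> \<mu>)) ^ p"
        unfolding b(2) sum_product ..
      finally show ?thesis by simp
    qed
    show ?case using 1 2 by (intro exI[of _ b']) blast
  qed
  then obtain b where "(\<Sum>\<mu>\<in>S p. b \<mu>) = real (card \<Lambda>) ^ p \<and>
    (\<forall>t. (\<Sum>\<mu>\<in>\<Lambda>. cnj (\<gamma> \<mu>) * cis (t \<bullet> \<mu>)) ^ p = (\<Sum>\<mu>\<in>S p. complex_of_real (b \<mu>) * (cnj (\<gamma> \<mu>) * cis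
        (t \<bullet> \<mu>))))"
    by (elim exE) (rule that)
  then show ?thesis using finS cardS by (intro exI[of _ b] exI[of _ "S p"]) simp
qed

text \<open>Taking the \<open>N\<close>-th root \<open>r\<close> of \<open>q\<close> spreads the
  geometric decay over the \<open>N\<close> linear factors and reduces the claim to the limit of
  \<open>(p + 1) * r ^ p\<close>.\<close>

lemma polynomial_times_geometric_tendsto_0:
  assumes "0 < q" "q < (1::real)"
  shows "(\<lambda>p. (real p + 1) ^ N * q ^ p) \<longlonglongrightarrow> 0"
proof (cases "N = 0")
  case True
  then show ?thesis using assms by (simp add: LIMSEQ_realpow_zero)
next
  case False
  define r where "r = root N q"
  have r: "0 < r" "r < 1" "r ^ N = q" using False assms by (auto simp: r_def)
  have "(\<lambda>p. real p * r ^ p + r ^ p) \<longlonglongrightarrow> 0 + 0"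
    using r by (intro tendsto_add LIMSEQ_realpow_zero) (use powser_times_n_limit_0[of r] in auto)
  then have "(\<lambda>p. ((real p + 1) * r ^ p) ^ N) \<longlonglongrightarrow> 0 ^ N"
    by (intro tendsto_power) (simp add: distrib_right)
  moreover have "((real p + 1) * r ^ p) ^ N = (real p + 1) ^ N * q ^ p" for p
    by (simp add: power_mult_distrib r(3)[symmetric] mult.commute flip: power_mult)
  ultimately show ?thesis using False by (simp add: power_0_left)
qed

text \<open>If the sum stayed below \<open>m\<close> in modulus, its \<open>p\<close>-th power would
  have mean square at most \<open>m ^ (2 * p)\<close>. By Parseval this mean square is the sum of
  the \<open>b \<mu>\<close> squared, and by Cauchy-Schwarz it is at least
  \<open>card \<Lambda> ^ (2 * p)\<close> divided by the number of frequencies. That number grows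
  only polynomially in \<open>p\<close>, while the ratio of the two powers is geometric.\<close>

lemma character_sum_sup:
  fixes \<Lambda> :: "(real ^ 'n) set"
  assumes \<gamma>: "\<gamma> \<in> characters" and fin: "finite \<Lambda>" and m: "0 < m" "m < real (card \<Lambda>)"
  shows "\<exists>t. cmod (\<Sum>\<mu>\<in>\<Lambda>. cnj (\<gamma> \<mu>) * cis (t \<bullet> \<mu>)) > m"
proof (rule ccontr)
  let ?f = "\<lambda>t. \<Sum>\<mu>\<in>\<Lambda>. cnj (\<gamma> \<mu>) * cis (t \<bullet> \<mu>)"
  let ?N = "card \<Lambda>"
  assume "\<not> ?thesis"
  then have fm: "cmod (?f t) \<le> m" for t by (meson not_le)
  have N: "real ?N > 0" using m by linarith
  have key: "1 \<le> (real p + 1) ^ ?N * ((m / real ?N)\<^sup>2) ^ p" for p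
  proof -
    obtain b S where S: "finite S" "card S \<le> (p + 1) ^ ?N" "(\<Sum>\<mu>\<in>S. b \<mu>) = real ?N ^ p"
      "\<And>t. ?f t ^ p = (\<Sum>\<mu>\<in>S. complex_of_real (b \<mu>) * (cnj (\<gamma> \<mu>) * cis (t \<bullet> \<mu>)))"
      using power_of_character_sum[OF \<gamma> fin, of p] by blast
    have sq: "complex_of_real ((cmod (?f t ^ p))\<^sup>2) = (\<Sum>\<mu>\<in>S. \<Sum>\<nu>\<in>S. (complex_of_real (b \<mu> * b \<nu>) *
        (cnj (\<gamma> \<mu>) * \<gamma> \<nu>)) * cis (t \<bullet> (\<mu> - \<nu>)))" for t
    proof -
      have "cis (t \<bullet> (\<mu> - \<nu>)) = cis (t \<bullet> \<mu>) * cnj (cis (t \<bullet> \<nu>))" for \<mu> \<nu>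
        by (simp add: cis_cnj cis_mult inner_diff_right)
      then show ?thesis
        unfolding complex_norm_square S(4) cnj_sum sum_product
        by (intro sum.cong refl) (simp add: mult_ac)
    qed
    have "mean (\<lambda>t. complex_of_real ((cmod (?f t ^ p))\<^sup>2)) =
        (\<Sum>\<mu>\<in>S. \<Sum>\<nu>\<in>S. (complex_of_real (b \<mu> * b \<nu>) * (cnj (\<gamma> \<mu>) * \<gamma> \<nu>)) * (if \<mu> - \<nu> = 0 then 1 else 0))"
      unfolding sq
      by (simp only: mean_sum[OF ap_sum[OF ap_cmult[OF ap_wave]]] mean_sum[OF ap_cmult[OF
          ap_wave]] mean_cmult[OF ap_wave] mean_wave)
    also have "\<dots> = (\<Sum>\<mu>\<in>S. \<Sum>\<nu>\<in>S. if \<mu> = \<nu> then complex_of_real ((b \<nu>)\<^sup>2) else 0)"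
    proof (intro sum.cong refl)
      fix \<mu> \<nu>
      have "cmod (\<gamma> \<nu>) = 1" using \<gamma> unfolding characters_def by blast
      then have "cnj (\<gamma> \<nu>) * \<gamma> \<nu> = 1" using complex_norm_square[of "\<gamma> \<nu>"] by (simp add: mult.commute)
      then show "(complex_of_real (b \<mu> * b \<nu>) * (cnj (\<gamma> \<mu>) * \<gamma> \<nu>)) * (if \<mu> - \<nu> = 0 then 1 else 0) =
          (if \<mu> = \<nu> then complex_of_real ((b \<nu>)\<^sup>2) else 0)"
        by (cases "\<mu> = \<nu>") (simp_all add: power2_eq_square)
    qed
    also have "\<dots> = complex_of_real (\<Sum>\<mu>\<in>S. (b \<mu>)\<^sup>2)" using S(1) by simp
    finally have mean: "mean (\<lambda>t. complex_of_real ((cmod (?f t ^ p))\<^sup>2)) = complex_of_real (\<Sum>\<mu>\<in>S.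
        (b \<mu>)\<^sup>2)" .
    have bsq: "(\<Sum>\<mu>\<in>S. (b \<mu>)\<^sup>2) \<le> (m ^ p)\<^sup>2"
    proof -
      have "cmod (mean (\<lambda>t. complex_of_real ((cmod (?f t ^ p))\<^sup>2))) \<le> (m ^ p)\<^sup>2"
      proof (rule mean_norm)
        show "ap (\<lambda>t. complex_of_real ((cmod (?f t ^ p))\<^sup>2))" unfolding sq by (intro ap_sum
            ap_cmult ap_wave)
        show "cmod (complex_of_real ((cmod (?f t ^ p))\<^sup>2)) \<le> (m ^ p)\<^sup>2" for t
          unfolding norm_of_real abs_power2 norm_power by (intro power_mono fm) auto
      qed
      then show ?thesis unfolding mean norm_of_real by linarith
    qed
    have "(real ?N ^ p)\<^sup>2 \<le> real (card S) * (\<Sum>\<mu>\<in>S. (b \<mu>)\<^sup>2)"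
      unfolding S(3)[symmetric] using sum_squared_le_sum_of_squares[of b S] by (simp add: mult.commute)
    also have "\<dots> \<le> (real p + 1) ^ ?N * (m ^ p)\<^sup>2"
    proof (rule mult_mono[OF _ bsq])
      have "real (card S) \<le> real ((p + 1) ^ ?N)" using S(2) by (simp only: of_nat_le_iff)
      then show "real (card S) \<le> (real p + 1) ^ ?N" by (simp add: add.commute)
    qed (auto intro: sum_nonneg)
    finally have "(real ?N ^ p)\<^sup>2 \<le> (real p + 1) ^ ?N * (m ^ p)\<^sup>2" .
    then have "1 \<le> (real p + 1) ^ ?N * (m ^ p)\<^sup>2 / (real ?N ^ p)\<^sup>2" using N by (simp add:
        pos_le_divide_eq)
    also have "\<dots> = (real p + 1) ^ ?N * ((m / real ?N)\<^sup>2) ^ p"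
      by (simp add: power_divide mult.commute flip: power_mult)
    finally show ?thesis .
  qed
  have q: "0 < (m / real ?N)\<^sup>2" "(m / real ?N)\<^sup>2 < 1"
  proof -
    have 0: "0 < m / real ?N" "m / real ?N < 1" using m N by (simp_all add: pos_divide_less_eq)
    show "0 < (m / real ?N)\<^sup>2" by (rule zero_less_power[OF 0(1)])
    show "(m / real ?N)\<^sup>2 < 1" using 0 by (simp add: power_less_one_iff)
  qed
  have "1 \<le> (0::real)"
    by (rule tendsto_lowerbound[OF polynomial_times_geometric_tendsto_0[OF q, of ?N]]) (use key in auto)
  then show False by simp
qed

text \<open>Unimodular numbers whose sum has almost maximal modulus nearly agree with each other.
  Here one of them equals 1, so all of them are near 1, and
  \<open>cnj (\<gamma> \<mu>) * cis (t \<bullet> \<mu>)\<close> being near 1 means that the wave is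
  near \<open>\<gamma> \<mu>\<close>.\<close>

lemma kronecker_characters:
  fixes \<Lambda> :: "(real ^ 'n) set"
  assumes \<gamma>: "\<gamma> \<in> characters" and fin: "finite \<Lambda>" and e: "\<epsilon> > 0"
  obtains t where "\<And>\<mu>. \<mu> \<in> \<Lambda> \<Longrightarrow> cmod (cis (t \<bullet> \<mu>) - \<gamma> \<mu>) < \<epsilon>"
proof -
  \<comment> \<open>The frequency 0 fixes the common phase: its term is 1 because
    \<open>\<gamma> 0 = 1\<close>. Without it the modulus of the sum would control only quotients of
    the terms.\<close>
  define \<Lambda>0 where "\<Lambda>0 = insert 0 \<Lambda>"
  have fin0: "finite \<Lambda>0" using fin by (simp add: \<Lambda>0_def)
  let ?N = "card \<Lambda>0"
  have N: "?N \<ge> 1" using fin0 by (simp add: \<Lambda>0_def card_gt_0_iff Suc_le_eq)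
  \<comment> \<open>By the parallelogram law the squared distance of a term from 1 is 4 minus the
    square of a number above \<open>2 - \<delta>\<close>, hence below \<open>4 * \<delta>\<close>.
    The cap 1/2 keeps \<open>2 - \<delta>\<close> and the level \<open>?N - \<delta>\<close>
    positive.\<close>
  define \<delta> where "\<delta> = min (1/2) (\<epsilon>\<^sup>2 / 4)"
  have \<delta>: "\<delta> > 0" "\<delta> \<le> 1/2" "4 * \<delta> \<le> \<epsilon>\<^sup>2" using e by (auto simp: \<delta>_def)
  define u where "u = (\<lambda>t \<mu>. cnj (\<gamma> \<mu>) * cis (t \<bullet> \<mu>))"
  have "0 < real ?N - \<delta>" "real ?N - \<delta> < real ?N" using N \<delta> by linarith+
  then obtain t where t: "cmod (\<Sum>\<mu>\<in>\<Lambda>0. u t \<mu>) > real ?N - \<delta>"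
    using character_sum_sup[OF \<gamma> fin0, of "real ?N - \<delta>"] unfolding u_def by blast
  have g1: "cmod (\<gamma> \<mu>) = 1" for \<mu> using \<gamma> unfolding characters_def by blast
  have u1: "cmod (u t \<mu>) = 1" for \<mu> by (simp add: u_def norm_mult g1)
  have u0: "u t 0 = 1" by (simp add: u_def character_zero[OF \<gamma>])
  show thesis
  proof (rule that[of t])
    fix \<mu> assume \<mu>: "\<mu> \<in> \<Lambda>"
    have "cmod (cis (t \<bullet> \<mu>) - \<gamma> \<mu>) = cmod (u t \<mu> - 1)"
    proof -
      have "cnj (\<gamma> \<mu>) * \<gamma> \<mu> = 1" using complex_norm_square[of "\<gamma> \<mu>"] g1[of \<mu>] by (simp add: mult.commute)
      then have "u t \<mu> - 1 = cnj (\<gamma> \<mu>) * (cis (t \<bullet> \<mu>) - \<gamma> \<mu>)" by (simp add: u_def right_diff_distrib)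
      then show ?thesis by (simp add: norm_mult g1)
    qed
    also have "\<dots> < \<epsilon>"
    proof (cases "\<mu> = 0")
      case True
      then show ?thesis using u0 e by simp
    next
      case False
      have "(\<Sum>\<mu>\<in>\<Lambda>0. u t \<mu>) = (\<Sum>\<mu>\<in>{0, \<mu>}. u t \<mu>) + (\<Sum>\<mu>\<in>\<Lambda>0 - {0, \<mu>}. u t \<mu>)"
        using \<mu> fin0 by (subst add.commute, intro sum.subset_diff) (auto simp: \<Lambda>0_def)
      also have "(\<Sum>\<mu>\<in>{0, \<mu>}. u t \<mu>) = 1 + u t \<mu>" using False u0 by simp
      finally have "cmod (\<Sum>\<mu>\<in>\<Lambda>0. u t \<mu>) \<le> cmod (1 + u t \<mu>) + cmod (\<Sum>\<mu>\<in>\<Lambda>0 - {0, \<mu>}. u t \<mu>)"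
        by (simp add: norm_triangle_ineq)
      also have "cmod (\<Sum>\<mu>\<in>\<Lambda>0 - {0, \<mu>}. u t \<mu>) \<le> real (card (\<Lambda>0 - {0, \<mu>}))"
        using norm_sum[of "u t" "\<Lambda>0 - {0, \<mu>}"] by (simp add: u1)
      also have "real (card (\<Lambda>0 - {0, \<mu>})) = real ?N - 2"
      proof -
        have sub: "{0, \<mu>} \<subseteq> \<Lambda>0" using \<mu> by (auto simp: \<Lambda>0_def)
        have "card (\<Lambda>0 - {0, \<mu>}) = ?N - 2" using card_Diff_subset[OF _ sub] False by simp
        moreover have "2 \<le> ?N" using card_mono[OF fin0 sub] False by simp
        ultimately show ?thesis by simp
      qed
      finally have big: "cmod (1 + u t \<mu>) > 2 - \<delta>" using t by simp
      have par: "(cmod (u t \<mu> - 1))\<^sup>2 = 4 - (cmod (1 + u t \<mu>))\<^sup>2"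
      proof -
        have "(Re (u t \<mu>))\<^sup>2 + (Im (u t \<mu>))\<^sup>2 = 1" using u1[of \<mu>] by (metis cmod_power2 one_power2)
        then show ?thesis by (simp add: cmod_power2 power2_diff power2_sum)
      qed
      have "(2 - \<delta>)\<^sup>2 < (cmod (1 + u t \<mu>))\<^sup>2" using big \<delta> by (intro power_strict_mono) auto
      moreover have "(2 - \<delta>)\<^sup>2 = 4 - 4 * \<delta> + \<delta>\<^sup>2" by (simp add: power2_diff)
      ultimately have "(cmod (u t \<mu> - 1))\<^sup>2 < 4 * \<delta> - \<delta>\<^sup>2" using par by linarith
      also have "\<dots> \<le> \<epsilon>\<^sup>2" using \<delta>(3) zero_le_power2[of \<delta>] by linarith
      finally show ?thesis using e by (simp add: power2_less_imp_less)
    qed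
    finally show "cmod (cis (t \<bullet> \<mu>) - \<gamma> \<mu>) < \<epsilon>" .
  qed
qed

section \<open>The topology on almost periodic mappings\<close>

text \<open>The inequality is not strict so that it survives pointwise limits. It follows from a
  uniform distance below \<open>\<epsilon>\<close> and gives back every strict bound with a larger
  constant.\<close>

definition near :: "(real ^ 'n) set \<Rightarrow> real \<Rightarrow> (complex ^ 'n \<Rightarrow> complex ^ 'm) \<Rightarrow> (complex ^ 'n \<Rightarrow>
    complex ^ 'm) \<Rightarrow> bool" where
  "near K \<epsilon> H G \<longleftrightarrow> (\<forall>x. \<forall>y\<in>K. \<forall>l. cmod (H (cplx x y) $ l - G (cplx x y) $ l) \<le> \<epsilon>)"

lemma nearD: "near K \<epsilon> H G \<Longrightarrow> y \<in> K \<Longrightarrow> cmod (H (cplx x y) $ l - G (cplx x y) $ l) \<le> \<epsilon>"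
  unfolding near_def by blast

lemma near_mono: "near K \<epsilon> H G \<Longrightarrow> K' \<subseteq> K \<Longrightarrow> \<epsilon> \<le> \<epsilon>' \<Longrightarrow> near K' \<epsilon>' H G"
  unfolding near_def using order_trans by blast

lemma near_tubeD: "near K \<epsilon> H G \<Longrightarrow> z \<in> tube K \<Longrightarrow> cmod (H z $ l - G z $ l) \<le> \<epsilon>"
  by (elim tubeE) (simp add: nearD)

lemma near_unif_dist: "near K \<epsilon> H G \<Longrightarrow> 0 \<le> \<epsilon> \<Longrightarrow> \<epsilon> < \<epsilon>' \<Longrightarrow> unif_dist (tube K) H G < ennreal \<epsilon>'"
  by (rule unif_dist_less) (rule near_tubeD)

lemma unif_dist_near:
  assumes "unif_dist (tube K) H G < ennreal \<epsilon>"
  shows "near K \<epsilon> H G"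
  unfolding near_def
proof (intro allI ballI)
  fix x y l assume "y \<in> K"
  then have "cplx x y \<in> tube K" by simp
  from unif_distD[OF assms this] show "cmod (H (cplx x y) $ l - G (cplx x y) $ l) \<le> \<epsilon>" by (rule
      less_imp_le)
qed

lemma near_triangle:
  assumes "near K \<epsilon> H G" "near K \<epsilon>' G J"
  shows "near K (\<epsilon> + \<epsilon>') H J"
  unfolding near_def
proof (intro allI ballI)
  fix x y l assume y: "y \<in> K"
  show "cmod (H (cplx x y) $ l - J (cplx x y) $ l) \<le> \<epsilon> + \<epsilon>'"
    by (rule norm_diff_triangle_le[OF nearD[OF assms(1) y] nearD[OF assms(2) y]])
qed

lemma near_sym: "near K \<epsilon> H G \<Longrightarrow> near K \<epsilon> G H"
  unfolding near_def by (simp add: norm_minus_commute)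

lemma hap_ball_open:
  assumes "G \<in> HAP \<Omega>" "compact K" "K \<subseteq> \<Omega>" "0 < \<epsilon>"
  shows "openin (hap_topology \<Omega>) {H \<in> HAP \<Omega>. unif_dist (tube K) H G < ennreal \<epsilon>}"
  unfolding hap_topology_def
  by (rule topology_generated_by_Basis) (use assms compact_imp_rel_compact in blast)

lemma hap_ball_center:
  assumes "G \<in> HAP \<Omega>" "0 < \<epsilon>"
  shows "G \<in> {H \<in> HAP \<Omega>. unif_dist (tube K) H G < ennreal \<epsilon>}"
  using assms near_unif_dist[of K 0 G G \<epsilon>] by (simp add: near_def)

lemma topspace_hap_topology: "topspace (hap_topology \<Omega>) = HAP \<Omega>"
proof
  show "topspace (hap_topology \<Omega>) \<subseteq> HAP \<Omega>"
    unfolding hap_topology_def topology_generated_by_topspace by blast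
  show "HAP \<Omega> \<subseteq> topspace (hap_topology \<Omega>)"
  proof
    fix G assume G: "G \<in> HAP \<Omega>"
    \<comment> \<open>Over the empty set the uniform distance is 0, so this subbasic set is all of
      \<open>HAP \<Omega>\<close>.\<close>
    have "openin (hap_topology \<Omega>) {H \<in> HAP \<Omega>. unif_dist (tube {}) H G < ennreal 1}"
      by (rule hap_ball_open[OF G]) auto
    moreover have "G \<in> {H \<in> HAP \<Omega>. unif_dist (tube {}) H G < ennreal 1}" by (rule
        hap_ball_center[OF G]) simp
    ultimately show "G \<in> topspace (hap_topology \<Omega>)" using openin_subset by blast
  qed
qed

text \<open>The topology is given by a subbasis of balls with arbitrary centres over relatively
  compact sets; this shows that \<open>near\<close> over compact sets describes neighbourhoods of
  any point. Finite intersections are absorbed by the union of the compact sets and the minimum of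
  the tolerances.\<close>

lemma hap_open_near:
  assumes "openin (hap_topology \<Omega>) U" "G \<in> U"
  obtains K \<epsilon> where "compact K" "K \<subseteq> \<Omega>" "0 < \<epsilon>" "\<And>H. H \<in> HAP \<Omega> \<Longrightarrow> near K \<epsilon> H G \<Longrightarrow> H \<in> U"
proof -
  have "generate_topology_on {{G \<in> HAP \<Omega>. unif_dist (tube \<Omega>') G F < ennreal \<epsilon>} | F \<Omega>' \<epsilon>.
        F \<in> HAP \<Omega> \<and> rel_compact_in \<Omega>' \<Omega> \<and> 0 < \<epsilon>} U"
    using assms(1) unfolding hap_topology_def by (rule openin_topology_generated_by)
  then have "\<exists>K \<epsilon>. compact K \<and> K \<subseteq> \<Omega> \<and> 0 < \<epsilon> \<and> (\<forall>H\<in>HAP \<Omega>. near K \<epsilon> H G \<longrightarrow> H \<in> U)"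
    using assms(2)
  proof (induction arbitrary: G)
    case Empty
    then show ?case by simp
  next
    case (Int a b)
    obtain K1 e1 where 1: "compact K1" "K1 \<subseteq> \<Omega>" "0 < e1" "\<And>H. H \<in> HAP \<Omega> \<Longrightarrow> near K1 e1 H G \<Longrightarrow> H \<in> a"
      using Int.IH(1)[of G] Int.prems by blast
    obtain K2 e2 where 2: "compact K2" "K2 \<subseteq> \<Omega>" "0 < e2" "\<And>H. H \<in> HAP \<Omega> \<Longrightarrow> near K2 e2 H G \<Longrightarrow> H \<in> b"
      using Int.IH(2)[of G] Int.prems by blast
    have "H \<in> a \<inter> b" if "H \<in> HAP \<Omega>" "near (K1 \<union> K2) (min e1 e2) H G" for H
      using 1(4)[OF that(1) near_mono[OF that(2)]] 2(4)[OF that(1) near_mono[OF that(2)]] by simp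
    then show ?case using 1 2 by (intro exI[of _ "K1 \<union> K2"] exI[of _ "min e1 e2"]) auto
  next
    case (UN S)
    then obtain k where k: "k \<in> S" "G \<in> k" by blast
    from UN.IH[OF this] obtain K e where "compact K" "K \<subseteq> \<Omega>" "0 < e" "\<forall>H\<in>HAP \<Omega>. near K e H G \<longrightarrow> H \<in>
        k" by blast
    then show ?case using k(1) by (intro exI[of _ K] exI[of _ e]) blast
  next
    case (Basis s)
    then obtain F \<Omega>' e where s: "s = {G \<in> HAP \<Omega>. unif_dist (tube \<Omega>') G F < ennreal e}"
      "rel_compact_in \<Omega>' \<Omega>" "0 < e" by blast
    have "unif_dist (tube \<Omega>') G F < ennreal e" using Basis.prems s by blast
    \<comment> \<open>Since \<open>G\<close> need not be the centre of the ball, a real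
      \<open>d\<close> strictly between its distance to the centre and the radius is fixed; half of
      the remaining gap \<open>e - d\<close> is the tolerance around \<open>G\<close>.\<close>
    then obtain e' where e': "unif_dist (tube \<Omega>') G F < e'" "e' < ennreal e" using dense by blast
    then obtain d where d: "e' = ennreal d" "0 \<le> d" by (cases e') auto
    then have de: "d < e" using e'(2) by (simp add: ennreal_less_iff)
    have GF: "near \<Omega>' d G F" using e'(1) unfolding d(1) by (rule unif_dist_near)
    have "H \<in> s" if "H \<in> HAP \<Omega>" "near (closure \<Omega>') ((e - d) / 2) H G" for H
    proof -
      have "near \<Omega>' ((e - d) / 2) H G" using near_mono[OF that(2) closure_subset] by simp
      from near_triangle[OF this GF] have "near \<Omega>' ((e - d) / 2 + d) H F" .
      then have "unif_dist (tube \<Omega>') H F < ennreal e"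
        by (rule near_unif_dist) (use de d(2) in \<open>simp_all add: field_simps\<close>)
      then show ?thesis using that(1) s(1) by simp
    qed
    moreover have "compact (closure \<Omega>')" "closure \<Omega>' \<subseteq> \<Omega>" using s(2) by (simp_all add:
        rel_compact_in_def)
    moreover have "0 < (e - d) / 2" using de by simp
    ultimately show ?case by (intro exI[of _ "closure \<Omega>'"] exI[of _ "(e - d) / 2"]) blast
  qed
  then obtain K \<epsilon> where "compact K \<and> K \<subseteq> \<Omega> \<and> 0 < \<epsilon> \<and> (\<forall>H\<in>HAP \<Omega>. near K \<epsilon> H G \<longrightarrow> H \<in> U)"
    by (elim exE) (rule that)
  then show thesis by (intro that[of K \<epsilon>]) auto
qed

lemma limitin_hapI:
  assumes "G \<in> HAP \<Omega>" "\<And>j. f j \<in> HAP \<Omega>"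
    and "\<And>K \<epsilon>. compact K \<Longrightarrow> K \<subseteq> \<Omega> \<Longrightarrow> 0 < \<epsilon> \<Longrightarrow> \<forall>\<^sub>F j in S. near K \<epsilon> (f j) G"
  shows "limitin (hap_topology \<Omega>) f G S"
  unfolding limitin_def topspace_hap_topology
proof (intro conjI allI impI assms(1))
  fix U assume U: "openin (hap_topology \<Omega>) U \<and> G \<in> U"
  obtain K \<epsilon> where K: "compact K" "K \<subseteq> \<Omega>" "0 < \<epsilon>" "\<And>H. H \<in> HAP \<Omega> \<Longrightarrow> near K \<epsilon> H G \<Longrightarrow> H \<in> U"
    by (rule hap_open_near[OF conjunct1[OF U] conjunct2[OF U]]) (rule that)
  show "\<forall>\<^sub>F j in S. f j \<in> U"
    using assms(3)[OF K(1-3)] by eventually_elim (rule K(4)[OF assms(2)])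
qed

lemma limitin_hapD:
  assumes "limitin (hap_topology \<Omega>) f G S" "compact K" "K \<subseteq> \<Omega>" "0 < \<epsilon>"
  shows "\<forall>\<^sub>F j in S. near K \<epsilon> (f j) G"
proof -
  have G: "G \<in> HAP \<Omega>" using assms(1) by (simp add: limitin_def topspace_hap_topology)
  have "\<forall>\<^sub>F j in S. f j \<in> {H \<in> HAP \<Omega>. unif_dist (tube K) H G < ennreal \<epsilon>}"
    using assms(1) hap_ball_open[OF G assms(2-4)] hap_ball_center[OF G assms(4)] unfolding
        limitin_def by blast
  then show ?thesis by eventually_elim (simp add: unif_dist_near)
qed

text \<open>Singletons \<open>{y}\<close> are compact, so limits in this topology are also pointwise
  limits on the tube, and extensionality extends the equality to total functions.\<close>

lemma hap_limit_unique:
  assumes "limitin (hap_topology \<Omega>) f G sequentially" "limitin (hap_topology \<Omega>) f G' sequentially"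
  shows "G = G'"
proof (rule extensionalityI[of _ "tube \<Omega>"])
  show "G \<in> extensional (tube \<Omega>)" "G' \<in> extensional (tube \<Omega>)"
    using assms by (simp_all add: limitin_def topspace_hap_topology HAP_def)
  fix z assume "z \<in> tube \<Omega>"
  then obtain x y where z: "z = cplx x y" "y \<in> \<Omega>" by (rule tubeE)
  have "G z $ l = G' z $ l" for l
  proof -
    have "cmod (G z $ l - G' z $ l) \<le> e" if "e > 0" for e
    proof -
      have "\<forall>\<^sub>F j in sequentially. near {y} (e/2) (f j) G \<and> near {y} (e/2) (f j) G'"
        by (intro eventually_conj limitin_hapD[OF assms(1)] limitin_hapD[OF assms(2)]) (use z that
            in auto)
      from eventually_happens'[OF sequentially_bot this]
      obtain j where "near {y} (e/2) (f j) G" "near {y} (e/2) (f j) G'" by (elim exE conjE) (rule that)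
      from near_triangle[OF near_sym[OF this(1)] this(2)] have "near {y} e G G'" by simp
      from nearD[OF this, of y x l] show ?thesis by (simp add: z)
    qed
    then have "cmod (G z $ l - G' z $ l) \<le> 0" by (rule field_le_epsilon) simp
    then show ?thesis by simp
  qed
  then show "G z = G' z" by (simp add: vec_eq_iff)
qed

lemma hap_closure_iff:
  "G \<in> hap_topology \<Omega> closure_of B \<longleftrightarrow> G \<in> HAP \<Omega> \<and>
    (\<forall>K \<epsilon>. compact K \<longrightarrow> K \<subseteq> \<Omega> \<longrightarrow> 0 < \<epsilon> \<longrightarrow> (\<exists>H\<in>B. H \<in> HAP \<Omega> \<and> near K \<epsilon> H G))"
proof
  assume G: "G \<in> hap_topology \<Omega> closure_of B"
  then have GH: "G \<in> HAP \<Omega>" by (simp add: in_closure_of topspace_hap_topology)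
  have "\<exists>H\<in>B. H \<in> HAP \<Omega> \<and> near K \<epsilon> H G" if K: "compact K" "K \<subseteq> \<Omega>" "0 < \<epsilon>" for K \<epsilon>
  proof -
    obtain H where "H \<in> B" "H \<in> {H \<in> HAP \<Omega>. unif_dist (tube K) H G < ennreal \<epsilon>}"
      using G hap_ball_open[OF GH K] hap_ball_center[OF GH K(3)] unfolding in_closure_of by blast
    then show ?thesis using unif_dist_near by blast
  qed
  then show "G \<in> HAP \<Omega> \<and> (\<forall>K \<epsilon>. compact K \<longrightarrow> K \<subseteq> \<Omega> \<longrightarrow> 0 < \<epsilon> \<longrightarrow> (\<exists>H\<in>B. H \<in> HAP \<Omega> \<and> near K \<epsilon> H G))"
    using GH by blast
next
  assume G: "G \<in> HAP \<Omega> \<and> (\<forall>K \<epsilon>. compact K \<longrightarrow> K \<subseteq> \<Omega> \<longrightarrow> 0 < \<epsilon> \<longrightarrow> (\<exists>H\<in>B. H \<in> HAP \<Omega> \<and> near K \<epsilon> H G))"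
  show "G \<in> hap_topology \<Omega> closure_of B"
    unfolding in_closure_of topspace_hap_topology
  proof (intro conjI allI impI)
    show "G \<in> HAP \<Omega>" using G by blast
    fix T assume T: "G \<in> T \<and> openin (hap_topology \<Omega>) T"
    obtain K \<epsilon> where "compact K" "K \<subseteq> \<Omega>" "0 < \<epsilon>" "\<And>H. H \<in> HAP \<Omega> \<Longrightarrow> near K \<epsilon> H G \<Longrightarrow> H \<in> T"
      by (rule hap_open_near[OF conjunct2[OF T] conjunct1[OF T]]) (rule that)
    then show "\<exists>H. H \<in> B \<and> H \<in> T" using G by blast
  qed
qed

section \<open>Exponential sums and translates as members of the space\<close>

lemma open_tube:
  fixes \<Omega> :: "(real ^ 'n) set"
  assumes "open \<Omega>"
  shows "open (tube \<Omega>)"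
proof -
  have "z \<in> tube \<Omega> \<longleftrightarrow> (\<chi> j. Im (z $ j)) \<in> \<Omega>" for z :: "complex ^ 'n"
  proof -
    have "z = cplx (\<chi> j. Re (z $ j)) (\<chi> j. Im (z $ j))" by (simp add: cplx_def)
    then show ?thesis by (metis cplx_in_tube)
  qed
  then have "tube \<Omega> = (\<lambda>z. \<chi> j. Im (z $ j)) -` \<Omega>" by blast
  moreover have "open ((\<lambda>z::complex^'n. \<chi> j. Im (z $ j)) -` \<Omega>)"
    by (rule open_vimage[OF assms]) (intro continuous_on_vec_lambda continuous_intros)
  ultimately show ?thesis by simp
qed

lemma has_derivative_vec_components:
  fixes g :: "'m::finite \<Rightarrow> complex ^ 'n \<Rightarrow> complex"
  assumes "\<And>l. (g l has_derivative L l) (at z)"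
  shows "((\<lambda>z. \<chi> l. g l z) has_derivative (\<lambda>v. \<chi> l. L l v)) (at z)"
proof -
  have lin: "linear (L l)" for l using assms has_derivative_linear by blast
  have bl: "bounded_linear (\<lambda>v. \<chi> l. L l v)"
    by (rule linear_conv_bounded_linear[THEN iffD1])
      (auto intro!: linearI simp: vec_eq_iff linear_add[OF lin] linear_scale[OF lin])
  have "((\<lambda>y. ((\<chi> l. g l y) - (\<chi> l. g l z) - (\<chi> l. L l (y - z))) /\<^sub>R norm (y - z)) \<longlongrightarrow> 0) (at z)"
  proof (rule vec_tendstoI)
    fix l
    have "((\<lambda>y. (g l y - g l z - L l (y - z)) /\<^sub>R norm (y - z)) \<longlongrightarrow> 0) (at z)"
      using assms[of l] by (simp add: has_derivative_at_within)
    then show "((\<lambda>y. (((\<chi> l. g l y) - (\<chi> l. g l z) - (\<chi> l. L l (y - z))) /\<^sub>R norm (y - z)) $ l) \<longlongrightarrow>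
        0 $ l) (at z)"
      by simp
  qed
  then show ?thesis using bl by (simp add: has_derivative_at_within)
qed

lemma holomorphic_map_cong_open:
  assumes "holomorphic_map F S" "open S" "\<And>z. z \<in> S \<Longrightarrow> F z = G z"
  shows "holomorphic_map G S"
  unfolding holomorphic_map_def
proof
  fix z assume z: "z \<in> S"
  then obtain L where L: "(F has_derivative L) (at z)" "\<forall>c v. L (c *s v) = c *s L v"
    using assms(1) unfolding holomorphic_map_def by blast
  have "(G has_derivative L) (at z)"
    by (rule has_derivative_transform_within_open[OF L(1) assms(2) z assms(3)])
  then show "\<exists>L. (G has_derivative L) (at z) \<and> (\<forall>c v. L (c *s v) = c *s L v)" using L(2) by blast
qed

lemma exponential_sum_holomorphic:
  fixes \<theta> :: "'m::finite \<Rightarrow> 'i \<Rightarrow> real ^ 'n"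
  shows "holomorphic_map (\<lambda>z. \<chi> l. \<Sum>i\<in>I. c l i * exp (\<i> * herm z (rvec (\<theta> l i)))) S"
  unfolding holomorphic_map_def
proof
  fix z :: "complex ^ 'n"
  let ?L = "\<lambda>l v. \<Sum>i\<in>I. c l i * (exp (\<i> * herm z (rvec (\<theta> l i))) * (\<i> * herm v (rvec (\<theta> l i))))"
  have bl: "bounded_linear (\<lambda>v. herm v (w :: complex ^ 'n))" for w
    by (rule linear_conv_bounded_linear[THEN iffD1])
      (auto intro!: linearI simp: herm_def algebra_simps sum.distrib scaleR_sum_right)
  have "((\<lambda>z. \<Sum>i\<in>I. c l i * exp (\<i> * herm z (rvec (\<theta> l i)))) has_derivative ?L l) (at z)" for l
  proof (intro has_derivative_sum has_derivative_mult_right)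
    fix i
    have "((\<lambda>z. \<i> * herm z (rvec (\<theta> l i))) has_derivative (\<lambda>v. \<i> * herm v (rvec (\<theta> l i)))) (at z)"
      by (intro has_derivative_mult_right bounded_linear_imp_has_derivative bl)
    moreover have "(exp has_derivative (\<lambda>h. exp (\<i> * herm z (rvec (\<theta> l i))) * h)) (at (\<i> * herm z
        (rvec (\<theta> l i))))"
      using DERIV_exp[of "\<i> * herm z (rvec (\<theta> l i))"] by (simp add: has_field_derivative_def)
    ultimately show "((\<lambda>z. exp (\<i> * herm z (rvec (\<theta> l i)))) has_derivative
        (\<lambda>v. exp (\<i> * herm z (rvec (\<theta> l i))) * (\<i> * herm v (rvec (\<theta> l i))))) (at z)"
      by (rule has_derivative_compose)
  qed
  then have "((\<lambda>z. \<chi> l. \<Sum>i\<in>I. c l i * exp (\<i> * herm z (rvec (\<theta> l i)))) has_derivative (\<lambda>v. \<chi> l. ?L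
      l v)) (at z)"
    by (rule has_derivative_vec_components)
  moreover have "(\<chi> l. ?L l (a *s v)) = a *s (\<chi> l. ?L l v)" for a v
  proof -
    have "herm (a *s v) w = a * herm v w" for w by (simp add: herm_def sum_distrib_left mult_ac)
    then show ?thesis by (simp add: vec_eq_iff sum_distrib_left mult_ac)
  qed
  ultimately show "\<exists>L. ((\<lambda>z. \<chi> l. \<Sum>i\<in>I. c l i * exp (\<i> * herm z (rvec (\<theta> l i)))) has_derivative L) (at z)
      \<and> (\<forall>a v. L (a *s v) = a *s L v)"
    by (intro exI[of _ "\<lambda>v. \<chi> l. ?L l v"]) simp
qed

lemma exp_wave_bounded:
  fixes K :: "(real ^ 'n) set"
  assumes "compact K"
  shows "\<exists>E>0. \<forall>x. \<forall>y\<in>K. cmod (exp (\<i> * herm (cplx x y) (rvec \<mu>))) \<le> E"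
proof -
  have "bounded ((\<lambda>y. exp (- (y \<bullet> \<mu>))) ` K)"
    by (intro compact_imp_bounded compact_continuous_image assms continuous_intros)
  then obtain E where "E > 0" "\<forall>e\<in>(\<lambda>y. exp (- (y \<bullet> \<mu>))) ` K. norm e \<le> E" unfolding bounded_pos by
      (elim exE conjE) (rule that)
  then show ?thesis by (intro exI[of _ E]) (simp add: exp_herm norm_mult)
qed

text \<open>Every vector that is nearly trivial on the finitely many frequencies is an almost
  period, and total boundedness of Bohr sets finds such a vector of the form
  \<open>\<xi> - i\<close> with \<open>i\<close> in a fixed finite set.\<close>

lemma exponential_sum_almost_periodic:
  fixes \<theta> :: "'m::finite \<Rightarrow> 'i \<Rightarrow> real ^ 'n"
  assumes "finite I"
  shows "almost_periodic \<Omega> (\<lambda>z. \<chi> l. \<Sum>i\<in>I. c l i * exp (\<i> * herm z (rvec (\<theta> l i))))" (is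
      "almost_periodic \<Omega> ?P")
  unfolding almost_periodic_def
proof (intro allI impI)
  fix \<epsilon> :: real and \<Omega>' assume e: "\<epsilon> > 0" and "rel_compact_in \<Omega>' \<Omega>"
  then have K: "compact (closure \<Omega>')" by (simp add: rel_compact_in_def)
  have "\<forall>\<mu>. \<exists>E. E > 0 \<and> (\<forall>x. \<forall>y\<in>closure \<Omega>'. cmod (exp (\<i> * herm (cplx x y) (rvec \<mu>))) \<le> E)"
    by (rule allI) (rule exp_wave_bounded[OF K])
  from choice[OF this] obtain E where E': "\<forall>\<mu>. E \<mu> > 0 \<and> (\<forall>x. \<forall>y\<in>closure \<Omega>'. cmod (exp (\<i> * herm
      (cplx x y) (rvec \<mu>))) \<le> E \<mu>)"
    by (elim exE) (rule that)
  then have E: "E \<mu> > 0" "y \<in> closure \<Omega>' \<Longrightarrow> cmod (exp (\<i> * herm (cplx x y) (rvec \<mu>))) \<le> E \<mu>" for \<mu>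
      x y by auto
  define B where "B = 1 + (\<Sum>l\<in>UNIV. \<Sum>i\<in>I. cmod (c l i) * E (\<theta> l i))"
  have nn: "0 \<le> (\<Sum>i\<in>I. cmod (c l i) * E (\<theta> l i))" for l
    by (intro sum_nonneg mult_nonneg_nonneg) (auto intro: less_imp_le[OF E(1)])
  have B: "B > 0" unfolding B_def by (intro add_pos_nonneg sum_nonneg nn) auto
  have Bl: "(\<Sum>i\<in>I. cmod (c l i) * E (\<theta> l i)) \<le> B" for l
    using member_le_sum[of l UNIV "\<lambda>l. \<Sum>i\<in>I. cmod (c l i) * E (\<theta> l i)"] nn by (simp add: B_def)
  define \<Lambda> where "\<Lambda> = (\<Union>l. \<theta> l ` I)"
  have \<Lambda>: "finite \<Lambda>" using assms by (simp add: \<Lambda>_def)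
  define \<delta> where "\<delta> = \<epsilon> / (2 * B)"
  have \<delta>: "\<delta> > 0" using e B by (simp add: \<delta>_def)
  obtain T where T: "finite T" "T \<noteq> {}" "\<And>x. \<exists>i\<in>T. \<forall>\<mu>\<in>\<Lambda>. cmod (cis ((x - i) \<bullet> \<mu>) - 1) < \<delta>"
    by (rule bohr_sets_totally_bounded[OF \<Lambda> \<delta>]) (rule that)
  \<comment> \<open>The box has to contain all the corrections from \<open>T\<close>; the summand 1
    makes its sides positive and the bound strict.\<close>
  define t :: "real ^ 'n" where "t = (\<chi> j. 1 + (\<Sum>i\<in>T. \<bar>i $ j\<bar>))"
  show "\<exists>t::real ^ 'n. (\<forall>l. 0 < t $ l) \<and> (\<forall>\<xi>. \<exists>\<tau>. (\<forall>l. \<bar>\<tau> $ l - \<xi> $ l\<bar> < t $ l) \<and>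
      unif_dist (tube \<Omega>') (\<lambda>z. ?P (z + rvec \<tau>)) ?P < ennreal \<epsilon>)"
  proof (rule exI[of _ t], intro conjI allI)
    show "0 < t $ j" for j by (simp add: t_def add_pos_nonneg sum_nonneg)
    fix \<xi>
    obtain i where i: "i \<in> T" "\<forall>\<mu>\<in>\<Lambda>. cmod (cis ((\<xi> - i) \<bullet> \<mu>) - 1) < \<delta>" using T(3) by blast
    show "\<exists>\<tau>. (\<forall>l. \<bar>\<tau> $ l - \<xi> $ l\<bar> < t $ l) \<and> unif_dist (tube \<Omega>') (\<lambda>z. ?P (z + rvec \<tau>)) ?P < ennreal \<epsilon>"
    proof (intro exI[of _ "\<xi> - i"] conjI allI)
      fix j
      have "\<bar>i $ j\<bar> \<le> (\<Sum>i\<in>T. \<bar>i $ j\<bar>)" by (rule member_le_sum[OF i(1)]) (use T in auto)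
      then show "\<bar>(\<xi> - i) $ j - \<xi> $ j\<bar> < t $ j" by (simp add: t_def)
    next
      have "near \<Omega>' (\<epsilon>/2) (\<lambda>z. ?P (z + rvec (\<xi> - i))) ?P"
        unfolding near_def
      proof (intro allI ballI)
        fix x y l assume "y \<in> \<Omega>'"
        then have y: "y \<in> closure \<Omega>'" using closure_subset by blast
        have "?P (cplx x y + rvec (\<xi> - i)) $ l - ?P (cplx x y) $ l =
          (\<Sum>k\<in>I. c l k * exp (\<i> * herm (cplx x y) (rvec (\<theta> l k))) * (cis ((\<xi> - i) \<bullet> \<theta> l k) - 1))"
        proof -
          have "exp (\<i> * herm (cplx (x + (\<xi> - i)) y) (rvec \<mu>)) = exp (\<i> * herm (cplx x y) (rvec
              \<mu>)) * cis ((\<xi> - i) \<bullet> \<mu>)" for \<mu>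
            unfolding exp_herm by (simp only: inner_add_left cis_mult[symmetric] mult.assoc)
          then have e: "c l k * exp (\<i> * herm (cplx (x + (\<xi> - i)) y) (rvec (\<theta> l k))) - c l k * exp
              (\<i> * herm (cplx x y) (rvec (\<theta> l k))) =
              c l k * exp (\<i> * herm (cplx x y) (rvec (\<theta> l k))) * (cis ((\<xi> - i) \<bullet> \<theta> l k) - 1)" for k
            by (simp only: right_diff_distrib mult.assoc mult_1_right)
          show ?thesis by (simp only: cplx_plus_rvec vec_lambda_beta sum_subtractf[symmetric] e)
        qed
        also have "cmod \<dots> \<le> (\<Sum>k\<in>I. cmod (c l k) * E (\<theta> l k) * \<delta>)"
        proof (rule order_trans[OF norm_sum], rule sum_mono)
          fix k assume "k \<in> I"
          then have "\<theta> l k \<in> \<Lambda>" by (auto simp: \<Lambda>_def)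
          then have h: "cmod (cis ((\<xi> - i) \<bullet> \<theta> l k) - 1) \<le> \<delta>" using i(2) by (simp add: less_imp_le)
          show "cmod (c l k * exp (\<i> * herm (cplx x y) (rvec (\<theta> l k))) * (cis ((\<xi> - i) \<bullet> \<theta> l k) - 1)) \<le>
              cmod (c l k) * E (\<theta> l k) * \<delta>"
            unfolding norm_mult
            by (intro mult_mono E(2)[OF y] h order_refl mult_nonneg_nonneg norm_ge_zero
                less_imp_le[OF E(1)])
        qed
        also have "\<dots> = (\<Sum>k\<in>I. cmod (c l k) * E (\<theta> l k)) * \<delta>" by (simp add: sum_distrib_right)
        also have "\<dots> \<le> B * \<delta>" using Bl[of l] \<delta> by (intro mult_right_mono) auto
        also have "\<dots> = \<epsilon>/2" using B by (simp add: \<delta>_def)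
        finally show "cmod (?P (cplx x y + rvec (\<xi> - i)) $ l - ?P (cplx x y) $ l) \<le> \<epsilon>/2" .
      qed
      then show "unif_dist (tube \<Omega>') (\<lambda>z. ?P (z + rvec (\<xi> - i))) ?P < ennreal \<epsilon>"
        by (rule near_unif_dist) (use e in auto)
    qed
  qed
qed

text \<open>Real translations preserve the tube over any set of imaginary parts, so the shifted
  values are also compared inside the tube over \<open>\<Omega>\<close>.\<close>

lemma almost_periodic_cong:
  fixes F G :: "complex ^ 'n \<Rightarrow> complex ^ 'm"
  assumes "almost_periodic \<Omega> F" "\<And>z. z \<in> tube \<Omega> \<Longrightarrow> F z = G z"
  shows "almost_periodic \<Omega> G"
proof -
  have "unif_dist (tube \<Omega>') (\<lambda>z. G (z + rvec \<tau>)) G = unif_dist (tube \<Omega>') (\<lambda>z. F (z + rvec \<tau>)) F"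
    if "rel_compact_in \<Omega>' \<Omega>" for \<Omega>' \<tau>
  proof -
    have sub: "\<Omega>' \<subseteq> \<Omega>" using that closure_subset unfolding rel_compact_in_def by blast
    show ?thesis unfolding unif_dist_def
    proof (rule SUP_cong[OF refl])
      fix z assume "z \<in> tube \<Omega>'"
      then obtain x y where z: "z = cplx x y" "y \<in> \<Omega>'" by (rule tubeE)
      have "F z = G z" "F (z + rvec \<tau>) = G (z + rvec \<tau>)"
        using z sub by (auto intro!: assms(2) simp: cplx_plus_rvec)
      then show "ennreal (MAX l\<in>UNIV. cmod (G (z + rvec \<tau>) $ l - G z $ l)) = ennreal (MAX l\<in>UNIV.
          cmod (F (z + rvec \<tau>) $ l - F z $ l))"
        by simp
    qed
  qed
  then show ?thesis using assms(1) unfolding almost_periodic_def by simp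
qed

lemma HAP_restrictI:
  assumes "open \<Omega>" "holomorphic_map P (tube \<Omega>)" "almost_periodic \<Omega> P"
  shows "restrict P (tube \<Omega>) \<in> HAP \<Omega>"
proof -
  have "holomorphic_map (restrict P (tube \<Omega>)) (tube \<Omega>)"
    by (rule holomorphic_map_cong_open[OF assms(2) open_tube[OF assms(1)]]) simp
  moreover have "almost_periodic \<Omega> (restrict P (tube \<Omega>))"
    by (rule almost_periodic_cong[OF assms(3)]) simp
  ultimately show ?thesis by (simp add: HAP_def)
qed

lemma exponential_sum_HAP:
  fixes \<theta> :: "'m::finite \<Rightarrow> 'i \<Rightarrow> real ^ 'n"
  assumes "open \<Omega>" "finite I"
  shows "restrict (\<lambda>z. \<chi> l. \<Sum>i\<in>I. c l i * exp (\<i> * herm z (rvec (\<theta> l i)))) (tube \<Omega>) \<in> HAP \<Omega>"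
  by (rule HAP_restrictI[OF assms(1) exponential_sum_holomorphic
      exponential_sum_almost_periodic[OF assms(2)]])

lemma translate_HAP:
  fixes F :: "complex ^ 'n \<Rightarrow> complex ^ 'm"
  assumes F: "F \<in> HAP \<Omega>" and \<Omega>: "open \<Omega>"
  shows "restrict (\<lambda>z. F (z + rvec t)) (tube \<Omega>) \<in> HAP \<Omega>"
proof (rule HAP_restrictI[OF \<Omega>])
  have tr: "z + rvec t \<in> tube S \<longleftrightarrow> z \<in> tube S" for z and S :: "(real ^ 'n) set"
  proof -
    have "z = cplx (\<chi> j. Re (z $ j)) (\<chi> j. Im (z $ j))" by (simp add: cplx_def)
    then show ?thesis by (metis cplx_in_tube cplx_plus_rvec)
  qed
  show "holomorphic_map (\<lambda>z. F (z + rvec t)) (tube \<Omega>)"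
    unfolding holomorphic_map_def
  proof
    fix z assume "z \<in> tube \<Omega>"
    then have "z + rvec t \<in> tube \<Omega>" by (simp add: tr)
    then obtain L where L: "(F has_derivative L) (at (z + rvec t))" "\<forall>c v. L (c *s v) = c *s L v"
      using F unfolding HAP_def holomorphic_map_def by blast
    have "((\<lambda>z. z + rvec t) has_derivative (\<lambda>v. v)) (at z)"
      by (rule has_derivative_eq_rhs) (rule derivative_intros | simp)+
    from has_derivative_compose[OF this L(1)]
    show "\<exists>L. ((\<lambda>z. F (z + rvec t)) has_derivative L) (at z) \<and> (\<forall>c v. L (c *s v) = c *s L v)"
        using L(2) by blast
  qed
  show "almost_periodic \<Omega> (\<lambda>z. F (z + rvec t))"
    unfolding almost_periodic_def
  proof (intro allI impI)
    fix \<epsilon> :: real and \<Omega>' assume e: "\<epsilon> > 0" "rel_compact_in \<Omega>' \<Omega>"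
    have "unif_dist (tube \<Omega>') (\<lambda>z. F (z + rvec \<tau> + rvec t)) (\<lambda>z. F (z + rvec t)) \<le>
        unif_dist (tube \<Omega>') (\<lambda>z. F (z + rvec \<tau>)) F" for \<tau>
      unfolding unif_dist_def
    proof (rule SUP_least)
      fix z assume "z \<in> tube \<Omega>'"
      then have "z + rvec t \<in> tube \<Omega>'" by (simp add: tr)
      from SUP_upper[OF this, of "\<lambda>z. ennreal (MAX l\<in>UNIV. cmod (F (z + rvec \<tau>) $ l - F z $ l))"]
      show "ennreal (MAX l\<in>UNIV. cmod (F (z + rvec \<tau> + rvec t) $ l - F (z + rvec t) $ l)) \<le>
          (SUP z\<in>tube \<Omega>'. ennreal (MAX l\<in>UNIV. cmod (F (z + rvec \<tau>) $ l - F z $ l)))"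
        by (simp add: add_ac)
    qed
    moreover have "\<exists>s::real ^ 'n. (\<forall>l. 0 < s $ l) \<and> (\<forall>\<xi>. \<exists>\<tau>. (\<forall>l. \<bar>\<tau> $ l - \<xi> $ l\<bar> < s $ l) \<and>
        unif_dist (tube \<Omega>') (\<lambda>z. F (z + rvec \<tau>)) F < ennreal \<epsilon>)"
      using F e unfolding HAP_def almost_periodic_def by blast
    ultimately show "\<exists>s::real ^ 'n. (\<forall>l. 0 < s $ l) \<and> (\<forall>\<xi>. \<exists>\<tau>. (\<forall>l. \<bar>\<tau> $ l - \<xi> $ l\<bar> < s $ l) \<and>
        unif_dist (tube \<Omega>') (\<lambda>z. F (z + rvec \<tau> + rvec t)) (\<lambda>z. F (z + rvec t)) < ennreal \<epsilon>)"
      using le_less_trans by meson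
  qed
qed

section \<open>Completeness of the space\<close>

lemma norm_imaginary_part_le: "norm (y - y0) \<le> norm (cplx x y - cplx x0 y0)"
  unfolding norm_vec_def
proof (rule L2_set_mono)
  fix j
  have "\<bar>Im ((cplx x y - cplx x0 y0) $ j)\<bar> \<le> cmod ((cplx x y - cplx x0 y0) $ j)" by (rule abs_Im_le_cmod)
  then show "norm ((y - y0) $ j) \<le> norm ((cplx x y - cplx x0 y0) $ j)" by (simp add: cplx_def)
qed simp

lemma norm_complex_scale: "norm (c *s (v :: complex ^ 'n)) = cmod c * norm v"
  unfolding norm_vec_def by (simp add: norm_mult L2_set_right_distrib)

lemma norm_le_sum_components: "norm (v :: complex ^ 'n) \<le> (\<Sum>l\<in>UNIV. cmod (v $ l))"
  unfolding norm_vec_def by (rule L2_set_le_sum) simp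

text \<open>On the complex line through \<open>z\<close> in the direction \<open>h\<close>, the disc
  of radius \<open>\<rho> / norm h\<close> stays over \<open>K\<close>, and Cauchy's inequality
  applies to the difference of the two mappings. Uniform closeness over a larger set thus controls
  derivatives.\<close>

lemma derivative_difference_bound:
  fixes H1 H2 :: "complex ^ 'n \<Rightarrow> complex ^ 'm"
  assumes hol: "holomorphic_map H1 (tube \<Omega>)" "holomorphic_map H2 (tube \<Omega>)" and \<rho>: "\<rho> > 0"
    and sub: "cball z \<rho> \<subseteq> tube K" "K \<subseteq> \<Omega>" and nr: "near K \<epsilon> H1 H2"
    and L: "(H1 has_derivative L1) (at z)" "\<And>c v. L1 (c *s v) = c *s L1 v"
      "(H2 has_derivative L2) (at z)" "\<And>c v. L2 (c *s v) = c *s L2 v"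
  shows "cmod (L1 h $ l - L2 h $ l) \<le> \<epsilon> / \<rho> * norm h"
proof (cases "h = 0")
  case True
  then show ?thesis
    using linear_0[OF has_derivative_linear[OF L(1)]] linear_0[OF has_derivative_linear[OF L(3)]] by simp
next
  case False
  then have nh: "norm h > 0" by simp
  define r where "r = \<rho> / norm h"
  have r: "r > 0" using \<rho> nh by (simp add: r_def)
  define \<phi> where "\<phi> = (\<lambda>w. H1 (z + w *s h) $ l - H2 (z + w *s h) $ l)"
  have inK: "z + w *s h \<in> tube K" if "cmod w \<le> r" for w
  proof -
    have "dist z (z + w *s h) \<le> \<rho>" using that nh by (simp add: dist_norm norm_complex_scale r_def
        field_simps)
    then show ?thesis using sub(1) by auto
  qed
  have in\<Omega>: "z + w *s h \<in> tube \<Omega>" if "cmod w \<le> r" for w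
    using inK[OF that] sub(2) by (auto elim!: tubeE)
  have diff: "\<phi> field_differentiable at w" if w: "cmod w \<le> r" for w
  proof -
    obtain M1 M2 where M: "(H1 has_derivative M1) (at (z + w *s h))" "\<And>c v. M1 (c *s v) = c *s M1 v"
      "(H2 has_derivative M2) (at (z + w *s h))" "\<And>c v. M2 (c *s v) = c *s M2 v"
      using hol in\<Omega>[OF w] unfolding holomorphic_map_def by meson
    show ?thesis unfolding \<phi>_def field_differentiable_def
      using DERIV_diff[OF has_field_derivative_along_line[OF M(1,2)]
          has_field_derivative_along_line[OF M(3,4)]]
      by blast
  qed
  have "(\<phi> has_field_derivative (L1 h $ l - L2 h $ l)) (at 0)"
    unfolding \<phi>_def using L
    by (intro DERIV_diff has_field_derivative_along_line) simp_all
  then have d: "deriv \<phi> 0 = L1 h $ l - L2 h $ l" by (rule DERIV_imp_deriv)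
  have "cmod ((deriv ^^ 1) \<phi> 0) \<le> fact 1 * \<epsilon> / r ^ 1"
  proof (rule Cauchy_inequality)
    show "\<phi> holomorphic_on ball 0 r"
      by (rule holomorphic_onI, rule field_differentiable_at_within, rule diff) simp
    show "continuous_on (cball 0 r) \<phi>"
      by (rule continuous_at_imp_continuous_on, rule ballI, rule
          field_differentiable_imp_continuous_at, rule diff) simp
    show "cmod (\<phi> w) \<le> \<epsilon>" if "cmod (0 - w) = r" for w
      unfolding \<phi>_def by (rule near_tubeD[OF nr inK]) (use that in simp)
  qed (rule r)
  then show ?thesis by (simp add: d r_def)
qed

text \<open>For holomorphy of the limit the derivatives must converge uniformly near each point;
  this follows from the uniform Cauchy condition by Cauchy's inequality. Almost periods of one late
  member of the sequence serve as almost periods of the limit.\<close>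

lemma HAP_complete:
  fixes H :: "nat \<Rightarrow> complex ^ 'n \<Rightarrow> complex ^ 'm"
  assumes \<Omega>: "open \<Omega>" and H: "\<And>k. H k \<in> HAP \<Omega>"
    and Cauchy: "\<And>K \<epsilon>. compact K \<Longrightarrow> K \<subseteq> \<Omega> \<Longrightarrow> 0 < \<epsilon> \<Longrightarrow> \<exists>N. \<forall>k\<ge>N. \<forall>m\<ge>N. near K \<epsilon> (H k) (H m)"
  obtains G where "G \<in> HAP \<Omega>" "\<And>K \<epsilon>. compact K \<Longrightarrow> K \<subseteq> \<Omega> \<Longrightarrow> 0 < \<epsilon> \<Longrightarrow> \<exists>N. \<forall>k\<ge>N. near K \<epsilon> (H k) G"
proof -
  define G where "G = (\<lambda>z. \<chi> l. lim (\<lambda>k. H k z $ l))"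
  have lim: "(\<lambda>k. H k z $ l) \<longlonglongrightarrow> G z $ l" if z: "z \<in> tube \<Omega>" for z l
  proof -
    obtain x y where xy: "z = cplx x y" "y \<in> \<Omega>" using z by (rule tubeE)
    have "Cauchy (\<lambda>k. H k z $ l)"
    proof (rule metric_CauchyI)
      fix e :: real assume e: "e > 0"
      have "\<exists>N. \<forall>k\<ge>N. \<forall>m\<ge>N. near {y} (e/2) (H k) (H m)" by (rule Cauchy) (use xy e in auto)
      then obtain N where N: "\<And>k m. k \<ge> N \<Longrightarrow> m \<ge> N \<Longrightarrow> near {y} (e/2) (H k) (H m)" by blast
      have "dist (H k z $ l) (H m z $ l) < e" if "k \<ge> N" "m \<ge> N" for k m
        using nearD[OF N[OF that], of y x l] e by (simp add: xy dist_norm)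
      then show "\<exists>N. \<forall>k\<ge>N. \<forall>m\<ge>N. dist (H k z $ l) (H m z $ l) < e" by blast
    qed
    then have "(\<lambda>k. H k z $ l) \<longlonglongrightarrow> lim (\<lambda>k. H k z $ l)"
      using Cauchy_convergent convergent_LIMSEQ_iff by blast
    then show ?thesis by (simp add: G_def)
  qed
  have near: "\<exists>N. \<forall>k\<ge>N. near K \<epsilon> (H k) G" if K: "compact K" "K \<subseteq> \<Omega>" "0 < \<epsilon>" for K \<epsilon>
  proof -
    obtain N where N: "\<And>k m. k \<ge> N \<Longrightarrow> m \<ge> N \<Longrightarrow> near K \<epsilon> (H k) (H m)" using Cauchy[OF K] by blast
    have "near K \<epsilon> (H k) G" if k: "k \<ge> N" for k
      unfolding near_def
    proof (intro allI ballI)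
      fix x y l assume y: "y \<in> K"
      have "(\<lambda>m. H m (cplx x y) $ l) \<longlonglongrightarrow> G (cplx x y) $ l" by (rule lim) (use y K in auto)
      then have "(\<lambda>m. cmod (H k (cplx x y) $ l - H m (cplx x y) $ l)) \<longlonglongrightarrow> cmod (H k (cplx x y) $ l -
          G (cplx x y) $ l)"
        by (intro tendsto_norm tendsto_diff tendsto_const)
      moreover have "\<forall>\<^sub>F m in sequentially. cmod (H k (cplx x y) $ l - H m (cplx x y) $ l) \<le> \<epsilon>"
        using eventually_ge_at_top[of N] by eventually_elim (rule nearD[OF N[OF k] y])
      ultimately show "cmod (H k (cplx x y) $ l - G (cplx x y) $ l) \<le> \<epsilon>"
        by (rule tendsto_upperbound) simp
    qed
    then show ?thesis by blast
  qed
  have "almost_periodic \<Omega> G"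
    unfolding almost_periodic_def
  proof (intro allI impI)
    fix \<epsilon> :: real and \<Omega>' assume e: "\<epsilon> > 0" and rc: "rel_compact_in \<Omega>' \<Omega>"
    \<comment> \<open>Three errors of \<open>\<epsilon>/4\<close> leave room for the strict
      inequality in the definition of an almost period.\<close>
    have "\<exists>N. \<forall>k\<ge>N. near (closure \<Omega>') (\<epsilon>/4) (H k) G"
      by (rule near) (use rc e in \<open>auto simp: rel_compact_in_def\<close>)
    then obtain k where "near (closure \<Omega>') (\<epsilon>/4) (H k) G" by blast
    then have k: "near \<Omega>' (\<epsilon>/4) (H k) G" by (rule near_mono) (auto simp: closure_subset)
    have "almost_periodic \<Omega> (H k)" using H by (simp add: HAP_def)
    then obtain t :: "real ^ 'n" where t: "\<forall>l. 0 < t $ l"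
      "\<And>\<xi>. \<exists>\<tau>. (\<forall>l. \<bar>\<tau> $ l - \<xi> $ l\<bar> < t $ l) \<and> unif_dist (tube \<Omega>') (\<lambda>z. H k (z + rvec \<tau>)) (H k) <
          ennreal (\<epsilon>/4)"
      unfolding almost_periodic_def using rc e by (meson zero_less_divide_iff zero_less_numeral)
    have "\<exists>\<tau>. (\<forall>l. \<bar>\<tau> $ l - \<xi> $ l\<bar> < t $ l) \<and> unif_dist (tube \<Omega>') (\<lambda>z. G (z + rvec \<tau>)) G < ennreal
        \<epsilon>" for \<xi>
    proof -
      obtain \<tau> where \<tau>: "\<forall>l. \<bar>\<tau> $ l - \<xi> $ l\<bar> < t $ l" "unif_dist (tube \<Omega>') (\<lambda>z. H k (z + rvec \<tau>))
          (H k) < ennreal (\<epsilon>/4)"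
        using t(2) by blast
      have 1: "near \<Omega>' (\<epsilon>/4) (\<lambda>z. G (z + rvec \<tau>)) (\<lambda>z. H k (z + rvec \<tau>))"
        using near_sym[OF k] unfolding near_def by (simp add: cplx_plus_rvec)
      have "near \<Omega>' (\<epsilon>/4 + \<epsilon>/4 + \<epsilon>/4) (\<lambda>z. G (z + rvec \<tau>)) G"
        by (rule near_triangle[OF near_triangle[OF 1 unif_dist_near[OF \<tau>(2)]] k])
      then have "unif_dist (tube \<Omega>') (\<lambda>z. G (z + rvec \<tau>)) G < ennreal \<epsilon>"
        by (rule near_unif_dist) (use e in auto)
      then show ?thesis using \<tau>(1) by blast
    qed
    then show "\<exists>t::real ^ 'n. (\<forall>l. 0 < t $ l) \<and> (\<forall>\<xi>. \<exists>\<tau>. (\<forall>l. \<bar>\<tau> $ l - \<xi> $ l\<bar> < t $ l) \<and>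
        unif_dist (tube \<Omega>') (\<lambda>z. G (z + rvec \<tau>)) G < ennreal \<epsilon>)"
      using t(1) by blast
  qed
  moreover have "holomorphic_map G (tube \<Omega>)"
    unfolding holomorphic_map_def
  proof
    fix z0 assume z0: "z0 \<in> tube \<Omega>"
    then obtain x0 y0 where xy0: "z0 = cplx x0 y0" "y0 \<in> \<Omega>" by (rule tubeE)
    obtain R where R: "R > 0" "cball y0 R \<subseteq> \<Omega>" using \<Omega> xy0(2) open_contains_cball by blast
    \<comment> \<open>With half the radius, discs of radius \<open>\<rho>\<close> about points of
      the ball \<open>S\<close> stay over the compact set \<open>K\<close>.\<close>
    define \<rho> where "\<rho> = R / 2"
    have \<rho>: "\<rho> > 0" using R by (simp add: \<rho>_def)
    define K where "K = cball y0 R"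
    have K: "compact K" "K \<subseteq> \<Omega>" using R by (simp_all add: K_def)
    define S where "S = ball z0 \<rho>"
    have S: "convex S" "open S" "z0 \<in> S" using \<rho> by (simp_all add: S_def)
    have tubeK: "z \<in> tube K" if "dist z0 z \<le> R" for z
    proof -
      define x y where "x = (\<chi> j. Re (z $ j))" and "y = (\<chi> j. Im (z $ j))"
      have z: "z = cplx x y" by (simp add: cplx_def x_def y_def)
      have "norm (y - y0) \<le> norm (cplx x y - cplx x0 y0)" by (rule norm_imaginary_part_le)
      then have "dist y0 y \<le> R" using that by (simp add: dist_norm norm_minus_commute z xy0)
      then show ?thesis by (simp add: z K_def)
    qed
    have cb: "cball z \<rho> \<subseteq> tube K" if "z \<in> S" for z
    proof
      fix w assume w: "w \<in> cball z \<rho>"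
      have "dist z0 w \<le> R" using dist_triangle[of z0 w z] that w by (simp add: S_def \<rho>_def)
      then show "w \<in> tube K" by (rule tubeK)
    qed
    have S\<Omega>: "z \<in> tube \<Omega>" if "z \<in> S" for z
    proof -
      have "z \<in> tube K" using cb[OF that] \<rho> by auto
      then show ?thesis using K(2) by (auto elim!: tubeE)
    qed
    have hol: "holomorphic_map (H k) (tube \<Omega>)" for k using H by (simp add: HAP_def)
    define L where "L = (\<lambda>k z. SOME L. (H k has_derivative L) (at z) \<and> (\<forall>c v. L (c *s v) = c *s L v))"
    have L: "(H k has_derivative L k z) (at z)" "L k z (c *s v) = c *s L k z v" if "z \<in> S" for k z c v
    proof -
      have "\<exists>L. (H k has_derivative L) (at z) \<and> (\<forall>c v. L (c *s v) = c *s L v)"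
        using hol S\<Omega>[OF that] unfolding holomorphic_map_def by blast
      from someI_ex[OF this] show "(H k has_derivative L k z) (at z)" "L k z (c *s v) = c *s L k z v"
        unfolding L_def by blast+
    qed
    have Lclose: "cmod (L k z h $ l - L m z h $ l) \<le> \<epsilon> / \<rho> * norm h" if "near K \<epsilon> (H k) (H m)" "z
        \<in> S" for k m z h l \<epsilon>
      by (rule derivative_difference_bound[OF hol hol \<rho> cb[OF that(2)] K(2) that(1)]) (rule L[OF
          that(2)])+
    define g' where "g' = (\<lambda>z h. \<chi> l. lim (\<lambda>k. L k z h $ l))"
    have g': "(\<lambda>k. L k z h $ l) \<longlonglongrightarrow> g' z h $ l" if z: "z \<in> S" for z h l
    proof -
      have "Cauchy (\<lambda>k. L k z h $ l)"
      proof (rule metric_CauchyI)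
        fix e :: real assume e: "e > 0"
        define e' where "e' = e * \<rho> / (norm h + 1)"
        have e': "e' > 0" using e \<rho> by (simp add: e'_def add_nonneg_pos)
        obtain N where N: "\<And>k m. k \<ge> N \<Longrightarrow> m \<ge> N \<Longrightarrow> near K e' (H k) (H m)" using Cauchy[OF K e'] by blast
        have "e' / \<rho> * norm h < e"
        proof -
          have "e' / \<rho> * norm h = e * (norm h / (norm h + 1))" using \<rho> by (simp add: e'_def)
          also have "\<dots> < e * 1" using e by (intro mult_strict_left_mono) (simp_all add: add_nonneg_pos)
          finally show ?thesis by simp
        qed
        then have "dist (L k z h $ l) (L m z h $ l) < e" if "k \<ge> N" "m \<ge> N" for k m
          using Lclose[OF N[OF that] z, of h l] by (simp add: dist_norm)
        then show "\<exists>N. \<forall>k\<ge>N. \<forall>m\<ge>N. dist (L k z h $ l) (L m z h $ l) < e" by blast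
      qed
      then have "(\<lambda>k. L k z h $ l) \<longlonglongrightarrow> lim (\<lambda>k. L k z h $ l)"
        using Cauchy_convergent convergent_LIMSEQ_iff by blast
      then show ?thesis by (simp add: g'_def)
    qed
    have unif: "\<forall>\<^sub>F k in sequentially. \<forall>z\<in>S. \<forall>h. norm (L k z h - g' z h) \<le> e * norm h" if e: "e >
        0" for e
    proof -
      \<comment> \<open>The factor \<open>\<rho>\<close> compensates Cauchy's inequality, and the
        number of components enters because the norm is estimated by the sum over the
        components.\<close>
      define e' where "e' = e * \<rho> / real CARD('m)"
      have e': "e' > 0" using e \<rho> by (simp add: e'_def)
      obtain N where N: "\<And>k m. k \<ge> N \<Longrightarrow> m \<ge> N \<Longrightarrow> near K e' (H k) (H m)" using Cauchy[OF K e'] by blast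
      show ?thesis
      proof (rule eventually_sequentiallyI[of N], intro ballI allI)
        fix k z h assume k: "k \<ge> N" and z: "z \<in> S"
        have comp: "cmod (L k z h $ l - g' z h $ l) \<le> e' / \<rho> * norm h" for l
        proof (rule tendsto_upperbound)
          show "(\<lambda>m. cmod (L k z h $ l - L m z h $ l)) \<longlonglongrightarrow> cmod (L k z h $ l - g' z h $ l)"
            by (intro tendsto_intros g'[OF z])
          show "\<forall>\<^sub>F m in sequentially. cmod (L k z h $ l - L m z h $ l) \<le> e' / \<rho> * norm h"
            using eventually_ge_at_top[of N] by eventually_elim (rule Lclose[OF N[OF k] z])
        qed simp
        have "norm (L k z h - g' z h) \<le> (\<Sum>l\<in>UNIV. cmod ((L k z h - g' z h) $ l))" by (rule
            norm_le_sum_components)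
        also have "\<dots> \<le> (\<Sum>l\<in>(UNIV :: 'm set). e' / \<rho> * norm h)" by (rule sum_mono) (simp only:
            vector_minus_component comp)
        also have "\<dots> = e * norm h" using \<rho> by (simp add: e'_def)
        finally show "norm (L k z h - g' z h) \<le> e * norm h" .
      qed
    qed
    have "(\<lambda>k. H k z0) \<longlonglongrightarrow> G z0" by (rule vec_tendstoI) (rule lim[OF z0])
    from has_derivative_sequence[OF S(1) has_derivative_at_withinI[OF L(1)] unif S(3) this]
    obtain g where g: "\<And>x. x \<in> S \<Longrightarrow> (\<lambda>n. H n x) \<longlonglongrightarrow> g x" "\<And>x. x \<in> S \<Longrightarrow> (g has_derivative g' x) (at x
        within S)"
      by blast
    have gG: "g x = G x" if "x \<in> S" for x
    proof (rule LIMSEQ_unique[OF g(1)[OF that]])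
      show "(\<lambda>n. H n x) \<longlonglongrightarrow> G x" by (rule vec_tendstoI) (rule lim[OF S\<Omega>[OF that]])
    qed
    have "(g has_derivative g' z0) (at z0)" using g(2)[OF S(3)] at_within_open[OF S(3,2)] by simp
    then have "(G has_derivative g' z0) (at z0)"
      by (rule has_derivative_transform_within_open[OF _ S(2,3) gG])
    moreover have "g' z0 (c *s v) = c *s g' z0 v" for c v
    proof -
      have "g' z0 (c *s v) $ l = c * g' z0 v $ l" for l
      proof (rule LIMSEQ_unique[OF g'[OF S(3)]])
        have "(\<lambda>k. c * L k z0 v $ l) \<longlonglongrightarrow> c * g' z0 v $ l" by (intro tendsto_intros g'[OF S(3)])
        then show "(\<lambda>k. L k z0 (c *s v) $ l) \<longlonglongrightarrow> c * g' z0 v $ l" by (simp add: L(2)[OF S(3)])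
      qed
      then show ?thesis by (simp add: vec_eq_iff)
    qed
    ultimately show "\<exists>L. (G has_derivative L) (at z0) \<and> (\<forall>c v. L (c *s v) = c *s L v)" by blast
  qed
  ultimately have "restrict G (tube \<Omega>) \<in> HAP \<Omega>" by (intro HAP_restrictI[OF \<Omega>])
  moreover have "near K \<epsilon> (H k) (restrict G (tube \<Omega>)) \<longleftrightarrow> near K \<epsilon> (H k) G" if "K \<subseteq> \<Omega>" for K \<epsilon> k
  proof -
    have "restrict G (tube \<Omega>) (cplx x y) = G (cplx x y)" if "y \<in> K" for x y
      using that \<open>K \<subseteq> \<Omega>\<close> by (auto simp: restrict_def)
    then show ?thesis by (simp add: near_def)
  qed
  ultimately show thesis using near by (intro that[of "restrict G (tube \<Omega>)"]) auto
qed

text \<open>A real translation by \<open>t\<close> acts on coefficients as the character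
  \<open>\<mu> \<mapsto> cis (t \<bullet> \<mu>)\<close>. This is the bridge between translates and
  perturbations.\<close>

lemma translate_fourier_coeff:
  fixes F :: "complex ^ 'n \<Rightarrow> complex ^ 'm"
  assumes F: "F \<in> HAP \<Omega>" and \<Omega>: "open \<Omega>" "convex \<Omega>" "\<Omega> \<noteq> {}"
  shows "fourier_coeff \<Omega> \<mu> (\<lambda>z. restrict (\<lambda>z. F (z + rvec t)) (tube \<Omega>) z $ l) =
    cis (t \<bullet> \<mu>) * fourier_coeff \<Omega> \<mu> (\<lambda>z. F z $ l)"
proof -
  obtain y where y: "y \<in> \<Omega>" using \<Omega> by blast
  let ?q = "\<lambda>x. exp (- (\<i> * herm (cplx x y) (rvec \<mu>))) * F (cplx x y) $ l"
  have e: "exp (- (\<i> * herm (cplx x y) (rvec \<mu>))) * restrict (\<lambda>z. F (z + rvec t)) (tube \<Omega>) (cplx x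
      y) $ l =
      cis (t \<bullet> \<mu>) * ?q (x + t)" for x
  proof -
    have "cis (x \<bullet> (- \<mu>)) = cis (t \<bullet> \<mu>) * cis ((x + t) \<bullet> (- \<mu>))" by (simp add: cis_mult inner_add_left)
    then have "exp (- (\<i> * herm (cplx x y) (rvec \<mu>))) = cis (t \<bullet> \<mu>) * exp (- (\<i> * herm (cplx (x +
        t) y) (rvec \<mu>)))"
      unfolding exp_neg_herm by (simp only: mult_ac)
    then show ?thesis using y by (simp add: cplx_plus_rvec)
  qed
  have q: "ap ?q" by (rule HAP_coeff_integrand_ap[OF F y])
  show ?thesis
    unfolding HAP_fourier_coeff[OF translate_HAP[OF F \<Omega>(1)] \<Omega>(1,2) y] HAP_fourier_coeff[OF F \<Omega>(1,2) y] e
      mean_cmult[OF ap_translate[OF q]] mean_translate[OF q] ..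
qed

text \<open>Each coefficient depends continuously on the mapping, already through its values over a
  single imaginary part. The factor is the modulus of the exponential in the integrand.\<close>

lemma fourier_coeff_near:
  fixes F G :: "complex ^ 'n \<Rightarrow> complex ^ 'm"
  assumes F: "F \<in> HAP \<Omega>" and G: "G \<in> HAP \<Omega>" and \<Omega>: "open \<Omega>" "convex \<Omega>" and y: "y \<in> \<Omega>"
    and nr: "near {y} \<epsilon> F G"
  shows "cmod (fourier_coeff \<Omega> \<mu> (\<lambda>z. F z $ l) - fourier_coeff \<Omega> \<mu> (\<lambda>z. G z $ l)) \<le> exp (y \<bullet> \<mu>) * \<epsilon>"
proof -
  let ?h = "\<lambda>x. exp (- (\<i> * herm (cplx x y) (rvec \<mu>)))"
  have a: "ap (\<lambda>x. ?h x * F (cplx x y) $ l)" "ap (\<lambda>x. ?h x * G (cplx x y) $ l)"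
    by (rule HAP_coeff_integrand_ap[OF F y], rule HAP_coeff_integrand_ap[OF G y])
  have "cmod (mean (\<lambda>x. ?h x * F (cplx x y) $ l - ?h x * G (cplx x y) $ l)) \<le> exp (y \<bullet> \<mu>) * \<epsilon>"
  proof (rule mean_norm[OF ap_diff[OF a]])
    fix x
    have "cmod (?h x * F (cplx x y) $ l - ?h x * G (cplx x y) $ l) = cmod (?h x) * cmod (F (cplx x
        y) $ l - G (cplx x y) $ l)"
      by (simp only: right_diff_distrib[symmetric] norm_mult)
    also have "\<dots> = exp (y \<bullet> \<mu>) * cmod (F (cplx x y) $ l - G (cplx x y) $ l)"
      by (simp add: exp_neg_herm norm_mult)
    also have "\<dots> \<le> exp (y \<bullet> \<mu>) * \<epsilon>" using nearD[OF nr, of y x l] by (intro mult_left_mono) auto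
    finally show "cmod (?h x * F (cplx x y) $ l - ?h x * G (cplx x y) $ l) \<le> exp (y \<bullet> \<mu>) * \<epsilon>" .
  qed
  then show ?thesis
    unfolding HAP_fourier_coeff[OF F \<Omega> y] HAP_fourier_coeff[OF G \<Omega> y] mean_diff[OF a] .
qed

section \<open>Perturbations by characters\<close>

lemma perturbed_bochner_fejer_eq:
  fixes F :: "complex ^ 'n \<Rightarrow> complex ^ 'm"
  assumes "\<Omega> \<noteq> {}"
  shows "perturbed_bochner_fejer \<Omega> \<omega> d \<gamma> F j = restrict (\<lambda>z. \<chi> l. \<Sum>\<nu>\<in>bf_exponents d j.
    (complex_of_real (bf_weight d j \<nu>) * fourier_coeff \<Omega> (bf_freq \<omega> d j \<nu>) (\<lambda>z. F z $ l) * \<gamma>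
        (bf_freq \<omega> d j \<nu>)) *
    exp (\<i> * herm z (rvec (bf_freq \<omega> d j \<nu>)))) (tube \<Omega>)"
proof -
  have bf: "bochner_fejer \<Omega> \<omega> d j f = (\<lambda>z. \<Sum>\<nu>\<in>bf_exponents d j. (complex_of_real (bf_weight d j \<nu>) *
     fourier_coeff \<Omega> (bf_freq \<omega> d j \<nu>) f) * exp (\<i> * herm z (rvec (bf_freq \<omega> d j \<nu>))))" for f
    by (rule ext) (rule bochner_fejer_eq)
  show ?thesis
    unfolding perturbed_bochner_fejer_def bf perturb_exponential_sum[OF assms finite_bf_exponents] ..
qed

text \<open>By \<open>twist\<close> the perturbed sums of \<open>F\<close> are the Bochner-Fejer
  sums of \<open>G\<close> in the same basis. That basis is admissible for \<open>G\<close> because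
  \<open>\<gamma>\<close> has no zeros, so both mappings have the same spectra.\<close>

lemma perturbed_bochner_fejer_limit:
  fixes F G :: "complex ^ 'n \<Rightarrow> complex ^ 'm"
  assumes F: "F \<in> HAP \<Omega>" and G: "G \<in> HAP \<Omega>" and \<Omega>: "open \<Omega>" "convex \<Omega>" "\<Omega> \<noteq> {}"
    and \<gamma>: "\<gamma> \<in> characters"
    and twist: "\<And>\<mu> l. fourier_coeff \<Omega> \<mu> (\<lambda>z. G z $ l) = \<gamma> \<mu> * fourier_coeff \<Omega> \<mu> (\<lambda>z. F z $ l)"
    and basis: "is_rat_basis \<omega> d (ratvec.span (spectral_group \<Omega> F))"
  shows "limitin (hap_topology \<Omega>) (perturbed_bochner_fejer \<Omega> \<omega> d \<gamma> F) G sequentially"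
proof (rule limitin_hapI[OF G])
  show "perturbed_bochner_fejer \<Omega> \<omega> d \<gamma> F j \<in> HAP \<Omega>" for j
    unfolding perturbed_bochner_fejer_eq[OF \<Omega>(3)] by (rule exponential_sum_HAP[OF \<Omega>(1)
        finite_bf_exponents])
  fix K and \<epsilon> :: real assume K: "compact K" "K \<subseteq> \<Omega>" "0 < \<epsilon>"
  have nz: "\<gamma> \<mu> \<noteq> 0" for \<mu>
  proof -
    have "cmod (\<gamma> \<mu>) = 1" using \<gamma> unfolding characters_def by blast
    then show ?thesis by auto
  qed
  have sp: "spectrum \<Omega> (\<lambda>z. G z $ l) \<subseteq> ratvec.span (spectral_group \<Omega> F)" for l
  proof -
    have "spectrum \<Omega> (\<lambda>z. G z $ l) = spectrum \<Omega> (\<lambda>z. F z $ l)" unfolding spectrum_def twist using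
        nz by simp
    also have "\<dots> \<subseteq> (\<Union>l. spectrum \<Omega> (\<lambda>z. F z $ l))" by (rule UN_upper) simp
    also have "\<dots> \<subseteq> ratvec.span (spectral_group \<Omega> F)"
      unfolding spectral_group_def span_group_closure by (rule subsetI) (rule ratvec.span_base)
    finally show ?thesis .
  qed
  have "\<forall>\<^sub>F j in sequentially. \<forall>l\<in>UNIV. \<forall>x. \<forall>y\<in>K.
      cmod (bochner_fejer \<Omega> \<omega> d j (\<lambda>z. G z $ l) (cplx x y) - G (cplx x y) $ l) \<le> \<epsilon>"
    by (intro eventually_ball_finite ballI finite)
      (rule bochner_fejer_converges[OF G \<Omega>(1,2) K basis sp])
  then show "\<forall>\<^sub>F j in sequentially. near K \<epsilon> (perturbed_bochner_fejer \<Omega> \<omega> d \<gamma> F j) G"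
  proof eventually_elim
    case (elim j)
    have "perturbed_bochner_fejer \<Omega> \<omega> d \<gamma> F j (cplx x y) $ l = bochner_fejer \<Omega> \<omega> d j (\<lambda>z. G z $ l)
        (cplx x y)"
      if "y \<in> K" for x y l
    proof -
      have "cplx x y \<in> tube \<Omega>" using that K(2) by auto
      then show ?thesis
        unfolding perturbed_bochner_fejer_eq[OF \<Omega>(3)] bochner_fejer_eq twist
        by (simp add: mult_ac)
    qed
    then show ?case using elim by (simp add: near_def)
  qed
qed

text \<open>For every rational basis the perturbed sums converge to the same \<open>G\<close>, so
  uniqueness of limits makes any other candidate in the definite description equal to
  \<open>G\<close>. Countability of the spectrum ensures that a basis exists at all.\<close>

lemma perturb_eqI:
  fixes F G :: "complex ^ 'n \<Rightarrow> complex ^ 'm"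
  assumes F: "F \<in> HAP \<Omega>" and G: "G \<in> HAP \<Omega>" and \<Omega>: "open \<Omega>" "convex \<Omega>" "\<Omega> \<noteq> {}"
    and \<gamma>: "\<gamma> \<in> characters"
    and twist: "\<And>\<mu> l. fourier_coeff \<Omega> \<mu> (\<lambda>z. G z $ l) = \<gamma> \<mu> * fourier_coeff \<Omega> \<mu> (\<lambda>z. F z $ l)"
  shows "perturb \<Omega> F \<gamma> = G"
  unfolding perturb_def
proof (rule the_equality)
  note lim = perturbed_bochner_fejer_limit[OF F G \<Omega> \<gamma> twist]
  have "countable (\<Union>l. spectrum \<Omega> (\<lambda>z. F z $ l))"
    by (intro countable_UN HAP_spectrum_countable[OF F \<Omega>]) auto
  then obtain \<omega> d where "is_rat_basis \<omega> d (ratvec.span (\<Union>l. spectrum \<Omega> (\<lambda>z. F z $ l)))"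
    by (rule rat_basis_exists)
  then have basis: "is_rat_basis \<omega> d (ratvec.span (spectral_group \<Omega> F))"
    unfolding spectral_group_def span_group_closure .
  show "\<exists>\<omega> d. is_rat_basis \<omega> d (ratvec.span (spectral_group \<Omega> F)) \<and>
      limitin (hap_topology \<Omega>) (perturbed_bochner_fejer \<Omega> \<omega> d \<gamma> F) G sequentially"
    using basis lim[OF basis] by blast
  fix G' assume "\<exists>\<omega> d. is_rat_basis \<omega> d (ratvec.span (spectral_group \<Omega> F)) \<and>
      limitin (hap_topology \<Omega>) (perturbed_bochner_fejer \<Omega> \<omega> d \<gamma> F) G' sequentially"
  then obtain \<omega>' d' where "is_rat_basis \<omega>' d' (ratvec.span (spectral_group \<Omega> F))"
      "limitin (hap_topology \<Omega>) (perturbed_bochner_fejer \<Omega> \<omega>' d' \<gamma> F) G' sequentially" by blast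
  then show "G' = G" using lim hap_limit_unique by blast
qed

text \<open>The product of circles over all frequencies is compact by Tychonoff, so the waves have a
  cluster point. Since the index set is uncountable, no convergent subsequence can be expected;
  approximation on finite sets beyond any index is what a cluster point provides. Multiplicativity
  involves only three frequencies at a time and therefore passes to \<open>\<gamma>\<close>.\<close>

lemma character_limit_of_waves:
  fixes t :: "nat \<Rightarrow> real ^ 'n"
  obtains \<gamma> where "\<gamma> \<in> characters"
    "\<And>M e N. finite M \<Longrightarrow> 0 < e \<Longrightarrow> \<exists>n\<ge>N. \<forall>\<mu>\<in>M. cmod (cis (t n \<bullet> \<mu>) - \<gamma> \<mu>) < e"
proof -
  define w where "w = (\<lambda>n \<mu>. cis (t n \<bullet> \<mu>))"
  define X where "X = (UNIV :: (real ^ 'n) set) \<rightarrow>\<^sub>E sphere (0::complex) 1"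
  define Fl where "Fl = filtermap w sequentially"
  have wX: "w n \<in> X" for n by (simp add: X_def w_def PiE_iff)
  have "compactin (product_topology (\<lambda>_. euclidean) UNIV) X"
    unfolding X_def compactin_PiE by simp
  then have "compact X" by (simp add: euclidean_product_topology)
  moreover have "Fl \<noteq> bot" by (simp add: Fl_def filtermap_bot_iff)
  moreover have "eventually (\<lambda>f. f \<in> X) Fl" unfolding Fl_def eventually_filtermap by (simp add: wX)
  ultimately obtain \<gamma> where \<gamma>: "\<gamma> \<in> X" "inf (nhds \<gamma>) Fl \<noteq> bot" unfolding compact_filter by blast
  have approx: "\<exists>n\<ge>N. \<forall>\<mu>\<in>M. cmod (cis (t n \<bullet> \<mu>) - \<gamma> \<mu>) < e" if M: "finite M" "0 < e" for M e N
  proof (rule ccontr)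
    assume no: "\<not> ?thesis"
    let ?Q = "\<lambda>f. \<forall>\<mu>\<in>M. cmod (f \<mu> - \<gamma> \<mu>) < e"
    have "open {f. \<forall>\<mu>\<in>M. f \<mu> \<in> ball (\<gamma> \<mu>) e}" by (rule product_topology_basis'[OF M(1)]) simp
    then have "\<forall>\<^sub>F f in nhds \<gamma>. f \<in> {f. \<forall>\<mu>\<in>M. f \<mu> \<in> ball (\<gamma> \<mu>) e}"
      by (rule eventually_nhds_in_open) (simp add: M(2))
    then have 1: "eventually ?Q (nhds \<gamma>)" by (simp add: dist_norm norm_minus_commute)
    have "\<forall>\<^sub>F n in sequentially. \<not> ?Q (w n)"
      using eventually_ge_at_top[of N] by eventually_elim (use no in \<open>auto simp: w_def\<close>)
    then have 2: "eventually (\<lambda>f. \<not> ?Q f) Fl" unfolding Fl_def eventually_filtermap .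
    have "eventually (\<lambda>f. False) (inf (nhds \<gamma>) Fl)"
      unfolding eventually_inf by (rule exI[of _ ?Q], rule exI[of _ "\<lambda>f. \<not> ?Q f"]) (intro conjI 1
          2, blast)
    then show False using \<gamma>(2) by (simp add: trivial_limit_def)
  qed
  have "\<gamma> \<in> characters"
    unfolding characters_def
  proof (intro CollectI conjI allI)
    show g1: "cmod (\<gamma> \<mu>) = 1" for \<mu> using \<gamma>(1) by (auto simp: X_def)
    fix \<mu> \<nu>
    have "cmod (\<gamma> (\<mu> + \<nu>) - \<gamma> \<mu> * \<gamma> \<nu>) \<le> e" if e: "e > 0" for e
    proof -
      obtain n where n: "\<forall>\<kappa>\<in>{\<mu>, \<nu>, \<mu> + \<nu>}. cmod (cis (t n \<bullet> \<kappa>) - \<gamma> \<kappa>) < e/3"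
        using approx[of "{\<mu>, \<nu>, \<mu> + \<nu>}" "e/3" 0] e by auto
      let ?a = "cis (t n \<bullet> \<mu>)" and ?b = "cis (t n \<bullet> \<nu>)"
      have ab: "cis (t n \<bullet> (\<mu> + \<nu>)) = ?a * ?b" by (simp add: cis_mult inner_add_right)
      have 1: "cmod (\<gamma> (\<mu> + \<nu>) - ?a * ?b) \<le> e/3" using n ab by (simp add: norm_minus_commute less_imp_le)
      have 2: "cmod (?a * ?b - ?a * \<gamma> \<nu>) \<le> e/3"
        using n by (simp add: norm_mult less_imp_le flip: right_diff_distrib)
      have 3: "cmod (?a * \<gamma> \<nu> - \<gamma> \<mu> * \<gamma> \<nu>) \<le> e/3"
        using n g1[of \<nu>] by (simp add: norm_mult less_imp_le flip: left_diff_distrib)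
      show ?thesis using norm_diff_triangle_le[OF norm_diff_triangle_le[OF 1 2] 3] by simp
    qed
    then have "cmod (\<gamma> (\<mu> + \<nu>) - \<gamma> \<mu> * \<gamma> \<nu>) \<le> 0 + e" if "e > 0" for e using that by simp
    then have "cmod (\<gamma> (\<mu> + \<nu>) - \<gamma> \<mu> * \<gamma> \<nu>) \<le> 0" by (rule field_le_epsilon)
    then show "\<gamma> (\<mu> + \<nu>) = \<gamma> \<mu> * \<gamma> \<nu>" by simp
  qed
  then show thesis using that[of \<gamma>] approx by blast
qed

text \<open>An exhaustion of \<open>\<Omega>\<close> by compact sets turns membership in the closure
  into a sequence of translates approaching \<open>G\<close>. Their coefficients are those of
  \<open>F\<close> times waves, so a cluster character of these waves relates the coefficients of
  \<open>G\<close> to those of \<open>F\<close>.\<close>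

lemma closure_imp_twist:
  fixes F G :: "complex ^ 'n \<Rightarrow> complex ^ 'm"
  assumes F: "F \<in> HAP \<Omega>" and \<Omega>: "open \<Omega>" "convex \<Omega>" "\<Omega> \<noteq> {}"
    and G: "G \<in> hap_topology \<Omega> closure_of bochner_transform \<Omega> F"
  obtains \<gamma> where "\<gamma> \<in> characters"
    "\<And>\<mu> l. fourier_coeff \<Omega> \<mu> (\<lambda>z. G z $ l) = \<gamma> \<mu> * fourier_coeff \<Omega> \<mu> (\<lambda>z. F z $ l)"
proof -
  obtain C where C: "\<And>n. compact (C n)" "\<And>n. C n \<subseteq> \<Omega>" "\<And>n. C n \<subseteq> interior (C (Suc n))" "\<Union>(range C) = \<Omega>"
    "\<And>K. compact K \<Longrightarrow> K \<subseteq> \<Omega> \<Longrightarrow> \<exists>N. \<forall>n\<ge>N. K \<subseteq> C n"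
    by (rule open_Union_compact_subsets[OF \<Omega>(1)]) (rule that)
  let ?H = "\<lambda>t. restrict (\<lambda>z. F (z + rvec t)) (tube \<Omega>)"
  have GH: "G \<in> HAP \<Omega>" using G unfolding hap_closure_iff by blast
  have "\<forall>n. \<exists>t. near (C n) (inverse (real (Suc n))) (?H t) G"
  proof
    fix n
    have "\<exists>H\<in>bochner_transform \<Omega> F. H \<in> HAP \<Omega> \<and> near (C n) (inverse (real (Suc n))) H G"
      using G C(1,2)[of n] unfolding hap_closure_iff by simp
    then show "\<exists>t. near (C n) (inverse (real (Suc n))) (?H t) G" unfolding bochner_transform_def by blast
  qed
  from choice[OF this] obtain t where t: "\<forall>n. near (C n) (inverse (real (Suc n))) (?H (t n)) G"
    by (elim exE) (rule that)
  obtain \<gamma> where \<gamma>: "\<gamma> \<in> characters"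
    "\<And>M e N. finite M \<Longrightarrow> 0 < e \<Longrightarrow> \<exists>n\<ge>N. \<forall>\<mu>\<in>M. cmod (cis (t n \<bullet> \<mu>) - \<gamma> \<mu>) < e"
    by (rule character_limit_of_waves[of t]) (rule that)
  obtain y where y: "y \<in> \<Omega>" using \<Omega>(3) by blast
  obtain N0 where N0: "\<forall>n\<ge>N0. {y} \<subseteq> C n" using C(5)[of "{y}"] y by auto
  have "fourier_coeff \<Omega> \<mu> (\<lambda>z. G z $ l) = \<gamma> \<mu> * fourier_coeff \<Omega> \<mu> (\<lambda>z. F z $ l)" for \<mu> l
  proof -
    let ?a = "fourier_coeff \<Omega> \<mu> (\<lambda>z. F z $ l)" and ?g = "fourier_coeff \<Omega> \<mu> (\<lambda>z. G z $ l)"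
    have "cmod (?g - \<gamma> \<mu> * ?a) \<le> e" if e: "e > 0" for e
    proof -
      define e1 where "e1 = e / (2 * exp (y \<bullet> \<mu>))"
      have e1: "e1 > 0" using e by (simp add: e1_def)
      obtain N1 where N1: "inverse (real (Suc N1)) < e1" using reals_Archimedean[OF e1] by blast
      define e2 where "e2 = e / (2 * (cmod ?a + 1))"
      have e2: "e2 > 0" using e by (simp add: e2_def add_nonneg_pos)
      \<comment> \<open>A single \<open>n\<close> must serve both approximations. The cluster
        property supplies one beyond any bound, although the waves themselves need not
        converge.\<close>
      obtain n where n: "n \<ge> max N0 N1" "\<forall>\<kappa>\<in>{\<mu>}. cmod (cis (t n \<bullet> \<kappa>) - \<gamma> \<kappa>) < e2"
        using \<gamma>(2)[of "{\<mu>}" e2 "max N0 N1"] e2 by auto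
      have "inverse (real (Suc n)) \<le> inverse (real (Suc N1))" using n(1) by simp
      then have le: "inverse (real (Suc n)) \<le> e1" using N1 by linarith
      have "near {y} e1 (?H (t n)) G"
        by (rule near_mono[OF spec[OF t] _ le]) (use N0 n(1) in simp)
      from fourier_coeff_near[OF GH translate_HAP[OF F \<Omega>(1)] \<Omega>(1,2) y near_sym[OF this], of \<mu> l]
      have 1: "cmod (?g - cis (t n \<bullet> \<mu>) * ?a) \<le> exp (y \<bullet> \<mu>) * e1"
        unfolding translate_fourier_coeff[OF F \<Omega>] .
      have 2: "cmod (cis (t n \<bullet> \<mu>) * ?a - \<gamma> \<mu> * ?a) \<le> e2 * (cmod ?a + 1)"
        unfolding left_diff_distrib[symmetric] norm_mult
        using n(2) e2 by (intro mult_mono) auto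
      have "cmod (?g - \<gamma> \<mu> * ?a) \<le> exp (y \<bullet> \<mu>) * e1 + e2 * (cmod ?a + 1)"
        by (rule norm_diff_triangle_le[OF 1 2])
      also have "\<dots> = e"
      proof -
        have c: "e / (2 * c) * c = e / 2" if "c \<noteq> 0" for c using that by simp
        have "cmod ?a + 1 \<noteq> 0" using norm_ge_zero[of ?a] by linarith
        then have "e2 * (cmod ?a + 1) = e / 2" unfolding e2_def by (rule c)
        then show ?thesis by (simp add: e1_def)
      qed
      finally show ?thesis .
    qed
    then have "cmod (?g - \<gamma> \<mu> * ?a) \<le> 0 + e" if "e > 0" for e using that by simp
    then have "cmod (?g - \<gamma> \<mu> * ?a) \<le> 0" by (rule field_le_epsilon)
    then show ?thesis by simp
  qed
  then show thesis using that \<gamma>(1) by blast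
qed

text \<open>At stage \<open>n\<close> Kronecker's theorem treats the first \<open>n + 1\<close>
  members of an enumeration with tolerance \<open>1 / (n + 1)\<close>, so each frequency is treated
  from some stage on.\<close>

lemma character_sequence:
  fixes S :: "(real ^ 'n) set"
  assumes "countable S" "\<gamma> \<in> characters"
  obtains t where "\<And>\<mu>. \<mu> \<in> S \<Longrightarrow> (\<lambda>n. cis (t n \<bullet> \<mu>)) \<longlonglongrightarrow> \<gamma> \<mu>"
proof -
  \<comment> \<open>The inserted 0 makes the enumerated set nonempty, so that it is exactly the
    range of \<open>g\<close>.\<close>
  define g where "g = from_nat_into (insert 0 S)"
  have g: "range g = insert 0 S" unfolding g_def using assms(1) by (intro range_from_nat_into) auto
  have "\<forall>n. \<exists>t. \<forall>\<mu>\<in>g ` {..n}. cmod (cis (t \<bullet> \<mu>) - \<gamma> \<mu>) < inverse (real (Suc n))"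
  proof
    fix n
    show "\<exists>t. \<forall>\<mu>\<in>g ` {..n}. cmod (cis (t \<bullet> \<mu>) - \<gamma> \<mu>) < inverse (real (Suc n))"
      by (rule kronecker_characters[OF assms(2), of "g ` {..n}" "inverse (real (Suc n))"]) auto
  qed
  from choice[OF this] obtain t where t: "\<forall>n. \<forall>\<mu>\<in>g ` {..n}. cmod (cis (t n \<bullet> \<mu>) - \<gamma> \<mu>) < inverse
      (real (Suc n))"
    by (elim exE) (rule that)
  show thesis
  proof (rule that[of t])
    fix \<mu> assume "\<mu> \<in> S"
    then obtain k where k: "\<mu> = g k" using g by blast
    have "(\<lambda>n. cis (t n \<bullet> \<mu>) - \<gamma> \<mu>) \<longlonglongrightarrow> 0"
    proof (rule Lim_null_comparison[OF _ LIMSEQ_inverse_real_of_nat])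
      show "\<forall>\<^sub>F n in sequentially. cmod (cis (t n \<bullet> \<mu>) - \<gamma> \<mu>) \<le> inverse (real (Suc n))"
        using eventually_ge_at_top[of k]
      proof eventually_elim
        case (elim n)
        then have "\<mu> \<in> g ` {..n}" using k by simp
        then show ?case using t less_imp_le by blast
      qed
    qed
    then show "(\<lambda>n. cis (t n \<bullet> \<mu>)) \<longlonglongrightarrow> \<gamma> \<mu>" by (simp add: LIM_zero_iff)
  qed
qed

text \<open>Translations along which the waves tend to \<open>\<gamma>\<close> on the spectrum
  produce a Cauchy sequence of translates, because the approximating exponential sums have
  frequencies in the spectrum only. Completeness gives \<open>G\<close>, and its coefficients are
  the limits of those of the translates.\<close>

lemma character_imp_closure:
  fixes F :: "complex ^ 'n \<Rightarrow> complex ^ 'm"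
  assumes F: "F \<in> HAP \<Omega>" and \<Omega>: "open \<Omega>" "convex \<Omega>" "\<Omega> \<noteq> {}" and \<gamma>: "\<gamma> \<in> characters"
  obtains G where "G \<in> hap_topology \<Omega> closure_of bochner_transform \<Omega> F"
    "\<And>\<mu> l. fourier_coeff \<Omega> \<mu> (\<lambda>z. G z $ l) = \<gamma> \<mu> * fourier_coeff \<Omega> \<mu> (\<lambda>z. F z $ l)"
proof -
  define S where "S = (\<Union>l. spectrum \<Omega> (\<lambda>z. F z $ l))"
  have "countable S" unfolding S_def by (intro countable_UN HAP_spectrum_countable[OF F \<Omega>]) auto
  then obtain t where t: "\<And>\<mu>. \<mu> \<in> S \<Longrightarrow> (\<lambda>n. cis (t n \<bullet> \<mu>)) \<longlonglongrightarrow> \<gamma> \<mu>"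
    by (rule character_sequence[OF _ \<gamma>]) (rule that)
  define H where "H = (\<lambda>n. restrict (\<lambda>z. F (z + rvec (t n))) (tube \<Omega>))"
  have H: "H n \<in> HAP \<Omega>" for n unfolding H_def by (rule translate_HAP[OF F \<Omega>(1)])
  have cau: "\<exists>N. \<forall>n\<ge>N. \<forall>m\<ge>N. near K \<epsilon> (H n) (H m)" if K: "compact K" "K \<subseteq> \<Omega>" and e: "0 < \<epsilon>" for K \<epsilon>
  proof -
    have "\<exists>Q. \<forall>\<^sub>F n in sequentially. \<forall>x. \<forall>y\<in>K. cmod (H n (cplx x y) $ l - Q x y) \<le> \<epsilon>/2" for l
    proof -
      obtain A b where A: "finite A" "A \<subseteq> spectrum \<Omega> (\<lambda>z. F z $ l)"
        "\<And>x y. y \<in> K \<Longrightarrow> cmod (F (cplx x y) $ l - (\<Sum>\<mu>\<in>A. b \<mu> * exp (\<i> * herm (cplx x y) (rvec \<mu>)))) \<le> \<epsilon>/4"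
        by (rule HAP_approximation[OF F \<Omega>(1,2) K, of "\<epsilon>/4" l]) (use e in simp, rule that)
      have "\<forall>\<mu>. \<exists>E>0. \<forall>x. \<forall>y\<in>K. cmod (exp (\<i> * herm (cplx x y) (rvec \<mu>))) \<le> E"
        by (rule allI) (rule exp_wave_bounded[OF K(1)])
      from choice[OF this] obtain E where E: "\<forall>\<mu>. E \<mu> > 0 \<and> (\<forall>x. \<forall>y\<in>K. cmod (exp (\<i> * herm (cplx x
          y) (rvec \<mu>))) \<le> E \<mu>)"
        by (elim exE) (rule that)
      \<comment> \<open>The perturbation of the approximating sum is a comparison function that does
        not depend on \<open>n\<close>; all late translates are close to it, hence close to each
        other.\<close>
      define Q where "Q = (\<lambda>x y. \<Sum>\<mu>\<in>A. b \<mu> * exp (\<i> * herm (cplx x y) (rvec \<mu>)) * \<gamma> \<mu>)"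
      have "(\<lambda>n. \<Sum>\<mu>\<in>A. cmod (b \<mu>) * E \<mu> * cmod (cis (t n \<bullet> \<mu>) - \<gamma> \<mu>)) \<longlonglongrightarrow> (\<Sum>\<mu>\<in>A. cmod (b \<mu>) * E \<mu> *
          cmod (\<gamma> \<mu> - \<gamma> \<mu>))"
        by (intro tendsto_sum tendsto_mult tendsto_norm tendsto_diff tendsto_const t) (use A(2) in
            \<open>auto simp: S_def\<close>)
      then have "(\<lambda>n. \<Sum>\<mu>\<in>A. cmod (b \<mu>) * E \<mu> * cmod (cis (t n \<bullet> \<mu>) - \<gamma> \<mu>)) \<longlonglongrightarrow> 0" by simp
      then have "\<forall>\<^sub>F n in sequentially. (\<Sum>\<mu>\<in>A. cmod (b \<mu>) * E \<mu> * cmod (cis (t n \<bullet> \<mu>) - \<gamma> \<mu>)) < \<epsilon>/4"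
        by (rule order_tendstoD(2)) (use e in simp)
      then have "\<forall>\<^sub>F n in sequentially. \<forall>x. \<forall>y\<in>K. cmod (H n (cplx x y) $ l - Q x y) \<le> \<epsilon>/2"
      proof eventually_elim
        case (elim n)
        show ?case
        proof (intro allI ballI)
          fix x y assume y: "y \<in> K"
          have Hn: "H n (cplx x y) = F (cplx (x + t n) y)" using y K by (auto simp: H_def cplx_plus_rvec)
          have 1: "cmod (H n (cplx x y) $ l - (\<Sum>\<mu>\<in>A. b \<mu> * exp (\<i> * herm (cplx (x + t n) y) (rvec
              \<mu>)))) \<le> \<epsilon>/4"
            unfolding Hn by (rule A(3)[OF y])
          have "(\<Sum>\<mu>\<in>A. b \<mu> * exp (\<i> * herm (cplx (x + t n) y) (rvec \<mu>))) - Q x y =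
              (\<Sum>\<mu>\<in>A. b \<mu> * exp (\<i> * herm (cplx x y) (rvec \<mu>)) * (cis (t n \<bullet> \<mu>) - \<gamma> \<mu>))"
            unfolding Q_def sum_subtractf[symmetric]
          proof (rule sum.cong[OF refl])
            fix \<mu>
            have "exp (\<i> * herm (cplx (x + t n) y) (rvec \<mu>)) = exp (\<i> * herm (cplx x y) (rvec \<mu>))
                * cis (t n \<bullet> \<mu>)"
              unfolding exp_herm by (simp only: inner_add_left cis_mult[symmetric] mult.assoc)
            then show "b \<mu> * exp (\<i> * herm (cplx (x + t n) y) (rvec \<mu>)) - b \<mu> * exp (\<i> * herm
                (cplx x y) (rvec \<mu>)) * \<gamma> \<mu> =
                b \<mu> * exp (\<i> * herm (cplx x y) (rvec \<mu>)) * (cis (t n \<bullet> \<mu>) - \<gamma> \<mu>)"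
              by (simp only: right_diff_distrib mult.assoc)
          qed
          also have "cmod \<dots> \<le> (\<Sum>\<mu>\<in>A. cmod (b \<mu>) * E \<mu> * cmod (cis (t n \<bullet> \<mu>) - \<gamma> \<mu>))"
          proof (rule order_trans[OF norm_sum], rule sum_mono)
            fix \<mu>
            have "cmod (exp (\<i> * herm (cplx x y) (rvec \<mu>))) \<le> E \<mu>" using E y by blast
            then show "cmod (b \<mu> * exp (\<i> * herm (cplx x y) (rvec \<mu>)) * (cis (t n \<bullet> \<mu>) - \<gamma> \<mu>)) \<le>
                cmod (b \<mu>) * E \<mu> * cmod (cis (t n \<bullet> \<mu>) - \<gamma> \<mu>)"
              unfolding norm_mult by (intro mult_right_mono mult_left_mono) auto
          qed
          finally have 2: "cmod ((\<Sum>\<mu>\<in>A. b \<mu> * exp (\<i> * herm (cplx (x + t n) y) (rvec \<mu>))) - Q x y) \<le> \<epsilon>/4"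
            using elim by linarith
          show "cmod (H n (cplx x y) $ l - Q x y) \<le> \<epsilon>/2"
            using norm_diff_triangle_le[OF 1 2] by simp
        qed
      qed
      then show ?thesis by blast
    qed
    then have "\<forall>l. \<exists>Q. \<forall>\<^sub>F n in sequentially. \<forall>x. \<forall>y\<in>K. cmod (H n (cplx x y) $ l - Q x y) \<le> \<epsilon>/2" by blast
    from choice[OF this] obtain Q where Q: "\<forall>l. \<forall>\<^sub>F n in sequentially. \<forall>x. \<forall>y\<in>K. cmod (H n (cplx x
        y) $ l - Q l x y) \<le> \<epsilon>/2"
      by (elim exE) (rule that)
    have "\<forall>\<^sub>F n in sequentially. \<forall>l\<in>UNIV. \<forall>x. \<forall>y\<in>K. cmod (H n (cplx x y) $ l - Q l x y) \<le> \<epsilon>/2"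
      by (intro eventually_ball_finite ballI finite) (rule spec[OF Q])
    then obtain N where N: "\<forall>n\<ge>N. \<forall>l\<in>UNIV. \<forall>x. \<forall>y\<in>K. cmod (H n (cplx x y) $ l - Q l x y) \<le> \<epsilon>/2"
      unfolding eventually_sequentially by (elim exE) (rule that)
    have "near K \<epsilon> (H n) (H m)" if nm: "n \<ge> N" "m \<ge> N" for n m
      unfolding near_def
    proof (intro allI ballI)
      fix x y l assume y: "y \<in> K"
      have 1: "cmod (H n (cplx x y) $ l - Q l x y) \<le> \<epsilon>/2" using N nm(1) y by blast
      have "cmod (H m (cplx x y) $ l - Q l x y) \<le> \<epsilon>/2" using N nm(2) y by blast
      then have 2: "cmod (Q l x y - H m (cplx x y) $ l) \<le> \<epsilon>/2" by (simp only: norm_minus_commute)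
      show "cmod (H n (cplx x y) $ l - H m (cplx x y) $ l) \<le> \<epsilon>"
        using norm_diff_triangle_le[OF 1 2] by simp
    qed
    then show ?thesis by blast
  qed
  obtain G where G: "G \<in> HAP \<Omega>" "\<And>K \<epsilon>. compact K \<Longrightarrow> K \<subseteq> \<Omega> \<Longrightarrow> 0 < \<epsilon> \<Longrightarrow> \<exists>N. \<forall>k\<ge>N. near K \<epsilon> (H k) G"
  proof (rule HAP_complete[OF \<Omega>(1) H])
    fix K and \<epsilon> :: real assume "compact K" "K \<subseteq> \<Omega>" "0 < \<epsilon>"
    then show "\<exists>N. \<forall>n\<ge>N. \<forall>m\<ge>N. near K \<epsilon> (H n) (H m)" by (rule cau)
  next
    fix G assume "G \<in> HAP \<Omega>" "\<And>K \<epsilon>. compact K \<Longrightarrow> K \<subseteq> \<Omega> \<Longrightarrow> 0 < \<epsilon> \<Longrightarrow> \<exists>N. \<forall>k\<ge>N. near K \<epsilon> (H k) G"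
    then show thesis by (rule that)
  qed
  show thesis
  proof (rule that)
    show "G \<in> hap_topology \<Omega> closure_of bochner_transform \<Omega> F"
      unfolding hap_closure_iff
    proof (intro conjI allI impI G(1))
      fix K and \<epsilon> :: real assume "compact K" "K \<subseteq> \<Omega>" "0 < \<epsilon>"
      from G(2)[OF this] obtain k where "near K \<epsilon> (H k) G" by blast
      moreover have "H k \<in> bochner_transform \<Omega> F" unfolding H_def bochner_transform_def by blast
      ultimately show "\<exists>H\<in>bochner_transform \<Omega> F. H \<in> HAP \<Omega> \<and> near K \<epsilon> H G" using H by blast
    qed
    fix \<mu> l
    let ?a = "fourier_coeff \<Omega> \<mu> (\<lambda>z. F z $ l)" and ?g = "fourier_coeff \<Omega> \<mu> (\<lambda>z. G z $ l)"
    obtain y where y: "y \<in> \<Omega>" using \<Omega>(3) by blast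
    have "(\<lambda>n. cis (t n \<bullet> \<mu>) * ?a) \<longlonglongrightarrow> ?g"
    proof (rule metric_LIMSEQ_I)
      fix e :: real assume e: "e > 0"
      define e1 where "e1 = e / (2 * exp (y \<bullet> \<mu>))"
      have e1: "e1 > 0" using e by (simp add: e1_def)
      obtain N where N: "\<forall>k\<ge>N. near {y} e1 (H k) G" using G(2)[of "{y}" e1] y e1 by auto
      have "dist (cis (t n \<bullet> \<mu>) * ?a) ?g < e" if "n \<ge> N" for n
      proof -
        have "near {y} e1 (H n) G" using N that by blast
        from fourier_coeff_near[OF H G(1) \<Omega>(1,2) y this, of \<mu> l]
        have "cmod (cis (t n \<bullet> \<mu>) * ?a - ?g) \<le> exp (y \<bullet> \<mu>) * e1"
          unfolding H_def translate_fourier_coeff[OF F \<Omega>] .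
        also have "\<dots> < e" using e by (simp add: e1_def)
        finally show ?thesis by (simp only: dist_norm)
      qed
      then show "\<exists>N. \<forall>n\<ge>N. dist (cis (t n \<bullet> \<mu>) * ?a) ?g < e" by blast
    qed
    \<comment> \<open>Convergence of the waves is known only on the spectrum, but off it both sides
      vanish.\<close>
    moreover have "(\<lambda>n. cis (t n \<bullet> \<mu>) * ?a) \<longlonglongrightarrow> \<gamma> \<mu> * ?a"
    proof (cases "?a = 0")
      case False
      then have "\<mu> \<in> S" by (auto simp: S_def spectrum_def)
      then show ?thesis by (intro tendsto_mult t tendsto_const)
    qed simp
    ultimately show "?g = \<gamma> \<mu> * ?a" by (rule LIMSEQ_unique)
  qed
qed

theorem theorem3p2:
  fixes \<Omega> :: "(real ^ 'n) set" and F :: "complex ^ 'n \<Rightarrow> complex ^ 'm"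
  assumes "\<Omega> \<noteq> {}" and "open \<Omega>" and "convex \<Omega>"
    and "F \<in> HAP \<Omega>"
  shows "perturbations \<Omega> F = hap_topology \<Omega> closure_of bochner_transform \<Omega> F"
proof (intro equalityI subsetI)
  fix G assume "G \<in> perturbations \<Omega> F"
  then obtain \<gamma> where \<gamma>: "\<gamma> \<in> characters" "G = perturb \<Omega> F \<gamma>" unfolding perturbations_def by blast
  \<comment> \<open>The limit of translates is built before anything is known about
    \<open>perturb \<Omega> F \<gamma>\<close>; comparing coefficients then identifies the
    two.\<close>
  obtain G' where G': "G' \<in> hap_topology \<Omega> closure_of bochner_transform \<Omega> F"
    "\<And>\<mu> l. fourier_coeff \<Omega> \<mu> (\<lambda>z. G' z $ l) = \<gamma> \<mu> * fourier_coeff \<Omega> \<mu> (\<lambda>z. F z $ l)"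
    by (rule character_imp_closure[OF assms(4,2,3,1) \<gamma>(1)]) (rule that)
  have "G' \<in> HAP \<Omega>" using G'(1) unfolding hap_closure_iff by blast
  then have "G = G'" unfolding \<gamma>(2) by (rule perturb_eqI[OF assms(4) _ assms(2,3,1) \<gamma>(1) G'(2)])
  then show "G \<in> hap_topology \<Omega> closure_of bochner_transform \<Omega> F" using G'(1) by simp
next
  fix G assume G: "G \<in> hap_topology \<Omega> closure_of bochner_transform \<Omega> F"
  obtain \<gamma> where \<gamma>: "\<gamma> \<in> characters"
    "\<And>\<mu> l. fourier_coeff \<Omega> \<mu> (\<lambda>z. G z $ l) = \<gamma> \<mu> * fourier_coeff \<Omega> \<mu> (\<lambda>z. F z $ l)"
    by (rule closure_imp_twist[OF assms(4,2,3,1) G]) (rule that)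
  have "G \<in> HAP \<Omega>" using G unfolding hap_closure_iff by blast
  then have "perturb \<Omega> F \<gamma> = G" by (rule perturb_eqI[OF assms(4) _ assms(2,3,1) \<gamma>])
  then show "G \<in> perturbations \<Omega> F" unfolding perturbations_def using \<gamma>(1) by blast
qed

end
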